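(* Let $\{X_t\}$ be a stationary AR(1) process $X_t=\theta X_{t-1}+Z_t$ with $|\theta|<1$, where the $Z_t$ are i.i.d. with mean $0$, variance $\sigma^2\in(0,\infty)$ and $EZ_t^4<\infty$. Let $\{w_{nt}:1\le t\le n,\ n\ge 1\}$ be a triangular array of row-exchangeable random variables, independent of $\{X_t\}$, and put $\sigma_n^2=\mathrm{Var}(w_{n1})$ and $W_{nt}=\sigma_n^{-1}(w_{nt}-1)$. Assume: (A1) $E(w_{n1})=1$; (A2) there is a constant $k>0$ with $\sigma_n^2>k$ for all $n$, and $\sigma_n^2=o(n)$; (A3) $\mathrm{Cov}(w_{n1},w_{n2})=O(n^{-1})$; (A4) $E(W_{nj})=0$ and $E(W_{nj}^2)=1$ for all $1\le j\le n$, $n\ge1$; $\frac1n\sum_{j=1}^n W_{nj}^2\to 1$ in probability; and $\lim_{K\to\infty}\limsup_{n\to\infty}\sqrt{E\big(W_{nj}^2 I_{\{|W_{nj}|>K\}}\big)}=0$. Let $$\hat\theta_n=\frac{\sum_{t=2}^n X_tX_{t-1}}{\sum_{t=2}^n X_{t-1}^2},\qquad \hat\theta_n^*=\frac{\sum_{t=2}^n w_{nt}X_tX_{t-1}}{\sum_{t=2}^n w_{nt}X_{t-1}^2}.$$ Then for every $x\in\mathbb{R}$, as $n\to\infty$, $$P_B\big[\sqrt n\,\sigma_n^{-1}(\hat\theta_n^*-\hat\theta_n)\le x \,\big|\, X_1,\dots,X_n\big]-P[Y\le x]=o_P(1),$$ where $Y\sim N(0,1-\theta^2)$.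
   Context: $P_B$ denotes probability with respect to the distribution of the weights, conditional on the data $X_1,\dots,X_n$. $o_P(1)$ denotes a sequence converging to $0$ in probability. A triangular array is row exchangeable if for each $n$ the vector $(w_{n1},\dots,w_{nn})$ has an exchangeable joint distribution. For the stationary AR(1) process, $Z_t$ is independent of $\{X_s: s<t\}$. *)

theory Defs
  imports "HOL-Probability.Probability" "HOL-Library.Landau_Symbols"
    "HOL-Combinatorics.Permutations"
begin

definition covariance :: "'a measure \<Rightarrow> ('a \<Rightarrow> real) \<Rightarrow> ('a \<Rightarrow> real) \<Rightarrow> real" where
  "covariance M U V =
     integral\<^sup>L M (\<lambda>\<omega>. (U \<omega> - integral\<^sup>L M U) * (V \<omega> - integral\<^sup>L M V))"

definition converges_in_prob :: "'a measure \<Rightarrow> (nat \<Rightarrow> 'a \<Rightarrow> real) \<Rightarrow> real \<Rightarrow> bool" where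
  "converges_in_prob M V c \<longleftrightarrow>
     (\<forall>\<epsilon>>0. (\<lambda>n. measure M {\<omega> \<in> space M. \<bar>V n \<omega> - c\<bar> > \<epsilon>}) \<longlonglongrightarrow> 0)"

text \<open>Independence of random elements with values in possibly different types;
  \<^const>\<open>prob_space.indep_var\<close> needs both to take values in the same type.\<close>

definition indep_elements ::
    "'a measure \<Rightarrow> 'b measure \<Rightarrow> ('a \<Rightarrow> 'b) \<Rightarrow> 'c measure \<Rightarrow> ('a \<Rightarrow> 'c) \<Rightarrow> bool" where
  "indep_elements M S U T V \<longleftrightarrow>
     U \<in> measurable M S \<and> V \<in> measurable M T \<and>
     prob_space.indep_set M (sets (vimage_algebra (space M) U S))
                            (sets (vimage_algebra (space M) V T))"

definition strictly_stationary :: "'a measure \<Rightarrow> (int \<Rightarrow> 'a \<Rightarrow> real) \<Rightarrow> bool" where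
  "strictly_stationary M X \<longleftrightarrow>
     (\<forall>J h. finite J \<longrightarrow>
        distr M (\<Pi>\<^sub>M t\<in>J. borel) (\<lambda>\<omega>. \<lambda>t\<in>J. X (t + h) \<omega>) =
        distr M (\<Pi>\<^sub>M t\<in>J. borel) (\<lambda>\<omega>. \<lambda>t\<in>J. X t \<omega>))"

text \<open>Only the entries \<open>w n t\<close> with \<open>1 \<le> t \<le> n\<close> belong to a triangular array; the remaining
  values of the function \<open>w\<close> are irrelevant.\<close>

definition array_index :: "(nat \<times> nat) set" where
  "array_index = {(n, t). 1 \<le> t \<and> t \<le> n}"

definition row_exchangeable :: "'a measure \<Rightarrow> (nat \<Rightarrow> nat \<Rightarrow> 'a \<Rightarrow> real) \<Rightarrow> bool" where
  "row_exchangeable M w \<longleftrightarrow>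
     (\<forall>n \<pi>. \<pi> permutes {1..n} \<longrightarrow>
        distr M (\<Pi>\<^sub>M t\<in>{1..n}. borel) (\<lambda>\<omega>. \<lambda>t\<in>{1..n}. w n (\<pi> t) \<omega>) =
        distr M (\<Pi>\<^sub>M t\<in>{1..n}. borel) (\<lambda>\<omega>. \<lambda>t\<in>{1..n}. w n t \<omega>))"

definition weight_sd :: "'a measure \<Rightarrow> (nat \<Rightarrow> nat \<Rightarrow> 'a \<Rightarrow> real) \<Rightarrow> nat \<Rightarrow> real" where
  "weight_sd M w n = sqrt (prob_space.variance M (w n 1))"

definition std_weight ::
    "'a measure \<Rightarrow> (nat \<Rightarrow> nat \<Rightarrow> 'a \<Rightarrow> real) \<Rightarrow> nat \<Rightarrow> nat \<Rightarrow> 'a \<Rightarrow> real" where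
  "std_weight M w n t \<omega> = (w n t \<omega> - 1) / weight_sd M w n"

definition ls_estimator :: "(int \<Rightarrow> 'a \<Rightarrow> real) \<Rightarrow> nat \<Rightarrow> 'a \<Rightarrow> real" where
  "ls_estimator X n \<omega> =
     (\<Sum>t=2..n. X (int t) \<omega> * X (int t - 1) \<omega>) / (\<Sum>t=2..n. (X (int t - 1) \<omega>)\<^sup>2)"

definition weighted_ls_estimator ::
    "(nat \<Rightarrow> nat \<Rightarrow> 'a \<Rightarrow> real) \<Rightarrow> (int \<Rightarrow> 'a \<Rightarrow> real) \<Rightarrow> nat \<Rightarrow> 'a \<Rightarrow> real" where
  "weighted_ls_estimator w X n \<omega> =
     (\<Sum>t=2..n. w n t \<omega> * X (int t) \<omega> * X (int t - 1) \<omega>) /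
     (\<Sum>t=2..n. w n t \<omega> * (X (int t - 1) \<omega>)\<^sup>2)"

definition data_algebra :: "'a measure \<Rightarrow> (int \<Rightarrow> 'a \<Rightarrow> real) \<Rightarrow> nat \<Rightarrow> 'a measure" where
  "data_algebra M X n =
     vimage_algebra (space M) (\<lambda>\<omega>. \<lambda>t\<in>{1..int n}. X t \<omega>) (\<Pi>\<^sub>M t\<in>{1..int n}. borel)"

definition cond_prob_data ::
    "'a measure \<Rightarrow> (int \<Rightarrow> 'a \<Rightarrow> real) \<Rightarrow> nat \<Rightarrow> ('a \<Rightarrow> bool) \<Rightarrow> 'a \<Rightarrow> real" where
  "cond_prob_data M X n P =
     real_cond_exp M (data_algebra M X n) (indicator {\<omega> \<in> space M. P \<omega>})"

end

theory Submission
  imports Defs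
begin

text \<open>Write \<open>W\<close> for the standardized weights, \<open>\<xi>\<^sub>t = X\<^sub>t\<^sub>-\<^sub>1 Z\<^sub>t\<close> and \<open>m = E X\<^sub>0\<^sup>2\<close>. Up to terms vanishing in
  probability the rescaled contrast is \<open>T / m\<close> with \<open>T = n\<^sup>-\<^sup>1\<^sup>/\<^sup>2 \<Sum> W\<^sub>t \<xi>\<^sub>t\<close>. No permutation central limit
  theorem is needed for the conditional law of \<open>T\<close>. Let \<open>\<phi>\<close> be its conditional characteristic
  function and \<open>c\<close> its Gaussian limit. Then \<open>E \<bar>\<phi> - c\<bar>\<^sup>2 = E \<bar>\<phi>\<bar>\<^sup>2 - 2 c Re (E \<phi>) + c\<^sup>2\<close>, and
  \<open>E \<bar>\<phi>\<bar>\<^sup>2\<close> is the characteristic function of \<open>n\<^sup>-\<^sup>1\<^sup>/\<^sup>2 \<Sum> (W\<^sub>t - W'\<^sub>t) \<xi>\<^sub>t\<close> for an independent copy \<open>W'\<close> of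
  the weights. By Fubini the weights may be held fixed, and what remains is a central limit theorem
  for the martingale differences \<open>\<xi>\<^sub>t\<close> with deterministic coefficients. Exchangeability only enters
  through the common covariance of the weights.\<close>

subsection \<open>Laws close to the normal law, convergence in probability\<close>

text \<open>The error terms are controlled by second moments on the product of the weight space and
  the data space. The obstacle is the weighted denominator \<open>Q + sd * B\<close>: the squares
  \<open>x^2\<close> are not centred, so all pairs of weights contribute to the second moment of
  \<open>sd * B\<close>. The diagonal leaves \<open>sd^2 / n\<close> and the remaining pairs leave
  \<open>sd^2 * \<rho>\<close>, the covariance of two raw weights; these are exactly what the growth
  condition on the variance and (A3) make vanish. The lower bound \<open>k\<close> turns (A3) into
  \<open>\<rho> \<longlonglongrightarrow> 0\<close>, which decorrelates the two replicas: the
  coefficients \<open>W - W'\<close> then have mean square 2 in the limit, and the limits match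
  because \<open>exp (- u^2)\<close> is the square of \<open>exp (- u^2 / 2)\<close>. The tail
  condition on \<open>W\<close> makes all coefficients uniformly small, the other input of the
  martingale limit theorem. Fourth moments are given for the innovations only; those of
  \<open>X\<close> have to be extracted from stationarity. The limiting scale
  \<open>c0 / m = \<sigma> / sqrt m\<close> equals \<open>sqrt (1 - \<theta>^2)\<close> by the
  stationary equation for \<open>m\<close>.\<close>

lemma cmod_iexp_diff_le: "cmod (iexp a - iexp b) \<le> \<bar>a - b\<bar>"
proof -
  have "iexp a - iexp b = iexp b * (iexp (a - b) - 1)"
    by (simp add: algebra_simps flip: exp_add)
  then have "cmod (iexp a - iexp b) = cmod (iexp (a - b) - 1)"
    by (simp add: norm_mult)
  also have "\<dots> \<le> \<bar>a - b\<bar>"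
    using iexp_approx1[of "a - b" 0] by simp
  finally show ?thesis .
qed

text \<open>The Lipschitz constant of \<open>iexp (u * y)\<close> in the frequency is
  \<open>\<bar>y\<bar>\<close>, which is integrated against the law. The moment is an extended
  integral, so a finite bound on it includes integrability. The resulting equicontinuity over all
  laws with the same bound is what lets rational frequencies decide convergence at every real
  one.\<close>

lemma char_lipschitz:
  assumes \<mu>: "real_distribution \<mu>" and C: "C \<ge> 0" "(\<integral>\<^sup>+y. ennreal \<bar>y\<bar> \<partial>\<mu>) \<le> ennreal C"
  shows "cmod (char \<mu> u - char \<mu> v) \<le> C * \<bar>u - v\<bar>"
proof -
  interpret real_distribution \<mu> by fact
  have int: "integrable \<mu> (\<lambda>y. \<bar>y\<bar>)"
  proof (rule integrableI_bounded)
    show "(\<integral>\<^sup>+y. ennreal (norm \<bar>y\<bar>) \<partial>\<mu>) < \<infinity>"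
      using C(2) by (simp add: le_less_trans ennreal_less_top)
  qed auto
  have "ennreal (\<integral>y. \<bar>y\<bar> \<partial>\<mu>) \<le> ennreal C"
    using C nn_integral_eq_integral[OF int] by simp
  then have le: "(\<integral>y. \<bar>y\<bar> \<partial>\<mu>) \<le> C" using C(1) by (simp add: ennreal_le_iff)
  have "char \<mu> u - char \<mu> v = (CLINT y|\<mu>. iexp (u * y) - iexp (v * y))"
    unfolding char_def by (intro Bochner_Integration.integral_diff[symmetric] integrable_iexp) auto
  also have "cmod \<dots> \<le> (\<integral>y. \<bar>u - v\<bar> * \<bar>y\<bar> \<partial>\<mu>)"
  proof (rule Bochner_Integration.integral_norm_bound_integral)
    show "integrable \<mu> (\<lambda>y. iexp (u * y) - iexp (v * y))"
      by (intro Bochner_Integration.integrable_diff integrable_iexp) auto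
    show "integrable \<mu> (\<lambda>y. \<bar>u - v\<bar> * \<bar>y\<bar>)" using int by simp
    show "cmod (iexp (u * y) - iexp (v * y)) \<le> \<bar>u - v\<bar> * \<bar>y\<bar>" for y
      using cmod_iexp_diff_le[of "u * y" "v * y"] by (simp add: abs_mult flip: left_diff_distrib)
  qed
  also have "\<dots> \<le> C * \<bar>u - v\<bar>" using mult_right_mono[OF le, of "\<bar>u - v\<bar>"] by (simp add: mult.commute)
  finally show ?thesis .
qed

text \<open>Weak convergence gives convergence of distribution functions only at continuity points.
  A law with a density has no atoms.\<close>

lemma isCont_cdf_std_normal: "isCont (cdf std_normal_distribution) y"
proof -
  interpret real_distribution std_normal_distribution by (rule real_dist_normal_dist)
  have "{y} \<in> null_sets lborel" by (simp add: null_sets_def)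
  then have "{y} \<in> null_sets std_normal_distribution"
    using absolutely_continuousI_density[of "\<lambda>y. ennreal (std_normal_density y)" lborel]
    unfolding absolutely_continuous_def by auto
  then show ?thesis unfolding isCont_cdf by (simp add: measure_def null_sets_def)
qed

text \<open>A compactness argument on top of Levy's continuity theorem: it makes the theorem
  quantitative, so that it applies to random laws whose characteristic functions converge only in
  probability. The moment bound lets countably many frequencies suffice.\<close>

lemma cdf_close_std_normal:
  fixes C \<epsilon> y :: real
  assumes C: "C \<ge> 0" and \<epsilon>: "\<epsilon> > 0"
  shows "\<exists>U \<delta>. finite U \<and> \<delta> > 0 \<and>
    (\<forall>\<mu>. real_distribution \<mu> \<longrightarrow> (\<integral>\<^sup>+y. ennreal \<bar>y\<bar> \<partial>\<mu>) \<le> ennreal C \<longrightarrow>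
      (\<forall>u\<in>U. cmod (char \<mu> u - char std_normal_distribution u) < \<delta>) \<longrightarrow>
      \<bar>cdf \<mu> y - cdf std_normal_distribution y\<bar> < \<epsilon>)"
proof (rule ccontr)
  let ?N = "std_normal_distribution"
  assume neg: "\<not> ?thesis"
  \<comment> \<open>The sequence runs through all rationals. The \<open>k\<close>-th counterexample
    law agrees with the normal law on the first \<open>k + 1\<close> of them up to
    \<open>1 / Suc k\<close>.\<close>
  define q :: "nat \<Rightarrow> real" where "q i = of_rat (from_nat i)" for i
  have "\<exists>\<mu>. real_distribution \<mu> \<and> (\<integral>\<^sup>+y. ennreal \<bar>y\<bar> \<partial>\<mu>) \<le> ennreal C \<and>
      (\<forall>u\<in>q ` {..k}. cmod (char \<mu> u - char ?N u) < 1 / Suc k) \<and>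
      \<not> \<bar>cdf \<mu> y - cdf ?N y\<bar> < \<epsilon>" for k :: nat
  proof -
    have "finite (q ` {..k}) \<and> 1 / Suc k > (0::real)" by simp
    then show ?thesis using neg by (meson)
  qed
  then obtain \<mu> where \<mu>: "\<And>k. real_distribution (\<mu> k)"
    "\<And>k. (\<integral>\<^sup>+y. ennreal \<bar>y\<bar> \<partial>\<mu> k) \<le> ennreal C"
    "\<And>k i. i \<le> k \<Longrightarrow> cmod (char (\<mu> k) (q i) - char ?N (q i)) < 1 / Suc k"
    "\<And>k. \<bar>cdf (\<mu> k) y - cdf ?N y\<bar> \<ge> \<epsilon>"
    by (metis atMost_iff imageI not_le)
  have "(\<lambda>k. char (\<mu> k) u) \<longlonglongrightarrow> char ?N u" for u
  proof (rule metric_LIMSEQ_I)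
    fix r :: real assume r: "r > 0"
    have "\<forall>e>0. \<exists>d>0. \<forall>v. dist v u < d \<longrightarrow> dist (char ?N v) (char ?N u) < e"
      using real_distribution.isCont_char[OF real_dist_normal_dist, of u]
      by (simp add: continuous_at_eps_delta)
    then obtain d where d: "d > 0" "\<And>v. dist v u < d \<Longrightarrow> dist (char ?N v) (char ?N u) < r / 3"
      using r by (meson divide_pos_pos zero_less_numeral)
    \<comment> \<open>\<open>d\<close> controls the normal characteristic function, and the second
      entry controls those of all \<open>\<mu> k\<close> uniformly in \<open>k\<close>;
      \<open>C + 1\<close> keeps the quotient defined for \<open>C = 0\<close>.\<close>
    define e where "e = min d (r / (3 * (C + 1)))"
    have e: "e > 0" using d r C by (auto simp: e_def)
    obtain p where p: "u - e < of_rat p" "of_rat p < u"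
      using of_rat_dense[of "u - e" u] e by auto
    define i where "i = to_nat p"
    have qi: "q i = of_rat p" by (simp add: q_def i_def)
    have du: "\<bar>q i - u\<bar> < e" using p qi by auto
    obtain K :: nat where K: "real K > 3 / r" using reals_Archimedean2 by blast
    have "dist (char (\<mu> k) u) (char ?N u) < r" if k: "k \<ge> max i K" for k
    proof -
      have 1: "cmod (char (\<mu> k) u - char (\<mu> k) (q i)) \<le> C * \<bar>u - q i\<bar>"
        by (rule char_lipschitz[OF \<mu>(1) C \<mu>(2)])
      have "C * \<bar>u - q i\<bar> \<le> C * (r / (3 * (C + 1)))"
        using du C by (intro mult_left_mono) (auto simp: e_def)
      also have "\<dots> \<le> r / 3" using C r by (simp add: field_simps)
      finally have 1: "cmod (char (\<mu> k) u - char (\<mu> k) (q i)) \<le> r / 3" using 1 by simp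
      have 2: "cmod (char (\<mu> k) (q i) - char ?N (q i)) < 1 / Suc k" using \<mu>(3)[of i k] k by simp
      have "1 / Suc k < r / 3"
      proof -
        have "3 / r < Suc k" using K k by simp
        then show ?thesis using r by (simp add: field_simps)
      qed
      note 2 = less_trans[OF 2 this]
      have 3: "cmod (char ?N (q i) - char ?N u) < r / 3"
        using d(2)[of "q i"] du by (simp add: dist_norm e_def)
      have "char (\<mu> k) u - char ?N u = (char (\<mu> k) u - char (\<mu> k) (q i))
          + (char (\<mu> k) (q i) - char ?N (q i)) + (char ?N (q i) - char ?N u)" by simp
      then have "cmod (char (\<mu> k) u - char ?N u) \<le> cmod (char (\<mu> k) u - char (\<mu> k) (q i))
          + cmod (char (\<mu> k) (q i) - char ?N (q i)) + cmod (char ?N (q i) - char ?N u)"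
        by (metis norm_triangle_ineq norm_triangle_mono order_refl)
      then show ?thesis using 1 2 3 by (simp add: dist_norm)
    qed
    then show "\<exists>no. \<forall>k\<ge>no. dist (char (\<mu> k) u) (char ?N u) < r" by blast
  qed
  then have "weak_conv_m \<mu> ?N"
    by (intro levy_continuity \<mu>(1) real_dist_normal_dist)
  then have "(\<lambda>k. cdf (\<mu> k) y) \<longlonglongrightarrow> cdf ?N y"
    using isCont_cdf_std_normal by (auto simp: weak_conv_m_def weak_conv_def)
  then obtain k where "\<bar>cdf (\<mu> k) y - cdf ?N y\<bar> < \<epsilon>"
    using \<epsilon> by (metis LIMSEQ_D order_refl real_norm_def)
  then show False using \<mu>(4)[of k] by simp
qed

section \<open>Convergence in probability and tightness\<close>

lemma less_abs_iff_power2: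
  fixes v C :: real
  assumes "C \<ge> 0"
  shows "C < \<bar>v\<bar> \<longleftrightarrow> C\<^sup>2 < v\<^sup>2"
  using abs_le_square_iff[of v C] assms by linarith

text \<open>The bound is asked for eventually only, so that convergence in probability yields it
  without treating initial terms.\<close>

definition (in prob_space) tight_seq :: "(nat \<Rightarrow> 'a \<Rightarrow> real) \<Rightarrow> bool" where
  "tight_seq V \<longleftrightarrow> (\<forall>\<eta>>0. \<exists>C>0. \<forall>\<^sub>F n in sequentially. prob {\<omega>\<in>space M. \<bar>V n \<omega>\<bar> > C} < \<eta>)"

context prob_space begin

lemma converges_in_probI:
  assumes "\<And>\<epsilon> \<eta>. \<epsilon> > 0 \<Longrightarrow> \<eta> > 0 \<Longrightarrow>
    \<forall>\<^sub>F n in sequentially. prob {\<omega>\<in>space M. \<bar>V n \<omega> - c\<bar> > \<epsilon>} < \<eta>"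
  shows "converges_in_prob M V c"
  unfolding converges_in_prob_def
proof (intro allI impI)
  fix \<epsilon> :: real assume "\<epsilon> > 0"
  from assms[OF this] show "(\<lambda>n. prob {\<omega>\<in>space M. \<bar>V n \<omega> - c\<bar> > \<epsilon>}) \<longlonglongrightarrow> 0"
    by (intro order_tendstoI) (auto intro!: always_eventually less_le_trans[OF _ measure_nonneg])
qed

lemma converges_in_probD:
  assumes "converges_in_prob M V c" "\<epsilon> > 0" "\<eta> > 0"
  shows "\<forall>\<^sub>F n in sequentially. prob {\<omega>\<in>space M. \<bar>V n \<omega> - c\<bar> > \<epsilon>} < \<eta>"
  using assms unfolding converges_in_prob_def by (auto intro: order_tendstoD)

lemma prob_union_less:
  assumes "A \<subseteq> B \<union> C" "B \<in> events" "C \<in> events" "prob B < a" "prob C < b"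
  shows "prob A < a + b"
proof -
  have "prob A \<le> prob (B \<union> C)" using assms by (intro finite_measure_mono) auto
  also have "\<dots> \<le> prob B + prob C" using assms by (intro measure_Un_le) auto
  finally show ?thesis using assms by linarith
qed

text \<open>Both weakenings of equality occur: conditional probabilities are determined only almost
  surely, and the normalized sums satisfy their identities for \<open>n \<ge> 1\<close> only, since
  division by zero yields 0.\<close>

lemma converges_in_prob_cong:
  assumes "\<forall>\<^sub>F n in sequentially. AE \<omega> in M. U n \<omega> = V n \<omega>" "converges_in_prob M V c"
    and [measurable]: "\<And>n. U n \<in> borel_measurable M" "\<And>n. V n \<in> borel_measurable M"
  shows "converges_in_prob M U c"
proof (rule converges_in_probI)
  fix \<epsilon> \<eta> :: real assume "\<epsilon> > 0" "\<eta> > 0"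
  from converges_in_probD[OF assms(2) this] assms(1)
  show "\<forall>\<^sub>F n in sequentially. prob {\<omega>\<in>space M. \<bar>U n \<omega> - c\<bar> > \<epsilon>} < \<eta>"
  proof eventually_elim
    case (elim n)
    have "prob {\<omega>\<in>space M. \<bar>U n \<omega> - c\<bar> > \<epsilon>} = prob {\<omega>\<in>space M. \<bar>V n \<omega> - c\<bar> > \<epsilon>}"
      using elim(2) by (intro measure_eq_AE) auto
    then show ?case using elim(1) by simp
  qed
qed

lemma markov_less:
  assumes "integrable M V" "\<And>\<omega>. V \<omega> \<ge> 0" "a > 0" "expectation V < a * b"
  shows "prob {\<omega>\<in>space M. V \<omega> > a} < b"
proof -
  have "prob {\<omega>\<in>space M. V \<omega> > a} \<le> prob {\<omega>\<in>space M. V \<omega> \<ge> a}"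
    using assms(1) by (intro finite_measure_mono) auto
  also have "\<dots> \<le> expectation V / a"
    using assms by (intro integral_Markov_inequality_measure[where A="{}"]) auto
  also have "\<dots> < b" using assms by (simp add: field_simps)
  finally show ?thesis .
qed

lemma converges_in_prob_L1:
  assumes int: "\<And>n. integrable M (V n)" and lim: "(\<lambda>n. expectation (\<lambda>\<omega>. \<bar>V n \<omega>\<bar>)) \<longlonglongrightarrow> 0"
  shows "converges_in_prob M V 0"
proof (rule converges_in_probI)
  fix \<epsilon> \<eta> :: real assume "\<epsilon> > 0" "\<eta> > 0"
  then have "\<forall>\<^sub>F n in sequentially. expectation (\<lambda>\<omega>. \<bar>V n \<omega>\<bar>) < \<epsilon> * \<eta>"
    by (intro order_tendstoD[OF lim]) auto
  then show "\<forall>\<^sub>F n in sequentially. prob {\<omega>\<in>space M. \<bar>V n \<omega> - 0\<bar> > \<epsilon>} < \<eta>"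
    by eventually_elim (simp, rule markov_less, use int \<open>\<epsilon> > 0\<close> in auto)
qed

lemma converges_in_prob_L2:
  assumes int: "\<And>n. integrable M (\<lambda>\<omega>. (V n \<omega>)\<^sup>2)"
    and le: "\<And>n. n \<ge> 1 \<Longrightarrow> expectation (\<lambda>\<omega>. (V n \<omega>)\<^sup>2) \<le> a n" and lim: "a \<longlonglongrightarrow> 0"
  shows "converges_in_prob M V 0"
proof (rule converges_in_probI)
  fix \<epsilon> \<eta> :: real assume e: "\<epsilon> > 0" "\<eta> > 0"
  then have "\<forall>\<^sub>F n in sequentially. a n < \<epsilon>\<^sup>2 * \<eta>"
    by (intro order_tendstoD[OF lim]) auto
  with eventually_ge_at_top[of 1]
  show "\<forall>\<^sub>F n in sequentially. prob {\<omega>\<in>space M. \<bar>V n \<omega> - 0\<bar> > \<epsilon>} < \<eta>"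
  proof eventually_elim
    case (elim n)
    have "{\<omega>\<in>space M. \<bar>V n \<omega> - 0\<bar> > \<epsilon>} = {\<omega>\<in>space M. (V n \<omega>)\<^sup>2 > \<epsilon>\<^sup>2}"
      using e by (simp add: less_abs_iff_power2)
    then show ?case using markov_less[OF int _ _ le_less_trans[OF le elim(2)]] elim(1) e by simp
  qed
qed

lemma tight_seq_L2:
  assumes int: "\<And>n. integrable M (\<lambda>\<omega>. (V n \<omega>)\<^sup>2)"
    and le: "\<And>n. expectation (\<lambda>\<omega>. (V n \<omega>)\<^sup>2) \<le> K"
  shows "tight_seq V"
  unfolding tight_seq_def
proof (intro allI impI)
  fix \<eta> :: real assume \<eta>: "\<eta> > 0"
  have K: "K \<ge> 0" using le[of 0] by (rule order_trans[rotated]) simp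
  \<comment> \<open>Chosen so that \<open>C \<ge> 1\<close> and \<open>K < C * \<eta>\<close>; then
    also \<open>K < C^2 * \<eta>\<close>, which is what Markov's inequality for the square asks
    for.\<close>
  define C where "C = (K + 1) / \<eta> + 1"
  have C: "C \<ge> 1" using K \<eta> by (simp add: C_def)
  have "K < C * \<eta>" using K \<eta> by (simp add: C_def field_simps add_pos_pos)
  also have "\<dots> \<le> C\<^sup>2 * \<eta>" using C \<eta> by (simp add: power2_eq_square mult_right_mono)
  finally have KC: "K < C\<^sup>2 * \<eta>" .
  have "prob {\<omega>\<in>space M. \<bar>V n \<omega>\<bar> > C} < \<eta>" for n
  proof -
    have "{\<omega>\<in>space M. \<bar>V n \<omega>\<bar> > C} = {\<omega>\<in>space M. (V n \<omega>)\<^sup>2 > C\<^sup>2}"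
      using C by (simp add: less_abs_iff_power2)
    then show ?thesis using markov_less[OF int _ _ le_less_trans[OF le KC], of n] C by simp
  qed
  then show "\<exists>C>0. \<forall>\<^sub>F n in sequentially. prob {\<omega>\<in>space M. \<bar>V n \<omega>\<bar> > C} < \<eta>"
    using C by (intro exI[of _ C]) auto
qed

lemma converges_in_prob_add:
  assumes [measurable]: "\<And>n. U n \<in> borel_measurable M" "\<And>n. V n \<in> borel_measurable M"
    and UV: "converges_in_prob M U a" "converges_in_prob M V b"
  shows "converges_in_prob M (\<lambda>n \<omega>. U n \<omega> + V n \<omega>) (a + b)"
proof (rule converges_in_probI)
  fix \<epsilon> \<eta> :: real assume e: "\<epsilon> > 0" "\<eta> > 0"
  then have e': "\<epsilon>/2 > 0" "\<eta>/2 > 0" by auto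
  from UV[THEN converges_in_probD[OF _ e']]
  show "\<forall>\<^sub>F n in sequentially. prob {\<omega>\<in>space M. \<bar>U n \<omega> + V n \<omega> - (a + b)\<bar> > \<epsilon>} < \<eta>"
  proof eventually_elim
    case (elim n)
    have "{\<omega>\<in>space M. \<bar>U n \<omega> + V n \<omega> - (a + b)\<bar> > \<epsilon>}
        \<subseteq> {\<omega>\<in>space M. \<bar>U n \<omega> - a\<bar> > \<epsilon>/2} \<union> {\<omega>\<in>space M. \<bar>V n \<omega> - b\<bar> > \<epsilon>/2}"
      by (auto simp: abs_if split: if_splits)
    then have "prob {\<omega>\<in>space M. \<bar>U n \<omega> + V n \<omega> - (a + b)\<bar> > \<epsilon>} < \<eta>/2 + \<eta>/2"
      by (rule prob_union_less[OF _ _ _ elim]) auto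
    then show ?case by simp
  qed
qed

lemma converges_in_prob_const_seq:
  assumes "a \<longlonglongrightarrow> c"
  shows "converges_in_prob M (\<lambda>n \<omega>. a n) c"
proof (rule converges_in_probI)
  fix \<epsilon> \<eta> :: real assume "\<epsilon> > 0" "\<eta> > 0"
  have "\<forall>\<^sub>F n in sequentially. \<bar>a n - c\<bar> < \<epsilon>"
    using tendstoD[OF assms \<open>\<epsilon> > 0\<close>] by (simp add: dist_real_def)
  then show "\<forall>\<^sub>F n in sequentially. prob {\<omega>\<in>space M. \<bar>a n - c\<bar> > \<epsilon>} < \<eta>"
    by eventually_elim (use \<open>\<eta> > 0\<close> in simp)
qed

lemma converges_in_prob_tight:
  assumes "converges_in_prob M V c" and [measurable]: "\<And>n. V n \<in> borel_measurable M"
  shows "tight_seq V"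
  unfolding tight_seq_def
proof (intro allI impI)
  fix \<eta> :: real assume "\<eta> > 0"
  from converges_in_probD[OF assms(1) zero_less_one this]
  have "\<forall>\<^sub>F n in sequentially. prob {\<omega>\<in>space M. \<bar>V n \<omega>\<bar> > \<bar>c\<bar> + 1} < \<eta>"
    by eventually_elim (erule le_less_trans[rotated], intro finite_measure_mono, auto)
  then show "\<exists>C>0. \<forall>\<^sub>F n in sequentially. prob {\<omega>\<in>space M. \<bar>V n \<omega>\<bar> > C} < \<eta>"
    by (intro exI[of _ "\<bar>c\<bar> + 1"]) auto
qed

lemma tight_seq_mult:
  assumes [measurable]: "\<And>n. U n \<in> borel_measurable M" "\<And>n. V n \<in> borel_measurable M"
    and UV: "tight_seq U" "tight_seq V"
  shows "tight_seq (\<lambda>n \<omega>. U n \<omega> * V n \<omega>)"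
  unfolding tight_seq_def
proof (intro allI impI)
  fix \<eta> :: real assume "\<eta> > 0"
  then have "\<eta>/2 > 0" by simp
  then obtain C D where CD: "C > 0" "D > 0"
    "\<forall>\<^sub>F n in sequentially. prob {\<omega>\<in>space M. \<bar>U n \<omega>\<bar> > C} < \<eta>/2"
    "\<forall>\<^sub>F n in sequentially. prob {\<omega>\<in>space M. \<bar>V n \<omega>\<bar> > D} < \<eta>/2"
    using UV unfolding tight_seq_def by meson
  from CD(3,4) have "\<forall>\<^sub>F n in sequentially. prob {\<omega>\<in>space M. \<bar>U n \<omega> * V n \<omega>\<bar> > C * D} < \<eta>"
  proof eventually_elim
    case (elim n)
    have "{\<omega>\<in>space M. \<bar>U n \<omega> * V n \<omega>\<bar> > C * D}
        \<subseteq> {\<omega>\<in>space M. \<bar>U n \<omega>\<bar> > C} \<union> {\<omega>\<in>space M. \<bar>V n \<omega>\<bar> > D}"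
    proof safe
      fix \<omega> assume "C * D < \<bar>U n \<omega> * V n \<omega>\<bar>" "\<not> D < \<bar>V n \<omega>\<bar>"
      then show "C < \<bar>U n \<omega>\<bar>"
        using CD(1,2) mult_mono[of "\<bar>U n \<omega>\<bar>" C "\<bar>V n \<omega>\<bar>" D] by (force simp: abs_mult not_less)
    qed
    then have "prob {\<omega>\<in>space M. \<bar>U n \<omega> * V n \<omega>\<bar> > C * D} < \<eta>/2 + \<eta>/2"
      by (rule prob_union_less[OF _ _ _ elim]) auto
    then show ?case by simp
  qed
  then show "\<exists>C>0. \<forall>\<^sub>F n in sequentially. prob {\<omega>\<in>space M. \<bar>U n \<omega> * V n \<omega>\<bar> > C} < \<eta>"
    using CD by (intro exI[of _ "C * D"]) auto
qed

lemma converges_in_prob_tight_mult: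
  assumes [measurable]: "\<And>n. U n \<in> borel_measurable M" "\<And>n. V n \<in> borel_measurable M"
    and UV: "tight_seq U" "converges_in_prob M V 0"
  shows "converges_in_prob M (\<lambda>n \<omega>. U n \<omega> * V n \<omega>) 0"
proof (rule converges_in_probI)
  fix \<epsilon> \<eta> :: real assume e: "\<epsilon> > 0" "\<eta> > 0"
  then have "\<eta>/2 > 0" by simp
  then obtain C where C: "C > 0" "\<forall>\<^sub>F n in sequentially. prob {\<omega>\<in>space M. \<bar>U n \<omega>\<bar> > C} < \<eta>/2"
    using UV unfolding tight_seq_def by meson
  have "\<epsilon>/C > 0" using C e by simp
  from C(2) converges_in_probD[OF UV(2) this \<open>\<eta>/2 > 0\<close>]
  show "\<forall>\<^sub>F n in sequentially. prob {\<omega>\<in>space M. \<bar>U n \<omega> * V n \<omega> - 0\<bar> > \<epsilon>} < \<eta>"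
  proof eventually_elim
    case (elim n)
    have "{\<omega>\<in>space M. \<bar>U n \<omega> * V n \<omega> - 0\<bar> > \<epsilon>}
        \<subseteq> {\<omega>\<in>space M. \<bar>U n \<omega>\<bar> > C} \<union> {\<omega>\<in>space M. \<bar>V n \<omega> - 0\<bar> > \<epsilon>/C}"
    proof safe
      fix \<omega> assume "\<epsilon> < \<bar>U n \<omega> * V n \<omega> - 0\<bar>" "\<not> \<epsilon> / C < \<bar>V n \<omega> - 0\<bar>" 
      then have *: "\<epsilon> < \<bar>U n \<omega>\<bar> * \<bar>V n \<omega>\<bar>" "\<bar>V n \<omega>\<bar> \<le> \<epsilon> / C" by (auto simp: abs_mult)
      then have "\<epsilon> < \<bar>U n \<omega>\<bar> * (\<epsilon> / C)" by (meson abs_ge_zero less_le_trans mult_left_mono)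
      then show "C < \<bar>U n \<omega>\<bar>" using e C by (simp add: field_simps)
    qed
    then have "prob {\<omega>\<in>space M. \<bar>U n \<omega> * V n \<omega> - 0\<bar> > \<epsilon>} < \<eta>/2 + \<eta>/2"
      by (rule prob_union_less[OF _ _ _ elim]) auto
    then show ?case by simp
  qed
qed

lemma converges_in_prob_cmult:
  assumes V: "converges_in_prob M V a"
  shows "converges_in_prob M (\<lambda>n \<omega>. c * V n \<omega>) (c * a)"
proof (cases "c = 0")
  case False
  have "\<epsilon> < \<bar>c * v - c * a\<bar> \<longleftrightarrow> \<epsilon> / \<bar>c\<bar> < \<bar>v - a\<bar>" for \<epsilon> v
    unfolding right_diff_distrib[symmetric] abs_mult using False by (simp add: pos_divide_less_eq mult.commute)
  then show ?thesis using V False unfolding converges_in_prob_def by simp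
qed (simp add: converges_in_prob_def)

lemma converges_in_prob_inverse:
  assumes [measurable]: "\<And>n. V n \<in> borel_measurable M" and V: "converges_in_prob M V c" and c: "c > 0"
  shows "converges_in_prob M (\<lambda>n \<omega>. inverse (V n \<omega>)) (inverse c)"
proof (rule converges_in_probI)
  fix \<epsilon> \<eta> :: real assume e: "\<epsilon> > 0" "\<eta> > 0"
  \<comment> \<open>The first entry keeps \<open>v\<close> above \<open>c / 2\<close>. Then
    \<open>\<bar>v - c\<bar> / (v * c)\<close> is at most
    \<open>2 * \<bar>v - c\<bar> / c^2\<close>, and the second entry makes this at most
    \<open>\<epsilon>\<close>.\<close>
  define d where "d = min (c/2) (\<epsilon> * c\<^sup>2 / 2)"
  have d: "d > 0" using c e by (simp add: d_def)
  from converges_in_probD[OF V this e(2)]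
  show "\<forall>\<^sub>F n in sequentially. prob {\<omega>\<in>space M. \<bar>inverse (V n \<omega>) - inverse c\<bar> > \<epsilon>} < \<eta>"
  proof eventually_elim
    case (elim n)
    have "\<bar>inverse v - inverse c\<bar> \<le> \<epsilon>" if "\<bar>v - c\<bar> \<le> d" for v
    proof -
      have v: "v \<ge> c/2" using that by (auto simp: d_def abs_if split: if_splits)
      then have v0: "v > 0" using c by simp
      have "\<bar>inverse v - inverse c\<bar> = \<bar>v - c\<bar> / (v * c)"
        using v0 c by (simp add: field_simps abs_if)
      also have "\<dots> \<le> (\<epsilon> * c\<^sup>2 / 2) / (c/2 * c)"
        using v c that e by (intro frac_le mult_right_mono) (auto simp: d_def)
      also have "\<dots> = \<epsilon>" using c by (simp add: power2_eq_square)
      finally show ?thesis .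
    qed
    then have "{\<omega>\<in>space M. \<bar>inverse (V n \<omega>) - inverse c\<bar> > \<epsilon>} \<subseteq> {\<omega>\<in>space M. \<bar>V n \<omega> - c\<bar> > d}"
      using not_le by blast
    then have "prob {\<omega>\<in>space M. \<bar>inverse (V n \<omega>) - inverse c\<bar> > \<epsilon>} \<le> prob {\<omega>\<in>space M. \<bar>V n \<omega> - c\<bar> > d}"
      by (rule finite_measure_mono) auto
    then show ?case using elim by simp
  qed
qed

text \<open>Bounded convergence: off the exceptional event the deviation is at most
  \<open>r/2\<close>, on it at most 2, and the event eventually has probability below
  \<open>r/4\<close>.\<close>

lemma expectation_lim_of_prob:
  fixes V :: "nat \<Rightarrow> 'a \<Rightarrow> complex"
  assumes [measurable]: "\<And>n. V n \<in> borel_measurable M"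
    and le: "\<And>n \<omega>. cmod (V n \<omega>) \<le> 1" "cmod c \<le> 1"
    and V: "converges_in_prob M (\<lambda>n \<omega>. cmod (V n \<omega> - c)) 0"
  shows "(\<lambda>n. expectation (V n)) \<longlonglongrightarrow> c"
proof (rule metric_LIMSEQ_I)
  fix r :: real assume r: "r > 0"
  then have "r/2 > 0" "r/4 > 0" by auto
  from converges_in_probD[OF V this]
  have "\<forall>\<^sub>F n in sequentially. dist (expectation (V n)) c < r"
  proof eventually_elim
    case (elim n)
    define A where "A = {\<omega>\<in>space M. cmod (V n \<omega> - c) > r/2}"
    have [measurable]: "A \<in> events" unfolding A_def by measurable
    have iA: "integrable M (indicat_real A)" by (rule integrable_const_bound[of _ 1]) auto
    have int: "integrable M (V n)" by (rule integrable_const_bound[of _ 1]) (auto simp: le)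
    have "expectation (V n) - c = expectation (\<lambda>\<omega>. V n \<omega> - c)"
      using int by (simp add: prob_space)
    also have "cmod \<dots> \<le> expectation (\<lambda>\<omega>. cmod (V n \<omega> - c))"
      by (rule integral_norm_bound)
    also have "\<dots> \<le> expectation (\<lambda>\<omega>. r/2 + 2 * indicator A \<omega>)"
    proof (rule integral_mono)
      show "cmod (V n \<omega> - c) \<le> r/2 + 2 * indicator A \<omega>" if "\<omega> \<in> space M" for \<omega>
        using that r norm_triangle_ineq4[of "V n \<omega>" c] le(1)[of n \<omega>] le(2) by (auto simp: indicator_def A_def)
      show "integrable M (\<lambda>\<omega>. r/2 + 2 * indicator A \<omega>)"
        using iA by simp
    qed (use int in auto)
    also have "\<dots> = r/2 + 2 * prob A" using iA by (simp add: prob_space)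
    also have "\<dots> < r" using elim by (simp add: A_def)
    finally show ?case by (simp add: dist_norm)
  qed
  then show "\<exists>no. \<forall>n\<ge>no. dist (expectation (V n)) c < r" by (simp add: eventually_sequentially)
qed

end

subsection \<open>Weighted sums of martingale differences of an AR(1) process\<close>

lemma abs_mult_le_sum_squares:
  fixes a b :: real
  shows "\<bar>a * b\<bar> \<le> a\<^sup>2 + b\<^sup>2"
proof -
  have "0 \<le> \<bar>a\<bar> * \<bar>b\<bar>" "2 * (\<bar>a\<bar> * \<bar>b\<bar>) \<le> a\<^sup>2 + b\<^sup>2"
    using sum_squares_bound[of "\<bar>a\<bar>" "\<bar>b\<bar>"] by (simp_all add: mult.assoc)
  then show ?thesis unfolding abs_mult by linarith
qed

lemma iexp_taylor2: "cmod (iexp y - (1 + \<i> * complex_of_real y - complex_of_real (y\<^sup>2) / 2)) \<le> \<bar>y\<bar> ^ 3 / 6"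
proof -
  have "(\<Sum>k\<le>2. (\<i> * complex_of_real y)^k / fact k) = 1 + \<i> * complex_of_real y - complex_of_real (y\<^sup>2) / 2"
    by (simp add: numeral_2_eq_2 power_mult_distrib)
  then show ?thesis
    using iexp_approx1[of y 2] by (simp add: fact_numeral)
qed

lemma integrable_mult_of_squares:
  fixes f g :: "'a \<Rightarrow> real"
  assumes [measurable]: "f \<in> borel_measurable M" "g \<in> borel_measurable M"
    and "integrable M (\<lambda>\<omega>. (f \<omega>)\<^sup>2)" "integrable M (\<lambda>\<omega>. (g \<omega>)\<^sup>2)"
  shows "integrable M (\<lambda>\<omega>. f \<omega> * g \<omega>)"
proof (rule Bochner_Integration.integrable_bound)
  show "integrable M (\<lambda>\<omega>. (f \<omega>)\<^sup>2 + (g \<omega>)\<^sup>2)" using assms by simp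
  show "AE \<omega> in M. norm (f \<omega> * g \<omega>) \<le> norm ((f \<omega>)\<^sup>2 + (g \<omega>)\<^sup>2)"
    using abs_mult_le_sum_squares by (auto intro: AE_I2)
qed simp

lemma
  fixes g :: "'i \<Rightarrow> 'a \<Rightarrow> real"
  assumes fin: "finite I" and [measurable]: "\<And>i. i \<in> I \<Longrightarrow> g i \<in> borel_measurable M"
    and sq: "\<And>i. i \<in> I \<Longrightarrow> integrable M (\<lambda>\<omega>. (g i \<omega>)\<^sup>2)"
  shows integrable_sum_square: "integrable M (\<lambda>\<omega>. (\<Sum>i\<in>I. g i \<omega>)\<^sup>2)"
    and integral_sum_square: "(\<integral>\<omega>. (\<Sum>i\<in>I. g i \<omega>)\<^sup>2 \<partial>M) = (\<Sum>i\<in>I. \<Sum>j\<in>I. \<integral>\<omega>. g i \<omega> * g j \<omega> \<partial>M)"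
proof -
  have eq: "(\<Sum>i\<in>I. g i \<omega>)\<^sup>2 = (\<Sum>i\<in>I. \<Sum>j\<in>I. g i \<omega> * g j \<omega>)" for \<omega>
    by (simp add: power2_eq_square sum_product)
  have int: "integrable M (\<lambda>\<omega>. g i \<omega> * g j \<omega>)" if "i \<in> I" "j \<in> I" for i j
    using that sq by (intro integrable_mult_of_squares) auto
  show "integrable M (\<lambda>\<omega>. (\<Sum>i\<in>I. g i \<omega>)\<^sup>2)"
    unfolding eq using int by auto
  show "(\<integral>\<omega>. (\<Sum>i\<in>I. g i \<omega>)\<^sup>2 \<partial>M) = (\<Sum>i\<in>I. \<Sum>j\<in>I. \<integral>\<omega>. g i \<omega> * g j \<omega> \<partial>M)"
    unfolding eq using int by (simp add: Bochner_Integration.integral_sum)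
qed

lemma (in prob_space) indep_set_imp_indep_var:
  assumes indep: "indep_set (sets F) (sets G)"
    and sp: "space F = space M" "space G = space M"
    and f: "f \<in> measurable F S" and g: "g \<in> measurable G T"
  shows "indep_var S f T g"
proof -
  have ev: "sets F \<subseteq> events" "sets G \<subseteq> events"
    using indep_setD_ev1[OF indep] indep_setD_ev2[OF indep] by auto
  have rv: "random_variable S f" "random_variable T g"
    using f g ev sp by (auto simp: measurable_def)
  have sub: "sigma_sets (space M) {f -` A \<inter> space M |A. A \<in> sets S} \<subseteq> sets F"
    using sets.sigma_sets_subset[of "{f -` A \<inter> space M |A. A \<in> sets S}" F] measurable_sets[OF f] sp
    by auto
  have sub': "sigma_sets (space M) {g -` A \<inter> space M |A. A \<in> sets T} \<subseteq> sets G"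
    using sets.sigma_sets_subset[of "{g -` A \<inter> space M |A. A \<in> sets T}" G] measurable_sets[OF g] sp
    by auto
  show ?thesis
    unfolding indep_var_eq using rv sub sub' indep unfolding indep_sets2_eq by (meson subset_iff subset_trans)
qed

text \<open>Used to replace \<open>1 - s\<close>, the second-order Taylor contribution of one
  summand, by a factor \<open>exp (- s)\<close> of the Gaussian limit.\<close>

lemma exp_minus_bound:
  fixes y :: real
  assumes "y \<ge> 0"
  shows "\<bar>exp (- y) - 1 + y\<bar> \<le> y\<^sup>2"
proof -
  have "exp (- y) = 1 / exp y" by (simp add: exp_minus field_simps)
  also have "\<dots> \<le> 1 / (1 + y)" using assms by (intro divide_left_mono) auto
  also have "\<dots> \<le> 1 - y + y\<^sup>2"
    using assms by (simp add: field_simps power2_eq_square)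
  finally show ?thesis using exp_ge_add_one_self[of "- y"] by (simp add: abs_if)
qed

lemma exp_minus_lipschitz:
  fixes x y :: real
  assumes "x \<ge> 0" "y \<ge> 0"
  shows "\<bar>exp (- x) - exp (- y)\<bar> \<le> \<bar>x - y\<bar>"
proof -
  have *: "exp (- a) - exp (- b) \<le> b - a" if "0 \<le> a" "a \<le> b" for a b :: real
  proof -
    have "exp (- a) - exp (- b) = exp (- a) * (1 - exp (- (b - a)))"
      by (simp add: algebra_simps flip: exp_add)
    also have "\<dots> \<le> 1 * (b - a)"
    proof (intro mult_mono)
      show "1 - exp (- (b - a)) \<le> b - a" using exp_ge_add_one_self[of "- (b - a)"] by linarith
    qed (use that in auto)
    finally show ?thesis by simp
  qed
  have "exp (- b) \<le> exp (- a)" if "a \<le> b" for a b :: real using that by simp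
  from *[of x y] *[of y x] this[of x y] this[of y x] assms show ?thesis
    by (cases "x \<le> y") (auto simp: abs_if)
qed

text \<open>What the limit theorem consumes of stationarity: a constant second moment, its
  fixed-point equation and uniform bounds on fourth moments. Time starts at 0 and the recursion
  holds at every point. In the filtration \<open>F\<close> the value \<open>x t\<close> is known at
  time \<open>t\<close>, hence so is \<open>z s\<close> for \<open>s < t\<close>, while
  \<open>z t\<close> is independent of \<open>F t\<close>.\<close>

locale ar1_process = prob_space M for M :: "'a measure" +
  fixes F :: "nat \<Rightarrow> 'a measure" and x z :: "nat \<Rightarrow> 'a \<Rightarrow> real" and \<theta> \<sigma> m \<kappa> :: real
  assumes subalg: "\<And>t. subalgebra M (F t)" and filt: "\<And>t. subalgebra (F (Suc t)) (F t)"
    and x_adapted: "\<And>t. x t \<in> borel_measurable (F t)"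
    and x_Suc: "\<And>t \<omega>. x (Suc t) \<omega> = \<theta> * x t \<omega> + z t \<omega>"
    and indep: "\<And>t. indep_set (sets (F t)) (sets (vimage_algebra (space M) (z t) borel))"
    and theta: "\<bar>\<theta>\<bar> < 1"
    and x4: "\<And>t. integrable M (\<lambda>\<omega>. x t \<omega> ^ 4)" "\<And>t. expectation (\<lambda>\<omega>. x t \<omega> ^ 4) \<le> \<kappa>"
    and z4: "\<And>t. integrable M (\<lambda>\<omega>. z t \<omega> ^ 4)" "\<And>t. expectation (\<lambda>\<omega>. z t \<omega> ^ 4) \<le> \<kappa>"
    and x2: "\<And>t. expectation (\<lambda>\<omega>. (x t \<omega>)\<^sup>2) = m"
    and z1: "\<And>t. expectation (z t) = 0"
    and z2: "\<And>t. expectation (\<lambda>\<omega>. (z t \<omega>)\<^sup>2) = \<sigma>\<^sup>2"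
    and m: "m = \<theta>\<^sup>2 * m + \<sigma>\<^sup>2"
begin

lemma F_le: "s \<le> t \<Longrightarrow> f \<in> measurable (F s) S \<Longrightarrow> f \<in> measurable (F t) S"
  by (induction t rule: nat_induct_at_least[of s]) (auto intro: measurable_from_subalg[OF filt] simp: dec_induct)

lemma F_M: "f \<in> measurable (F t) S \<Longrightarrow> f \<in> measurable M S"
  by (rule measurable_from_subalg[OF subalg])

lemma z_eq: "z t = (\<lambda>\<omega>. x (Suc t) \<omega> - \<theta> * x t \<omega>)"
  by (simp add: x_Suc)

lemma x_measurable [measurable]: "x t \<in> borel_measurable M"
  by (rule F_M[OF x_adapted])

lemma z_adapted: "s < t \<Longrightarrow> z s \<in> borel_measurable (F t)"
  unfolding z_eq using F_le[OF _ x_adapted, of s t] F_le[OF _ x_adapted, of "Suc s" t] by auto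

lemma z_measurable [measurable]: "z t \<in> borel_measurable M"
  unfolding z_eq by measurable

lemma x_adapted_le: "s \<le> t \<Longrightarrow> x s \<in> borel_measurable (F t)"
  by (rule F_le[OF _ x_adapted])

lemma integrable_x [simp]: "integrable M (x t)" "integrable M (\<lambda>\<omega>. (x t \<omega>)\<^sup>2)"
  and integrable_z [simp]: "integrable M (z t)" "integrable M (\<lambda>\<omega>. (z t \<omega>)\<^sup>2)"
proof -
  have *: "integrable M f \<and> integrable M (\<lambda>\<omega>. (f \<omega>)\<^sup>2)"
    if [measurable]: "f \<in> borel_measurable M" and "integrable M (\<lambda>\<omega>. f \<omega> ^ 4)" for f :: "'a \<Rightarrow> real"
  proof -
    have "integrable M (\<lambda>\<omega>. ((f \<omega>)\<^sup>2)\<^sup>2)" using that by (simp flip: power_mult)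
    then have "integrable M (\<lambda>\<omega>. (f \<omega>)\<^sup>2)" by (rule square_integrable_imp_integrable[rotated]) auto
    moreover from this have "integrable M f" by (rule square_integrable_imp_integrable[rotated]) auto
    ultimately show ?thesis by simp
  qed
  show "integrable M (x t)" "integrable M (\<lambda>\<omega>. (x t \<omega>)\<^sup>2)" "integrable M (z t)" "integrable M (\<lambda>\<omega>. (z t \<omega>)\<^sup>2)"
    using *[OF x_measurable x4(1)] *[OF z_measurable z4(1)] by auto
qed

lemmas [simp] = x4(1) z4(1)

lemma m_nonneg: "m \<ge> 0"
  using x2[of 0] by (metis Bochner_Integration.integral_nonneg zero_le_power2)

lemma \<kappa>_nonneg: "\<kappa> \<ge> 0"
  using x4(2)[of 0] by (rule order_trans[rotated]) simp

lemma theta2: "\<theta>\<^sup>2 < 1"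
  using theta by (simp add: abs_square_less_1)

text \<open>The values lie in a general normed field because \<open>f\<close> is complex in the
  recursions for characteristic functions and real in the moment computations.\<close>

lemma indep_mult:
  fixes f :: "'a \<Rightarrow> 'b::{real_normed_field,banach,second_countable_topology}"
  assumes f: "f \<in> borel_measurable (F t)" "integrable M f"
    and g: "g \<in> borel_measurable borel" "integrable M (\<lambda>\<omega>. g (z t \<omega>))"
  shows "expectation (\<lambda>\<omega>. f \<omega> * g (z t \<omega>)) = expectation f * expectation (\<lambda>\<omega>. g (z t \<omega>))"
    and "integrable M (\<lambda>\<omega>. f \<omega> * g (z t \<omega>))"
proof -
  let ?G = "vimage_algebra (space M) (z t) borel"
  have "z t \<in> borel_measurable ?G" by (rule measurable_vimage_algebra1) simp
  then have "(\<lambda>\<omega>. g (z t \<omega>)) \<in> borel_measurable ?G" using g(1) by (rule measurable_compose)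
  moreover have "space (F t) = space M" using subalg[of t] by (simp add: subalgebra_def)
  ultimately have "indep_var borel f borel (\<lambda>\<omega>. g (z t \<omega>))"
    by (intro indep_set_imp_indep_var[OF indep _ _ f(1)]) auto
  from indep_var_lebesgue_integral[OF this f(2) g(2)] indep_var_integrable[OF this f(2) g(2)]
  show "expectation (\<lambda>\<omega>. f \<omega> * g (z t \<omega>)) = expectation f * expectation (\<lambda>\<omega>. g (z t \<omega>))"
    and "integrable M (\<lambda>\<omega>. f \<omega> * g (z t \<omega>))" by auto
qed

text \<open>Independence of \<open>x t\<close> and \<open>z t\<close> factorizes the moments, so the
  fourth moment of the product needs fourth moments of the factors and not eighth ones.\<close>

lemma
  shows integrable_xz2 [simp]: "integrable M (\<lambda>\<omega>. (x t \<omega> * z t \<omega>)\<^sup>2)"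
    and expectation_xz2: "expectation (\<lambda>\<omega>. (x t \<omega> * z t \<omega>)\<^sup>2) = m * \<sigma>\<^sup>2"
    and integrable_xz4 [simp]: "integrable M (\<lambda>\<omega>. (x t \<omega> * z t \<omega>) ^ 4)"
    and expectation_xz4: "expectation (\<lambda>\<omega>. (x t \<omega> * z t \<omega>) ^ 4) \<le> \<kappa>\<^sup>2"
proof -
  note [measurable] = x_adapted
  have "integrable M (\<lambda>\<omega>. (x t \<omega>)\<^sup>2 * (z t \<omega>)\<^sup>2)" "expectation (\<lambda>\<omega>. (x t \<omega>)\<^sup>2 * (z t \<omega>)\<^sup>2) = m * \<sigma>\<^sup>2"
    using indep_mult[of "\<lambda>\<omega>. (x t \<omega>)\<^sup>2" t "\<lambda>y. y\<^sup>2"] by (auto simp: x2 z2)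
  then show "integrable M (\<lambda>\<omega>. (x t \<omega> * z t \<omega>)\<^sup>2)" "expectation (\<lambda>\<omega>. (x t \<omega> * z t \<omega>)\<^sup>2) = m * \<sigma>\<^sup>2"
    by (simp_all add: power_mult_distrib)
  have 4: "integrable M (\<lambda>\<omega>. (x t \<omega>)^4 * (z t \<omega>)^4)"
    "expectation (\<lambda>\<omega>. (x t \<omega>)^4 * (z t \<omega>)^4) = expectation (\<lambda>\<omega>. x t \<omega> ^ 4) * expectation (\<lambda>\<omega>. z t \<omega> ^ 4)"
    using indep_mult[of "\<lambda>\<omega>. (x t \<omega>)^4" t "\<lambda>y. y^4"] by auto
  then show "integrable M (\<lambda>\<omega>. (x t \<omega> * z t \<omega>)^4)" by (simp add: power_mult_distrib)
  have "expectation (\<lambda>\<omega>. x t \<omega> ^ 4) * expectation (\<lambda>\<omega>. z t \<omega> ^ 4) \<le> \<kappa> * \<kappa>"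
    using \<kappa>_nonneg by (intro mult_mono x4 z4) auto
  with 4 show "expectation (\<lambda>\<omega>. (x t \<omega> * z t \<omega>)^4) \<le> \<kappa>\<^sup>2"
    by (simp add: power_mult_distrib power2_eq_square)
qed

lemma integrable_xz [simp]: "integrable M (\<lambda>\<omega>. x t \<omega> * z t \<omega>)"
  by (rule square_integrable_imp_integrable[OF _ integrable_xz2]) simp

text \<open>The frequency is absorbed into the coefficients \<open>b\<close>, so
  \<open>expectation (char_sum b n)\<close> is the characteristic function of the weighted sum at 1.
  The last index is \<open>n - 1\<close>, which makes \<open>char_sum b n\<close> measurable for
  \<open>F n\<close> and therefore independent of \<open>z n\<close>.\<close>

definition char_sum :: "(nat \<Rightarrow> real) \<Rightarrow> nat \<Rightarrow> 'a \<Rightarrow> complex" where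
  "char_sum b n \<omega> = iexp (\<Sum>t<n. b t * (x t \<omega> * z t \<omega>))"

lemma char_sum_adapted: "char_sum b n \<in> borel_measurable (F n)"
proof -
  have [measurable]: "x t \<in> borel_measurable (F n)" "z t \<in> borel_measurable (F n)" if "t \<in> {..<n}" for t
    using that z_adapted x_adapted_le by auto
  show ?thesis unfolding char_sum_def[abs_def] by measurable
qed

lemma char_sum_measurable [measurable]: "char_sum b n \<in> borel_measurable M"
  by (rule F_M[OF char_sum_adapted])

lemma norm_char_sum [simp]: "cmod (char_sum b n \<omega>) = 1"
  by (simp add: char_sum_def)

lemma char_sum_Suc: "char_sum b (Suc n) \<omega> = char_sum b n \<omega> * iexp (b n * (x n \<omega> * z n \<omega>))"
  by (simp add: char_sum_def algebra_simps flip: exp_add)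

lemma integrable_char_sum_mult:
  assumes "integrable M (f :: 'a \<Rightarrow> real)"
  shows "integrable M (\<lambda>\<omega>. char_sum b n \<omega> * complex_of_real (f \<omega>))"
proof -
  have [measurable]: "f \<in> borel_measurable M" using assms by simp
  show ?thesis
    by (rule Bochner_Integration.integrable_bound[OF assms]) (auto simp: norm_mult)
qed

lemma norm_expectation_char_sum_mult_le:
  assumes "integrable M (f :: 'a \<Rightarrow> real)"
  shows "cmod (expectation (\<lambda>\<omega>. char_sum b n \<omega> * complex_of_real (f \<omega>))) \<le> expectation (\<lambda>\<omega>. \<bar>f \<omega>\<bar>)"
  using integral_norm_bound[of M "\<lambda>\<omega>. char_sum b n \<omega> * complex_of_real (f \<omega>)"] by (simp add: norm_mult)

lemma integrable_char_sum [simp]: "integrable M (char_sum b n)"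
  using integrable_char_sum_mult[of "\<lambda>_. 1"] by simp

text \<open>With \<open>g\<close> the identity this is the martingale difference property; with
  \<open>g y = y^2 - \<sigma>^2\<close> it removes the centred squares of the innovations.\<close>

lemma char_sum_mult_z:
  assumes f: "f \<in> borel_measurable (F n)" "integrable M (f :: 'a \<Rightarrow> real)"
    and g: "g \<in> borel_measurable borel" "integrable M (\<lambda>\<omega>. g (z n \<omega>) :: real)"
  shows "expectation (\<lambda>\<omega>. char_sum b n \<omega> * complex_of_real (f \<omega> * g (z n \<omega>)))
      = expectation (\<lambda>\<omega>. char_sum b n \<omega> * complex_of_real (f \<omega>)) * complex_of_real (expectation (\<lambda>\<omega>. g (z n \<omega>)))"
proof -
  note [measurable] = char_sum_adapted f(1) g(1)
  have "expectation (\<lambda>\<omega>. (char_sum b n \<omega> * complex_of_real (f \<omega>)) * complex_of_real (g (z n \<omega>)))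
      = expectation (\<lambda>\<omega>. char_sum b n \<omega> * complex_of_real (f \<omega>)) * expectation (\<lambda>\<omega>. complex_of_real (g (z n \<omega>)))"
    by (rule indep_mult(1)) (use integrable_char_sum_mult[OF f(2)] g in auto)
  then show ?thesis by (simp add: mult.assoc)
qed

text \<open>The conditional variance of the next summand given \<open>F n\<close> is
  \<open>\<sigma>^2 * (x n)^2\<close>. Up to the factor \<open>\<sigma>^2\<close>,
  \<open>q b n\<close> is the error made in the characteristic function when this is replaced by the
  constant \<open>\<sigma>^2 * m\<close>.\<close>

definition q :: "(nat \<Rightarrow> real) \<Rightarrow> nat \<Rightarrow> complex" where
  "q b n = expectation (\<lambda>\<omega>. char_sum b n \<omega> * complex_of_real ((x n \<omega>)\<^sup>2 - m))"

text \<open>Bounds the expectation of \<open>(x n * z n)^2 + 2 * x (Suc n)^4 + 2 * m^2\<close>, the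
  majorant for the change of the exponential in one step.\<close>

definition q_const :: real where
  "q_const = m * \<sigma>\<^sup>2 + 2 * \<kappa> + 2 * m\<^sup>2"

lemma q_const_nonneg: "q_const \<ge> 0"
  using m_nonneg \<kappa>_nonneg by (simp add: q_const_def)

lemma q_0: "q b 0 = 0"
proof -
  have "q b 0 = complex_of_real (expectation (\<lambda>\<omega>. (x 0 \<omega>)\<^sup>2 - m))"
    unfolding q_def char_sum_def by (simp del: of_real_diff of_real_power)
  then show ?thesis by (simp add: x2 prob_space)
qed

text \<open>Since \<open>x\<^sub>n\<^sub>+\<^sub>1\<^sup>2 - m = \<theta>\<^sup>2 (x\<^sub>n\<^sup>2 - m) + 2\<theta> x\<^sub>n z\<^sub>n + (z\<^sub>n\<^sup>2 - \<sigma>\<^sup>2)\<close>, the correlation of the conditional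
  variance with the past is damped geometrically; this replaces a law of large numbers for the
  weighted squares.\<close>

lemma q_Suc: "cmod (q b (Suc n)) \<le> \<theta>\<^sup>2 * cmod (q b n) + q_const * \<bar>b n\<bar>"
proof -
  let ?e = "char_sum b n"
  let ?Y = "\<lambda>n \<omega>. (x n \<omega>)\<^sup>2 - m"
  \<comment> \<open>The factor \<open>1 *\<close> gives the last term the shape
    \<open>f * g (z n)\<close> that \<open>char_sum_mult_z\<close> expects.\<close>
  have Y: "?Y (Suc n) \<omega> = \<theta>\<^sup>2 * ?Y n \<omega> + (2 * \<theta> * x n \<omega> * z n \<omega> + 1 * ((z n \<omega>)\<^sup>2 - \<sigma>\<^sup>2))" for \<omega>
    unfolding x_Suc by (subst m) (simp add: power2_eq_square algebra_simps)
  note [measurable] = x_adapted[of n]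
  have i1: "integrable M (\<lambda>\<omega>. 2 * \<theta> * x n \<omega> * z n \<omega>)"
    using integrable_mult_right[OF integrable_xz[of n], of "2 * \<theta>"] by (simp add: mult.assoc)
  \<comment> \<open>With the exponential frozen at time \<open>n\<close>, both terms containing
    \<open>z n\<close> integrate to zero and only the contracted \<open>q b n\<close> survives.
    Updating the exponential then costs a multiple of \<open>\<bar>b n\<bar>\<close>.\<close>
  have "expectation (\<lambda>\<omega>. ?e \<omega> * complex_of_real (?Y (Suc n) \<omega>))
      = expectation (\<lambda>\<omega>. complex_of_real (\<theta>\<^sup>2) * (?e \<omega> * complex_of_real (?Y n \<omega>))
         + (?e \<omega> * complex_of_real (2 * \<theta> * x n \<omega> * z n \<omega>)
         + ?e \<omega> * complex_of_real (1 * ((z n \<omega>)\<^sup>2 - \<sigma>\<^sup>2))))"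
    unfolding Y by (simp only: of_real_add of_real_mult distrib_left mult.left_commute)
  also have "\<dots> = complex_of_real (\<theta>\<^sup>2) * q b n
      + (expectation (\<lambda>\<omega>. ?e \<omega> * complex_of_real (2 * \<theta> * x n \<omega> * z n \<omega>))
         + expectation (\<lambda>\<omega>. ?e \<omega> * complex_of_real (1 * ((z n \<omega>)\<^sup>2 - \<sigma>\<^sup>2))))"
    unfolding q_def using i1
    by (subst Bochner_Integration.integral_add Bochner_Integration.integral_mult_right_zero
      | intro integrable_char_sum_mult integrable_mult_right Bochner_Integration.integrable_add refl
      | simp)+
  also have "expectation (\<lambda>\<omega>. ?e \<omega> * complex_of_real (2 * \<theta> * x n \<omega> * z n \<omega>)) = 0"
    by (subst char_sum_mult_z[where g="\<lambda>y. y"]) (auto simp: z1)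
  also have "expectation (\<lambda>\<omega>. ?e \<omega> * complex_of_real (1 * ((z n \<omega>)\<^sup>2 - \<sigma>\<^sup>2))) = 0"
    by (subst char_sum_mult_z[where g="\<lambda>y. y\<^sup>2 - \<sigma>\<^sup>2"]) (auto simp: z2 prob_space)
  finally have 1: "expectation (\<lambda>\<omega>. ?e \<omega> * complex_of_real (?Y (Suc n) \<omega>)) = complex_of_real (\<theta>\<^sup>2) * q b n"
    by simp
  have iY: "integrable M (?Y (Suc n))" by simp
  have iD: "integrable M (\<lambda>\<omega>. (char_sum b (Suc n) \<omega> - ?e \<omega>) * complex_of_real (?Y (Suc n) \<omega>))"
    unfolding left_diff_distrib[where c="complex_of_real _"]
    by (rule Bochner_Integration.integrable_diff[OF integrable_char_sum_mult[OF iY] integrable_char_sum_mult[OF iY]])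
  have eq: "q b (Suc n) - complex_of_real (\<theta>\<^sup>2) * q b n
      = expectation (\<lambda>\<omega>. (char_sum b (Suc n) \<omega> - ?e \<omega>) * complex_of_real (?Y (Suc n) \<omega>))"
    unfolding 1[symmetric] unfolding q_def left_diff_distrib[where c="complex_of_real _"]
    by (intro Bochner_Integration.integral_diff[symmetric] integrable_char_sum_mult iY)
  have "cmod (q b (Suc n) - complex_of_real (\<theta>\<^sup>2) * q b n)
      \<le> expectation (\<lambda>\<omega>. cmod ((char_sum b (Suc n) \<omega> - ?e \<omega>) * complex_of_real (?Y (Suc n) \<omega>)))"
    unfolding eq by (rule integral_norm_bound)
  also have "\<dots> \<le> expectation (\<lambda>\<omega>. \<bar>b n\<bar> * ((x n \<omega> * z n \<omega>)\<^sup>2 + (2 * x (Suc n) \<omega> ^ 4 + 2 * m\<^sup>2)))"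
  proof (rule integral_mono)
    show "integrable M (\<lambda>\<omega>. cmod ((char_sum b (Suc n) \<omega> - ?e \<omega>) * complex_of_real (?Y (Suc n) \<omega>)))"
      by (rule integrable_norm[OF iD])
    fix \<omega>
    let ?u = "x n \<omega> * z n \<omega>" and ?v = "?Y (Suc n) \<omega>"
    have "cmod (char_sum b (Suc n) \<omega> - ?e \<omega>) = cmod (?e \<omega> * (iexp (b n * ?u) - 1))"
      by (simp add: char_sum_Suc algebra_simps)
    also have "\<dots> \<le> \<bar>b n * ?u\<bar>"
      using cmod_iexp_diff_le[of "b n * ?u" 0] by (simp add: norm_mult)
    finally have "cmod ((char_sum b (Suc n) \<omega> - ?e \<omega>) * complex_of_real ?v) \<le> \<bar>b n * ?u\<bar> * \<bar>?v\<bar>"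
      unfolding norm_mult norm_of_real by (rule mult_right_mono) simp
    also have "\<dots> = \<bar>b n\<bar> * \<bar>?u * ?v\<bar>" by (simp add: abs_mult)
    also have "\<bar>?u * ?v\<bar> \<le> ?u\<^sup>2 + ?v\<^sup>2"
      by (rule abs_mult_le_sum_squares)
    also have "?v\<^sup>2 \<le> 2 * x (Suc n) \<omega> ^ 4 + 2 * m\<^sup>2"
    proof -
      have "(a - m)\<^sup>2 \<le> 2 * a\<^sup>2 + 2 * m\<^sup>2" for a
        using zero_le_power2[of "a + m"] by (simp add: power2_eq_square algebra_simps)
      from this[of "(x (Suc n) \<omega>)\<^sup>2"] show ?thesis by (simp flip: power_mult)
    qed
    finally show "cmod ((char_sum b (Suc n) \<omega> - ?e \<omega>) * complex_of_real ?v)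
        \<le> \<bar>b n\<bar> * (?u\<^sup>2 + (2 * x (Suc n) \<omega> ^ 4 + 2 * m\<^sup>2))" by (simp add: mult_left_mono)
  qed simp
  also have "\<dots> = \<bar>b n\<bar> * (m * \<sigma>\<^sup>2 + (2 * expectation (\<lambda>\<omega>. x (Suc n) \<omega> ^ 4) + 2 * m\<^sup>2))"
    by (simp add: expectation_xz2 prob_space)
  also have "\<dots> \<le> \<bar>b n\<bar> * q_const"
    using x4(2)[of "Suc n"] by (intro mult_left_mono) (auto simp: q_const_def)
  finally have "cmod (q b (Suc n) - complex_of_real (\<theta>\<^sup>2) * q b n) \<le> \<bar>b n\<bar> * q_const" .
  moreover have "cmod (q b (Suc n)) \<le> cmod (complex_of_real (\<theta>\<^sup>2) * q b n) + cmod (q b (Suc n) - complex_of_real (\<theta>\<^sup>2) * q b n)"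
    by (metis add.commute diff_add_cancel norm_triangle_ineq)
  moreover have "cmod (complex_of_real (\<theta>\<^sup>2) * q b n) = \<theta>\<^sup>2 * cmod (q b n)"
    by (simp add: norm_mult norm_power)
  ultimately show ?thesis by (simp add: mult.commute)
qed

text \<open>The constant is the fixed point of
  \<open>y = \<theta>^2 * y + q_const * \<beta>\<close>, so the recursion preserves the bound, and
  \<open>q b 0 = 0\<close> lies below it.\<close>

lemma q_bound:
  assumes "\<And>t. t < n \<Longrightarrow> \<bar>b t\<bar> \<le> \<beta>" "t \<le> n" "\<beta> \<ge> 0"
  shows "cmod (q b t) \<le> q_const / (1 - \<theta>\<^sup>2) * \<beta>"
  using assms(2)
proof (induction t)
  case 0
  then show ?case using assms(3) q_const_nonneg theta2 by (simp add: q_0)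
next
  case (Suc t)
  have "cmod (q b (Suc t)) \<le> \<theta>\<^sup>2 * cmod (q b t) + q_const * \<bar>b t\<bar>" by (rule q_Suc)
  also have "\<dots> \<le> \<theta>\<^sup>2 * (q_const / (1 - \<theta>\<^sup>2) * \<beta>) + q_const * \<beta>"
    using Suc assms(1)[of t] q_const_nonneg by (intro add_mono mult_left_mono) auto
  also have "\<dots> = q_const / (1 - \<theta>\<^sup>2) * \<beta>" using theta2 by (simp add: field_simps)
  finally show ?case .
qed

text \<open>Taylor expansion of the last factor to second order. The linear term vanishes by the
  martingale property; the quadratic one is \<open>- s\<close> times the previous characteristic
  function, \<open>s = \<sigma>^2 * m / 2 * (b n)^2\<close>, plus an error in \<open>q b n\<close>.
  The three terms of the bound are the Taylor remainder, this error, and the cost \<open>s^2\<close>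
  of writing \<open>exp (- s)\<close> for \<open>1 - s\<close>.\<close>

lemma char_sum_step:
  "cmod (expectation (char_sum b (Suc n)) - complex_of_real (exp (- (\<sigma>\<^sup>2 * m / 2 * (b n)\<^sup>2))) * expectation (char_sum b n))
    \<le> (1 + \<kappa>\<^sup>2) * \<bar>b n\<bar> ^ 3 + \<sigma>\<^sup>2 / 2 * (b n)\<^sup>2 * cmod (q b n) + (\<sigma>\<^sup>2 * m / 2 * (b n)\<^sup>2)\<^sup>2"
proof -
  let ?e = "char_sum b n" and ?u = "\<lambda>\<omega>. x n \<omega> * z n \<omega>"
  define R where "R \<omega> = iexp (b n * ?u \<omega>) - (1 + \<i> * (b n * ?u \<omega>) - (b n * ?u \<omega>)\<^sup>2 / 2)" for \<omega>
  have R: "cmod (R \<omega>) \<le> \<bar>b n\<bar>^3 * (1 + (?u \<omega>)^4)" for \<omega>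
  proof -
    have "cmod (R \<omega>) \<le> \<bar>b n * ?u \<omega>\<bar> ^ 3 / 6"
      using iexp_taylor2[of "b n * ?u \<omega>"] unfolding R_def by simp
    also have "\<dots> \<le> \<bar>b n\<bar>^3 * \<bar>?u \<omega>\<bar>^3" by (simp add: abs_mult power_mult_distrib)
    \<comment> \<open>The cubic remainder is dominated by the fourth moment, for which a bound is at
      hand.\<close>
    also have "\<bar>?u \<omega>\<bar>^3 \<le> 1 + \<bar>?u \<omega>\<bar>^4"
    proof (cases "\<bar>?u \<omega>\<bar> \<le> 1")
      case True
      then have "\<bar>?u \<omega>\<bar>^3 \<le> 1" by (intro power_le_one) auto
      then show ?thesis by (simp add: add_increasing2)
    next
      case False
      then have "\<bar>?u \<omega>\<bar>^3 \<le> \<bar>?u \<omega>\<bar>^4" by (intro power_increasing) auto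
      then show ?thesis by simp
    qed
    finally show ?thesis by (simp add: mult_left_mono power_even_abs)
  qed
  have [measurable]: "R \<in> borel_measurable M" unfolding R_def by measurable
  have iR: "integrable M (\<lambda>\<omega>. ?e \<omega> * R \<omega>)"
  proof (rule Bochner_Integration.integrable_bound)
    show "integrable M (\<lambda>\<omega>. \<bar>b n\<bar>^3 * (1 + (?u \<omega>)^4))" by simp
    show "AE \<omega> in M. norm (?e \<omega> * R \<omega>) \<le> norm (\<bar>b n\<bar>^3 * (1 + (?u \<omega>)^4))"
      using R by (auto simp: norm_mult)
  qed simp
  note [measurable] = x_adapted[of n]
  have e1: "expectation (\<lambda>\<omega>. ?e \<omega> * complex_of_real (?u \<omega>)) = 0"
    by (subst char_sum_mult_z[where g="\<lambda>y. y"]) (auto simp: z1)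
  \<comment> \<open>Splitting \<open>x^2\<close> into \<open>(x^2 - m) + m\<close> separates the
    fluctuation \<open>q b n\<close> from the Gaussian main term.\<close>
  have e2: "expectation (\<lambda>\<omega>. ?e \<omega> * complex_of_real ((?u \<omega>)\<^sup>2)) = \<sigma>\<^sup>2 * (q b n + m * expectation ?e)"
  proof -
    have "expectation (\<lambda>\<omega>. ?e \<omega> * complex_of_real ((?u \<omega>)\<^sup>2))
        = expectation (\<lambda>\<omega>. ?e \<omega> * complex_of_real ((x n \<omega>)\<^sup>2)) * \<sigma>\<^sup>2"
      unfolding power_mult_distrib
      by (subst char_sum_mult_z[where g="\<lambda>y. y\<^sup>2"]) (auto simp: z2)
    also have "expectation (\<lambda>\<omega>. ?e \<omega> * complex_of_real ((x n \<omega>)\<^sup>2))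
        = expectation (\<lambda>\<omega>. ?e \<omega> * complex_of_real ((x n \<omega>)\<^sup>2 - m) + m * ?e \<omega>)"
      by (simp add: algebra_simps)
    also have "\<dots> = q b n + m * expectation ?e"
      unfolding q_def by (subst Bochner_Integration.integral_add) (auto intro!: integrable_char_sum_mult simp del: of_real_diff)
    finally show ?thesis by (simp add: mult.commute)
  qed
  have "char_sum b (Suc n) \<omega> = ?e \<omega> * R \<omega> + (?e \<omega> + ((\<i> * b n) * (?e \<omega> * complex_of_real (?u \<omega>))
      - ((b n)\<^sup>2 / 2) * (?e \<omega> * complex_of_real ((?u \<omega>)\<^sup>2))))" for \<omega>
    unfolding char_sum_Suc R_def by (simp add: algebra_simps power_mult_distrib)
  then have "expectation (char_sum b (Suc n)) = expectation (\<lambda>\<omega>. ?e \<omega> * R \<omega>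
      + (?e \<omega> + ((\<i> * b n) * (?e \<omega> * complex_of_real (?u \<omega>))
      - ((b n)\<^sup>2 / 2) * (?e \<omega> * complex_of_real ((?u \<omega>)\<^sup>2)))))" by presburger
  also have "\<dots> = expectation (\<lambda>\<omega>. ?e \<omega> * R \<omega>) + (expectation ?e
      + ((\<i> * b n) * expectation (\<lambda>\<omega>. ?e \<omega> * complex_of_real (?u \<omega>))
      - ((b n)\<^sup>2 / 2) * expectation (\<lambda>\<omega>. ?e \<omega> * complex_of_real ((?u \<omega>)\<^sup>2))))"
  proof -
    have i1: "integrable M (\<lambda>\<omega>. (\<i> * b n) * (?e \<omega> * complex_of_real (?u \<omega>)))"
      by (intro integrable_mult_right integrable_char_sum_mult integrable_xz)
    have i2: "integrable M (\<lambda>\<omega>. ((b n)\<^sup>2 / 2) * (?e \<omega> * complex_of_real ((?u \<omega>)\<^sup>2)))"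
      by (intro integrable_mult_right integrable_char_sum_mult integrable_xz2)
    show ?thesis
      using iR i1 i2 by (simp del: of_real_mult of_real_power)
  qed
  also have "\<dots> = expectation (\<lambda>\<omega>. ?e \<omega> * R \<omega>) + (expectation ?e
      - ((b n)\<^sup>2 / 2) * (\<sigma>\<^sup>2 * (q b n + m * expectation ?e)))"
    by (simp only: e1 e2 mult_zero_right diff_0 add_0 add_0_left) simp
  finally have E: "expectation (char_sum b (Suc n)) = expectation (\<lambda>\<omega>. ?e \<omega> * R \<omega>) + (expectation ?e
      - ((b n)\<^sup>2 / 2) * (\<sigma>\<^sup>2 * (q b n + m * expectation ?e)))" .
  have tri: "cmod (u + (- v + w)) \<le> cmod u + (cmod v + cmod w)" for u v w
    using norm_triangle_ineq[of u "- v + w"] norm_triangle_ineq[of "- v" w] by simp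
  define s where "s = \<sigma>\<^sup>2 * m / 2 * (b n)\<^sup>2"
  have s: "s \<ge> 0" using m_nonneg by (simp add: s_def)
  have "expectation (char_sum b (Suc n)) - complex_of_real (exp (- s)) * expectation ?e
      = expectation (\<lambda>\<omega>. ?e \<omega> * R \<omega>) + (- (complex_of_real (\<sigma>\<^sup>2 / 2 * (b n)\<^sup>2) * q b n)
        + complex_of_real (- (exp (- s) - 1 + s)) * expectation ?e)"
    unfolding E s_def by (simp add: field_simps)
  then have "cmod (expectation (char_sum b (Suc n)) - complex_of_real (exp (- s)) * expectation ?e)
      \<le> cmod (expectation (\<lambda>\<omega>. ?e \<omega> * R \<omega>)) + (cmod (complex_of_real (\<sigma>\<^sup>2 / 2 * (b n)\<^sup>2) * q b n)
        + cmod (complex_of_real (- (exp (- s) - 1 + s)) * expectation ?e))"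
    by (simp only: tri)
  also have "cmod (complex_of_real (\<sigma>\<^sup>2 / 2 * (b n)\<^sup>2) * q b n) = \<sigma>\<^sup>2 / 2 * (b n)\<^sup>2 * cmod (q b n)"
    unfolding norm_mult[of "complex_of_real _"] norm_of_real by simp
  also have "cmod (complex_of_real (- (exp (- s) - 1 + s)) * expectation ?e) \<le> s\<^sup>2 * 1"
  proof -
    have "cmod (expectation ?e) \<le> 1"
      using norm_expectation_char_sum_mult_le[of "\<lambda>_. 1" b n] by (simp add: prob_space)
    then show ?thesis
      unfolding norm_mult norm_of_real abs_minus_cancel
      using exp_minus_bound[OF s] by (intro mult_mono) auto
  qed
  also have "cmod (expectation (\<lambda>\<omega>. ?e \<omega> * R \<omega>)) \<le> (1 + \<kappa>\<^sup>2) * \<bar>b n\<bar>^3"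
  proof -
    have "cmod (expectation (\<lambda>\<omega>. ?e \<omega> * R \<omega>)) \<le> expectation (\<lambda>\<omega>. cmod (?e \<omega> * R \<omega>))"
      by (rule integral_norm_bound)
    also have "\<dots> \<le> expectation (\<lambda>\<omega>. \<bar>b n\<bar>^3 * (1 + (?u \<omega>)^4))"
      using R iR by (intro integral_mono integrable_norm) (auto simp: norm_mult)
    also have "\<dots> = \<bar>b n\<bar>^3 * (1 + expectation (\<lambda>\<omega>. (?u \<omega>)^4))" by (simp add: prob_space)
    also have "\<dots> \<le> \<bar>b n\<bar>^3 * (1 + \<kappa>\<^sup>2)"
      using expectation_xz4[of n] by (intro mult_left_mono) auto
    finally show ?thesis by (simp add: mult.commute)
  qed
  finally show ?thesis by (simp add: s_def)
qed

text \<open>One summand for each of the three errors of \<open>char_sum_step\<close>. The first two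
  are of order \<open>\<beta> * (b t)^2\<close>, the last of order
  \<open>\<beta>^2 * (b t)^2\<close>, whence the common factor \<open>\<beta> + \<beta>^2\<close>
  below.\<close>

definition clt_const :: real where
  "clt_const = (1 + \<kappa>\<^sup>2) + \<sigma>\<^sup>2 / 2 * (q_const / (1 - \<theta>\<^sup>2)) + (\<sigma>\<^sup>2 * m / 2)\<^sup>2"

text \<open>Each step multiplies the accumulated error by a factor \<open>exp (- s) \<le> 1\<close>,
  so the one-step errors simply add up. The bound is explicit in the maximum and the sum of squares
  of the coefficients, so it can be applied pointwise to random weights.\<close>

lemma clt_bound:
  assumes b: "\<And>t. t < n \<Longrightarrow> \<bar>b t\<bar> \<le> \<beta>" and \<beta>: "\<beta> \<ge> 0"
  shows "cmod (expectation (char_sum b n) - complex_of_real (exp (- (\<sigma>\<^sup>2 * m / 2 * (\<Sum>t<n. (b t)\<^sup>2)))))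
    \<le> clt_const * (\<beta> + \<beta>\<^sup>2) * (\<Sum>t<n. (b t)\<^sup>2)"
proof -
  let ?c = "\<sigma>\<^sup>2 * m / 2"
  have step: "cmod (expectation (char_sum b (Suc t)) - complex_of_real (exp (- (?c * (b t)\<^sup>2))) * expectation (char_sum b t))
      \<le> clt_const * (\<beta> + \<beta>\<^sup>2) * (b t)\<^sup>2" if t: "t < n" for t
  proof -
    have q0: "q_const / (1 - \<theta>\<^sup>2) \<ge> 0" using q_const_nonneg theta2 by simp
    have b2: "(b t)\<^sup>2 \<le> \<beta>\<^sup>2" using b[OF t] by (simp add: abs_le_square_iff[symmetric])
    have "(1 + \<kappa>\<^sup>2) * \<bar>b t\<bar> ^ 3 = (1 + \<kappa>\<^sup>2) * (\<bar>b t\<bar> * (b t)\<^sup>2)"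
      by (simp add: power3_eq_cube power2_eq_square)
    also have "\<dots> \<le> (1 + \<kappa>\<^sup>2) * ((\<beta> + \<beta>\<^sup>2) * (b t)\<^sup>2)"
      using b[OF t] by (intro mult_left_mono mult_right_mono) (auto intro: add_increasing2)
    finally have 1: "(1 + \<kappa>\<^sup>2) * \<bar>b t\<bar> ^ 3 \<le> (1 + \<kappa>\<^sup>2) * ((\<beta> + \<beta>\<^sup>2) * (b t)\<^sup>2)" .
    have "\<sigma>\<^sup>2 / 2 * (b t)\<^sup>2 * cmod (q b t) \<le> \<sigma>\<^sup>2 / 2 * (b t)\<^sup>2 * (q_const / (1 - \<theta>\<^sup>2) * (\<beta> + \<beta>\<^sup>2))"
    proof (intro mult_left_mono)
      have "cmod (q b t) \<le> q_const / (1 - \<theta>\<^sup>2) * \<beta>" using q_bound[of n b \<beta> t] b \<beta> t by simp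
      also have "\<dots> \<le> q_const / (1 - \<theta>\<^sup>2) * (\<beta> + \<beta>\<^sup>2)" using q0 by (intro mult_left_mono) auto
      finally show "cmod (q b t) \<le> q_const / (1 - \<theta>\<^sup>2) * (\<beta> + \<beta>\<^sup>2)" .
    qed auto
    then have 2: "\<sigma>\<^sup>2 / 2 * (b t)\<^sup>2 * cmod (q b t) \<le> (\<sigma>\<^sup>2 / 2 * (q_const / (1 - \<theta>\<^sup>2))) * ((\<beta> + \<beta>\<^sup>2) * (b t)\<^sup>2)"
      by (simp add: mult_ac)
    have "(?c * (b t)\<^sup>2)\<^sup>2 = ?c\<^sup>2 * ((b t)\<^sup>2 * (b t)\<^sup>2)" by (simp add: power2_eq_square)
    also have "\<dots> \<le> ?c\<^sup>2 * ((\<beta> + \<beta>\<^sup>2) * (b t)\<^sup>2)"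
      using b2 \<beta> by (intro mult_left_mono mult_right_mono) auto
    finally have 3: "(?c * (b t)\<^sup>2)\<^sup>2 \<le> ?c\<^sup>2 * ((\<beta> + \<beta>\<^sup>2) * (b t)\<^sup>2)" .
    have "clt_const * (\<beta> + \<beta>\<^sup>2) * (b t)\<^sup>2 = (1 + \<kappa>\<^sup>2) * ((\<beta> + \<beta>\<^sup>2) * (b t)\<^sup>2)
        + (\<sigma>\<^sup>2 / 2 * (q_const / (1 - \<theta>\<^sup>2))) * ((\<beta> + \<beta>\<^sup>2) * (b t)\<^sup>2) + ?c\<^sup>2 * ((\<beta> + \<beta>\<^sup>2) * (b t)\<^sup>2)"
      by (simp only: clt_const_def distrib_right mult.assoc)
    then show ?thesis using char_sum_step[of b t] 1 2 3 by linarith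
  qed
  have "cmod (expectation (char_sum b k) - complex_of_real (exp (- (?c * (\<Sum>t<k. (b t)\<^sup>2)))))
    \<le> clt_const * (\<beta> + \<beta>\<^sup>2) * (\<Sum>t<k. (b t)\<^sup>2)" if "k \<le> n" for k
    using that
  proof (induction k)
    case 0
    have "expectation (char_sum b 0) = 1" by (simp add: char_sum_def[abs_def] prob_space)
    then show ?case by simp
  next
    case (Suc k)
    let ?B = "\<Sum>t<k. (b t)\<^sup>2"
    have e: "complex_of_real (exp (- (?c * (\<Sum>t<Suc k. (b t)\<^sup>2)))) = complex_of_real (exp (- (?c * (b k)\<^sup>2))) * complex_of_real (exp (- (?c * ?B)))"
      unfolding of_real_mult[symmetric] exp_add[symmetric] by (simp add: algebra_simps)
    have eq: "expectation (char_sum b (Suc k)) - complex_of_real (exp (- (?c * (\<Sum>t<Suc k. (b t)\<^sup>2))))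
      = (expectation (char_sum b (Suc k)) - complex_of_real (exp (- (?c * (b k)\<^sup>2))) * expectation (char_sum b k))
        + complex_of_real (exp (- (?c * (b k)\<^sup>2))) * (expectation (char_sum b k) - complex_of_real (exp (- (?c * ?B))))"
      unfolding e by (simp add: algebra_simps)
    have "cmod (complex_of_real (exp (- (?c * (b k)\<^sup>2))) * (expectation (char_sum b k) - complex_of_real (exp (- (?c * ?B)))))
        \<le> 1 * cmod (expectation (char_sum b k) - complex_of_real (exp (- (?c * ?B))))"
      unfolding norm_mult norm_of_real using m_nonneg by (intro mult_right_mono) auto
    then have "cmod (complex_of_real (exp (- (?c * (b k)\<^sup>2))) * (expectation (char_sum b k) - complex_of_real (exp (- (?c * ?B)))))
        \<le> clt_const * (\<beta> + \<beta>\<^sup>2) * ?B"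
      using Suc by simp
    then show ?case
      unfolding eq using step[of k] Suc.prems
      by (intro order_trans[OF norm_triangle_ineq]) (simp add: distrib_left)
  qed
  then show ?thesis by simp
qed

section \<open>Orthogonality and the law of large numbers for the squares\<close>

lemma xz_orthogonal:
  assumes "s \<noteq> t"
  shows "expectation (\<lambda>\<omega>. (x s \<omega> * z s \<omega>) * (x t \<omega> * z t \<omega>)) = 0"
proof -
  have *: "expectation (\<lambda>\<omega>. (x s \<omega> * z s \<omega>) * (x t \<omega> * z t \<omega>)) = 0" if "s < t" for s t
  proof -
    have [measurable]: "x s \<in> borel_measurable (F t)" "z s \<in> borel_measurable (F t)" "x t \<in> borel_measurable (F t)"
      using that z_adapted x_adapted_le by auto
    have "expectation (\<lambda>\<omega>. ((x s \<omega> * z s \<omega>) * x t \<omega>) * z t \<omega>) = 0"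
      by (subst indep_mult[where g="\<lambda>y. y"]) (auto simp: z1 intro!: integrable_mult_of_squares)
    then show ?thesis by (simp add: mult.assoc)
  qed
  from assms consider "s < t" | "t < s" by linarith
  then show ?thesis using *[of s t] *[of t s] by cases (auto simp: mult.commute)
qed

text \<open>The recursion gives
  \<open>(1 - \<theta>^2) * (x t^2 - m) = x t^2 - x (t+1)^2 + h t\<close> with orthogonal
  \<open>h t\<close>. Summation telescopes to two boundary terms and a sum whose second moment grows
  linearly, so no decay of covariances of the squares has to be computed. The \<open>+ 1\<close> in
  the bound pays for the boundary terms.\<close>

lemma expectation_sum_squares_bound:
  "\<exists>K\<ge>0. \<forall>n. integrable M (\<lambda>\<omega>. (\<Sum>t<n. (x t \<omega>)\<^sup>2 - m)\<^sup>2) \<and>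
     expectation (\<lambda>\<omega>. (\<Sum>t<n. (x t \<omega>)\<^sup>2 - m)\<^sup>2) \<le> K * (real n + 1)"
proof -
  define h where "h t \<omega> = 2 * \<theta> * (x t \<omega> * z t \<omega>) + ((z t \<omega>)\<^sup>2 - \<sigma>\<^sup>2)" for t \<omega>
  have [measurable]: "h t \<in> borel_measurable M" for t unfolding h_def by measurable
  \<comment> \<open>Comes from \<open>(a + (b - c))^2 \<le> 2 * a^2 + 4 * b^2 + 4 * c^2\<close> with
    \<open>a = 2 * \<theta> * x * z\<close>, \<open>b = z^2\<close>,
    \<open>c = \<sigma>^2\<close>.\<close>
  define C where "C = 8 * \<theta>\<^sup>2 * (m * \<sigma>\<^sup>2) + 4 * \<kappa> + 4 * \<sigma>^4"
  have sq: "(a + (b - c))\<^sup>2 \<le> 2 * a\<^sup>2 + 4 * b\<^sup>2 + 4 * c\<^sup>2" for a b c :: real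
  proof -
    have "(a + d)\<^sup>2 \<le> 2 * a\<^sup>2 + 2 * d\<^sup>2" for a d :: real
      using zero_le_power2[of "a - d"] by (simp add: power2_eq_square algebra_simps)
    from this[of a "b - c"] this[of b "- c"] show ?thesis by simp
  qed
  have hle: "(h t \<omega>)\<^sup>2 \<le> 2 * (2 * \<theta>)\<^sup>2 * (x t \<omega> * z t \<omega>)\<^sup>2 + 4 * z t \<omega> ^ 4 + 4 * \<sigma>^4" for t \<omega>
    using sq[of "2 * \<theta> * (x t \<omega> * z t \<omega>)" "(z t \<omega>)\<^sup>2" "\<sigma>\<^sup>2"]
    by (simp add: h_def power_mult_distrib flip: power_mult)
  have ih: "integrable M (\<lambda>\<omega>. (h t \<omega>)\<^sup>2)" for t
  proof (rule Bochner_Integration.integrable_bound)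
    show "integrable M (\<lambda>\<omega>. 2 * (2 * \<theta>)\<^sup>2 * (x t \<omega> * z t \<omega>)\<^sup>2 + 4 * z t \<omega> ^ 4 + 4 * \<sigma>^4)" by simp
    show "AE \<omega> in M. norm ((h t \<omega>)\<^sup>2) \<le> norm (2 * (2 * \<theta>)\<^sup>2 * (x t \<omega> * z t \<omega>)\<^sup>2 + 4 * z t \<omega> ^ 4 + 4 * \<sigma>^4)"
      using hle by (intro AE_I2) (simp add: order_trans[OF _ abs_ge_self])
  qed simp
  have Eh: "expectation (\<lambda>\<omega>. (h t \<omega>)\<^sup>2) \<le> C" for t
  proof -
    have "expectation (\<lambda>\<omega>. (h t \<omega>)\<^sup>2)
        \<le> expectation (\<lambda>\<omega>. 2 * (2 * \<theta>)\<^sup>2 * (x t \<omega> * z t \<omega>)\<^sup>2 + 4 * z t \<omega> ^ 4 + 4 * \<sigma>^4)"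
      using ih hle by (intro integral_mono) auto
    also have "\<dots> \<le> C"
      using z4(2)[of t] expectation_xz2[of t]
      by (simp add: prob_space C_def power_mult_distrib[of 2])
    finally show ?thesis .
  qed
  have orth: "expectation (\<lambda>\<omega>. h s \<omega> * h t \<omega>) = 0" if "s < t" for s t
  proof -
    have [measurable]: "x s \<in> borel_measurable (F t)" "z s \<in> borel_measurable (F t)" "x t \<in> borel_measurable (F t)"
      using that z_adapted x_adapted_le by auto
    have [measurable]: "h s \<in> borel_measurable (F t)" unfolding h_def by measurable
    have i: "integrable M (h s)" by (rule square_integrable_imp_integrable[OF _ ih]) simp
    have i1: "integrable M (\<lambda>\<omega>. h s \<omega> * (2 * \<theta> * x t \<omega>))"
      using ih by (intro integrable_mult_of_squares) (auto simp: power_mult_distrib)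
    have "expectation (\<lambda>\<omega>. (h s \<omega> * (2 * \<theta> * x t \<omega>)) * z t \<omega>) = 0"
      using i1 by (subst indep_mult(1)[where g="\<lambda>y. y"]) (auto simp: z1)
    moreover have "expectation (\<lambda>\<omega>. h s \<omega> * ((z t \<omega>)\<^sup>2 - \<sigma>\<^sup>2)) = 0"
      using i by (subst indep_mult(1)[where g="\<lambda>y. y\<^sup>2 - \<sigma>\<^sup>2"]) (auto simp: z2 prob_space)
    moreover have "integrable M (\<lambda>\<omega>. (h s \<omega> * (2 * \<theta> * x t \<omega>)) * z t \<omega>)"
      using i1 by (intro indep_mult(2)[where g="\<lambda>y. y"]) auto
    moreover have "integrable M (\<lambda>\<omega>. h s \<omega> * ((z t \<omega>)\<^sup>2 - \<sigma>\<^sup>2))"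
      using i by (intro indep_mult(2)[where g="\<lambda>y. y\<^sup>2 - \<sigma>\<^sup>2"]) auto
    ultimately have "expectation (\<lambda>\<omega>. (h s \<omega> * (2 * \<theta> * x t \<omega>)) * z t \<omega> + h s \<omega> * ((z t \<omega>)\<^sup>2 - \<sigma>\<^sup>2)) = 0"
      by (subst Bochner_Integration.integral_add) auto
    then show ?thesis by (simp add: h_def[of t] algebra_simps)
  qed
  have C0: "C \<ge> 0" using m_nonneg \<kappa>_nonneg by (simp add: C_def)
  have ES: "expectation (\<lambda>\<omega>. (\<Sum>t<n. h t \<omega>)\<^sup>2) \<le> C * n" for n
  proof -
    have orth': "expectation (\<lambda>\<omega>. h s \<omega> * h t \<omega>) = (if s = t then expectation (\<lambda>\<omega>. (h t \<omega>)\<^sup>2) else 0)" for s t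
      using orth[of s t] orth[of t s] by (cases s t rule: linorder_cases) (auto simp: mult.commute power2_eq_square)
    have "expectation (\<lambda>\<omega>. (\<Sum>t<n. h t \<omega>)\<^sup>2) = (\<Sum>t<n. expectation (\<lambda>\<omega>. (h t \<omega>)\<^sup>2))"
      using ih by (subst integral_sum_square) (auto simp: orth')
    also have "\<dots> \<le> (\<Sum>t<n. C)" by (intro sum_mono Eh)
    finally show ?thesis by (simp add: mult.commute)
  qed
  define d where "d = 1 - \<theta>\<^sup>2"
  have d: "d > 0" using theta2 by (simp add: d_def)
  have \<sigma>d: "\<sigma>\<^sup>2 = d * m" using m by (simp add: d_def algebra_simps)
  have tele: "d * (\<Sum>t<n. (x t \<omega>)\<^sup>2 - m) = (x 0 \<omega>)\<^sup>2 - (x n \<omega>)\<^sup>2 + (\<Sum>t<n. h t \<omega>)" for n \<omega>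
  proof (induction n)
    case (Suc n)
    have "d * (\<Sum>t<Suc n. (x t \<omega>)\<^sup>2 - m) = (x 0 \<omega>)\<^sup>2 - (x n \<omega>)\<^sup>2 + (\<Sum>t<n. h t \<omega>) + d * ((x n \<omega>)\<^sup>2 - m)"
      using Suc by (simp add: distrib_left)
    also have "\<dots> = (x 0 \<omega>)\<^sup>2 - (x (Suc n) \<omega>)\<^sup>2 + (\<Sum>t<Suc n. h t \<omega>)"
      unfolding x_Suc using \<sigma>d by (simp add: h_def d_def power2_eq_square algebra_simps)
    finally show ?case .
  qed simp
  \<comment> \<open>The difference of the two sides is
    \<open>(a + b)^2 + (a - c)^2 + (b + c)^2\<close>.\<close>
  have sq3: "(a - b + c)\<^sup>2 \<le> 3 * (a\<^sup>2 + b\<^sup>2 + c\<^sup>2)" for a b c :: real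
    using zero_le_power2[of "a + b"] zero_le_power2[of "a - c"] zero_le_power2[of "b + c"]
    by (simp add: power2_eq_square algebra_simps)
  define G where "G n \<omega> = 3 * (x 0 \<omega> ^ 4 + x n \<omega> ^ 4 + (\<Sum>t<n. h t \<omega>)\<^sup>2) / d\<^sup>2" for n \<omega>
  have iG: "integrable M (G n)" for n
    unfolding G_def[abs_def] using ih
    by (intro integrable_divide integrable_mult_right Bochner_Integration.integrable_add integrable_sum_square) auto
  have le: "(\<Sum>t<n. (x t \<omega>)\<^sup>2 - m)\<^sup>2 \<le> G n \<omega>" for n \<omega>
  proof -
    have "d\<^sup>2 * (\<Sum>t<n. (x t \<omega>)\<^sup>2 - m)\<^sup>2 = ((x 0 \<omega>)\<^sup>2 - (x n \<omega>)\<^sup>2 + (\<Sum>t<n. h t \<omega>))\<^sup>2"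
      unfolding tele[symmetric] by (simp add: power_mult_distrib)
    also have "\<dots> \<le> d\<^sup>2 * G n \<omega>"
      using sq3[of "(x 0 \<omega>)\<^sup>2" "(x n \<omega>)\<^sup>2" "\<Sum>t<n. h t \<omega>"] d by (simp add: G_def flip: power_mult)
    finally show ?thesis using d by simp
  qed
  have i: "integrable M (\<lambda>\<omega>. (\<Sum>t<n. (x t \<omega>)\<^sup>2 - m)\<^sup>2)" for n
  proof (rule Bochner_Integration.integrable_bound[OF iG])
    show "AE \<omega> in M. norm ((\<Sum>t<n. (x t \<omega>)\<^sup>2 - m)\<^sup>2) \<le> norm (G n \<omega>)"
      using le[of _ n] by (intro AE_I2) (simp add: order_trans[OF _ abs_ge_self])
  qed simp
  have "expectation (\<lambda>\<omega>. (\<Sum>t<n. (x t \<omega>)\<^sup>2 - m)\<^sup>2) \<le> (3 * (2 * \<kappa> + C) / d\<^sup>2) * (real n + 1)" for n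
  proof -
    have "expectation (\<lambda>\<omega>. (\<Sum>t<n. (x t \<omega>)\<^sup>2 - m)\<^sup>2) \<le> expectation (G n)"
      by (intro integral_mono i iG le)
    also have "\<dots> = 3 * (expectation (\<lambda>\<omega>. x 0 \<omega> ^ 4) + expectation (\<lambda>\<omega>. x n \<omega> ^ 4)
        + expectation (\<lambda>\<omega>. (\<Sum>t<n. h t \<omega>)\<^sup>2)) / d\<^sup>2"
      unfolding G_def[abs_def] using ih by (simp add: integrable_sum_square)
    also have "\<dots> \<le> 3 * (2 * \<kappa> + C * n) / d\<^sup>2"
      using x4(2)[of 0] x4(2)[of n] ES[of n] by (intro divide_right_mono) auto
    also have "\<dots> \<le> 3 * ((2 * \<kappa> + C) * (real n + 1)) / d\<^sup>2"
      using \<kappa>_nonneg C0 by (intro divide_right_mono mult_left_mono) (auto simp: algebra_simps)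
    also have "\<dots> = (3 * (2 * \<kappa> + C) / d\<^sup>2) * (real n + 1)" by simp
    finally show ?thesis .
  qed
  moreover have "3 * (2 * \<kappa> + C) / d\<^sup>2 \<ge> 0" using \<kappa>_nonneg C0 by simp
  ultimately show ?thesis using i by blast
qed

end

subsection \<open>Conditional laws on product spaces\<close>

lemma prob_space_pair:
  assumes "prob_space P" "prob_space M"
  shows "prob_space (P \<Otimes>\<^sub>M M)"
proof -
  interpret P: prob_space P by fact
  interpret M: prob_space M by fact
  interpret PM: pair_prob_space P M ..
  show ?thesis by (rule PM.P.prob_space_axioms)
qed

lemma measure_pair_fst:
  assumes "prob_space P" "prob_space M" "A \<in> sets P"
  shows "measure (P \<Otimes>\<^sub>M M) (A \<times> space M) = measure P A"
proof -
  interpret P: prob_space P by fact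
  interpret M: prob_space M by fact
  show ?thesis
    using assms(3) by (simp add: measure_def M.emeasure_pair_measure_Times M.emeasure_space_1)
qed

lemma measure_pair_snd:
  assumes "prob_space P" "prob_space M" "A \<in> sets M"
  shows "measure (P \<Otimes>\<^sub>M M) (space P \<times> A) = measure M A"
proof -
  interpret P: prob_space P by fact
  interpret M: prob_space M by fact
  show ?thesis
    using assms(3) by (simp add: measure_def M.emeasure_pair_measure_Times P.emeasure_space_1)
qed

lemma converges_in_prob_pair_fst:
  assumes P: "prob_space P" and M: "prob_space M" and [measurable]: "\<And>n. V n \<in> borel_measurable P"
    and V: "converges_in_prob P V c"
  shows "converges_in_prob (P \<Otimes>\<^sub>M M) (\<lambda>n p. V n (fst p)) c"
proof -
  have "{p \<in> space (P \<Otimes>\<^sub>M M). \<bar>V n (fst p) - c\<bar> > e} = {p \<in> space P. \<bar>V n p - c\<bar> > e} \<times> space M" for n e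
    by (auto simp: space_pair_measure)
  then show ?thesis
    using V unfolding converges_in_prob_def by (simp add: measure_pair_fst[OF P M])
qed

lemma converges_in_prob_pair_snd:
  assumes P: "prob_space P" and M: "prob_space M" and [measurable]: "\<And>n. V n \<in> borel_measurable M"
    and V: "converges_in_prob M V c"
  shows "converges_in_prob (P \<Otimes>\<^sub>M M) (\<lambda>n p. V n (snd p)) c"
proof -
  have "{p \<in> space (P \<Otimes>\<^sub>M M). \<bar>V n (snd p) - c\<bar> > e} = space P \<times> {p \<in> space M. \<bar>V n p - c\<bar> > e}" for n e
    by (auto simp: space_pair_measure)
  then show ?thesis
    using V unfolding converges_in_prob_def by (simp add: measure_pair_snd[OF P M])
qed

lemma
  fixes f :: "'p \<Rightarrow> real" and g :: "'a \<Rightarrow> real"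
  assumes P: "prob_space P" and M: "prob_space M" and f: "integrable P f" and g: "integrable M g"
  shows integrable_pair_mult: "integrable (P \<Otimes>\<^sub>M M) (\<lambda>p. f (fst p) * g (snd p))"
    and integral_pair_mult: "(\<integral>p. f (fst p) * g (snd p) \<partial>(P \<Otimes>\<^sub>M M)) = (\<integral>p. f p \<partial>P) * (\<integral>\<omega>. g \<omega> \<partial>M)"
proof -
  interpret P: prob_space P by fact
  interpret M: prob_space M by fact
  interpret PM: pair_prob_space P M ..
  have [measurable]: "f \<in> borel_measurable P" "g \<in> borel_measurable M" using f g by auto
  have "integrable (P \<Otimes>\<^sub>M M) (\<lambda>(p, \<omega>). f p * g \<omega>)"
    using f g by (intro PM.Fubini_integrable) (auto simp: abs_mult)
  then show 1: "integrable (P \<Otimes>\<^sub>M M) (\<lambda>p. f (fst p) * g (snd p))" by (simp add: case_prod_beta')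
  show "(\<integral>p. f (fst p) * g (snd p) \<partial>(P \<Otimes>\<^sub>M M)) = (\<integral>p. f p \<partial>P) * (\<integral>\<omega>. g \<omega> \<partial>M)"
    using PM.integral_fst'[OF 1] by simp
qed

text \<open>Independence is built into the product measure, so mixed moments factorize. The second
  factor is the data for the sums \<open>T\<close> and \<open>B\<close>, and a second copy of the
  weights for the cross term of two replicas.\<close>

lemma pair_second_moment:
  fixes W :: "'i \<Rightarrow> 'p \<Rightarrow> real" and g :: "'i \<Rightarrow> 'a \<Rightarrow> real"
  assumes P: "prob_space P" and M: "prob_space M" and I: "finite I"
    and [measurable]: "\<And>i. i \<in> I \<Longrightarrow> W i \<in> borel_measurable P" "\<And>i. i \<in> I \<Longrightarrow> g i \<in> borel_measurable M"
    and W2: "\<And>i. i \<in> I \<Longrightarrow> integrable P (\<lambda>p. (W i p)\<^sup>2)"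
    and g2: "\<And>i. i \<in> I \<Longrightarrow> integrable M (\<lambda>p. (g i p)\<^sup>2)"
  shows "integrable (P \<Otimes>\<^sub>M M) (\<lambda>p. (\<Sum>i\<in>I. W i (fst p) * g i (snd p))\<^sup>2)" (is ?A)
    and "(\<integral>p. (\<Sum>i\<in>I. W i (fst p) * g i (snd p))\<^sup>2 \<partial>(P \<Otimes>\<^sub>M M))
      = (\<Sum>i\<in>I. \<Sum>j\<in>I. (\<integral>p. W i p * W j p \<partial>P) * (\<integral>\<omega>. g i \<omega> * g j \<omega> \<partial>M))" (is ?B)
proof -
  have sq: "integrable (P \<Otimes>\<^sub>M M) (\<lambda>p. (W i (fst p) * g i (snd p))\<^sup>2)" if "i \<in> I" for i
    using integrable_pair_mult[OF P M W2 g2] that by (simp add: power_mult_distrib)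
  show ?A by (rule integrable_sum_square[OF I _ sq]) measurable
  have "(\<integral>p. (W i (fst p) * g i (snd p)) * (W j (fst p) * g j (snd p)) \<partial>(P \<Otimes>\<^sub>M M))
      = (\<integral>p. W i p * W j p \<partial>P) * (\<integral>\<omega>. g i \<omega> * g j \<omega> \<partial>M)" if "i \<in> I" "j \<in> I" for i j
  proof -
    have "integrable P (\<lambda>p. W i p * W j p)" "integrable M (\<lambda>p. g i p * g j p)"
      using that W2 g2 by (auto intro!: integrable_mult_of_squares)
    from integral_pair_mult[OF P M this] show ?thesis by (simp add: mult_ac)
  qed
  then show ?B by (subst integral_sum_square[OF I _ sq]) (auto intro!: sum.cong)
qed

text \<open>The second moment of a conditional characteristic function is the characteristic function
  of the difference of two replicas sharing the data \<open>\<omega>\<close>. So convergence in probability of the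
  conditional law follows from unconditional statements, in which the replicas may be held fixed
  and the data integrated out first.\<close>

lemma conditional_clt_of_replicas:
  fixes T :: "nat \<Rightarrow> 'p \<Rightarrow> 'a \<Rightarrow> real"
  assumes P: "prob_space P" and M: "prob_space M"
    and T: "\<And>n. (\<lambda>q. T n (fst q) (snd q)) \<in> borel_measurable (P \<Otimes>\<^sub>M M)"
    and one: "\<And>u. (\<lambda>n. \<integral>p. (\<integral>\<omega>. iexp (u * T n p \<omega>) \<partial>M) \<partial>P) \<longlonglongrightarrow> complex_of_real (exp (- u\<^sup>2 / 2))"
    and two: "\<And>u. (\<lambda>n. \<integral>q. (\<integral>\<omega>. iexp (u * T n (fst q) \<omega> - u * T n (snd q) \<omega>) \<partial>M) \<partial>(P \<Otimes>\<^sub>M P))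
      \<longlonglongrightarrow> complex_of_real (exp (- u\<^sup>2))"
    and C: "C \<ge> 0" "\<And>n. (\<integral>\<^sup>+\<omega>. (\<integral>\<^sup>+p. ennreal \<bar>T n p \<omega>\<bar> \<partial>P) \<partial>M) \<le> ennreal C"
  shows "converges_in_prob M (\<lambda>n \<omega>. measure P {p \<in> space P. T n p \<omega> \<le> y}) (cdf std_normal_distribution y)"
proof -
  interpret P: prob_space P by fact
  interpret M: prob_space M by fact
  interpret PM: pair_prob_space P M ..
  interpret PP: pair_prob_space P P ..
  interpret PPM: pair_prob_space "P \<Otimes>\<^sub>M P" M ..
  \<comment> \<open>Joint measurability restated for arbitrary arguments, so that sections and
    iterated integrals of \<open>T\<close> are measurable automatically.\<close>
  have T'[measurable (raw)]: "(\<lambda>x. T n (f x) (g x)) \<in> borel_measurable N"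
    if "f \<in> measurable N P" "g \<in> measurable N M" for n N f and g :: "'z \<Rightarrow> 'a"
    using measurable_compose[OF measurable_Pair[OF that] T] by simp
  have T1[measurable]: "(\<lambda>p. T n p \<omega>) \<in> borel_measurable P" if "\<omega> \<in> space M" for n \<omega>
    using that by measurable
  have [measurable]: "cnj \<in> borel_measurable borel"
    by (intro borel_measurable_continuous_onI continuous_intros)
  define \<phi> where "\<phi> n u \<omega> = (\<integral>p. iexp (u * T n p \<omega>) \<partial>P)" for n u \<omega>
  have \<phi>_meas[measurable]: "\<phi> n u \<in> borel_measurable M" for n u unfolding \<phi>_def by measurable
  have \<phi>_le: "cmod (\<phi> n u \<omega>) \<le> 1" for n u \<omega>
  proof -
    have "cmod (\<phi> n u \<omega>) \<le> (\<integral>p. cmod (iexp (u * T n p \<omega>)) \<partial>P)" unfolding \<phi>_def by (rule integral_norm_bound)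
    then show ?thesis by (simp add: P.prob_space)
  qed
  have \<phi>_int: "integrable M (\<phi> n u)" for n u
    by (rule M.integrable_const_bound[of _ 1]) (auto simp: \<phi>_le)
  have \<phi>_conv: "converges_in_prob M (\<lambda>n \<omega>. cmod (\<phi> n u \<omega> - exp (- u\<^sup>2 / 2))) 0" for u
  proof (rule M.converges_in_prob_L2[OF _ order_refl])
    define c where "c = exp (- u\<^sup>2 / 2)"
    have c1: "c \<le> 1" "c \<ge> 0" by (simp_all add: c_def)
    have bd: "(cmod (\<phi> n u \<omega> - c))\<^sup>2 \<le> 2\<^sup>2" for n \<omega>
    proof (rule power_mono)
      show "cmod (\<phi> n u \<omega> - c) \<le> 2"
        using norm_triangle_ineq4[of "\<phi> n u \<omega>" "complex_of_real c"] \<phi>_le[of n u \<omega>] c1 by simp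
    qed simp
    show int: "integrable M (\<lambda>\<omega>. (cmod (\<phi> n u \<omega> - exp (- u\<^sup>2 / 2)))\<^sup>2)" for n
      unfolding c_def[symmetric]
    proof (rule M.integrable_const_bound)
      show "AE \<omega> in M. norm ((cmod (\<phi> n u \<omega> - c))\<^sup>2) \<le> 2\<^sup>2"
        using bd by (intro AE_I2) simp
    qed measurable
    have sq: "\<phi> n u \<omega> * cnj (\<phi> n u \<omega>)
        = (\<integral>q. iexp (u * T n (fst q) \<omega> - u * T n (snd q) \<omega>) \<partial>(P \<Otimes>\<^sub>M P))" if \<omega>[measurable]: "\<omega> \<in> space M" for n \<omega>
    proof -
      have i: "integrable (P \<Otimes>\<^sub>M P) (\<lambda>q. iexp (u * T n (fst q) \<omega> - u * T n (snd q) \<omega>))"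
        by (rule PP.P.integrable_const_bound[of _ 1]) (simp only: norm_exp_i_times order_refl AE_I2, measurable)
      have e: "iexp (u * T n p \<omega> - u * T n q \<omega>) = iexp (u * T n p \<omega>) * cnj (iexp (u * T n q \<omega>))" for p q
        by (simp add: exp_cnj algebra_simps flip: exp_add)
      have "(\<integral>q. iexp (u * T n (fst q) \<omega> - u * T n (snd q) \<omega>) \<partial>(P \<Otimes>\<^sub>M P))
          = (\<integral>p. (\<integral>q. iexp (u * T n p \<omega> - u * T n q \<omega>) \<partial>P) \<partial>P)"
        using PP.integral_fst'[OF i] by simp
      also have "\<dots> = \<phi> n u \<omega> * cnj (\<phi> n u \<omega>)"
        unfolding \<phi>_def e by simp
      finally show ?thesis by simp
    qed
    have two': "(\<integral>\<omega>. \<phi> n u \<omega> * cnj (\<phi> n u \<omega>) \<partial>M)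
        = (\<integral>q. (\<integral>\<omega>. iexp (u * T n (fst q) \<omega> - u * T n (snd q) \<omega>) \<partial>M) \<partial>(P \<Otimes>\<^sub>M P))" for n
    proof -
      have "(\<integral>\<omega>. \<phi> n u \<omega> * cnj (\<phi> n u \<omega>) \<partial>M)
          = (\<integral>\<omega>. (\<integral>q. iexp (u * T n (fst q) \<omega> - u * T n (snd q) \<omega>) \<partial>(P \<Otimes>\<^sub>M P)) \<partial>M)"
        by (intro Bochner_Integration.integral_cong sq) auto
      also have "\<dots> = (\<integral>q. (\<integral>\<omega>. iexp (u * T n (fst q) \<omega> - u * T n (snd q) \<omega>) \<partial>M) \<partial>(P \<Otimes>\<^sub>M P))"
        by (rule PPM.Fubini_integral, rule PPM.P.integrable_const_bound[of _ 1])
          (simp only: case_prod_beta' norm_exp_i_times order_refl AE_I2, measurable)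
      finally show ?thesis .
    qed
    have one': "(\<integral>\<omega>. \<phi> n u \<omega> \<partial>M) = (\<integral>p. (\<integral>\<omega>. iexp (u * T n p \<omega>) \<partial>M) \<partial>P)" for n
      unfolding \<phi>_def by (rule PM.Fubini_integral, rule PM.P.integrable_const_bound[of _ 1])
        (simp only: case_prod_beta' norm_exp_i_times order_refl AE_I2, measurable)
    have i2: "integrable M (\<lambda>\<omega>. \<phi> n u \<omega> * cnj (\<phi> n u \<omega>))" for n
    proof (rule M.integrable_const_bound[of _ 1])
      show "AE \<omega> in M. cmod (\<phi> n u \<omega> * cnj (\<phi> n u \<omega>)) \<le> 1"
        using mult_le_one[OF \<phi>_le norm_ge_zero \<phi>_le] by (simp add: norm_mult)
    qed measurable
    have "complex_of_real (\<integral>\<omega>. (cmod (\<phi> n u \<omega> - exp (- u\<^sup>2 / 2)))\<^sup>2 \<partial>M)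
        = (\<integral>\<omega>. \<phi> n u \<omega> * cnj (\<phi> n u \<omega>) \<partial>M) - complex_of_real c * (\<integral>\<omega>. \<phi> n u \<omega> \<partial>M)
          - complex_of_real c * cnj (\<integral>\<omega>. \<phi> n u \<omega> \<partial>M) + complex_of_real (c\<^sup>2)" for n
    proof -
      have expand: "complex_of_real ((cmod (v - complex_of_real c))\<^sup>2)
          = v * cnj v - complex_of_real c * v - complex_of_real c * cnj v + complex_of_real (c\<^sup>2)" for v
        unfolding complex_norm_square by (simp add: right_diff_distrib left_diff_distrib power2_eq_square mult.commute)
      have "complex_of_real (\<integral>\<omega>. (cmod (\<phi> n u \<omega> - exp (- u\<^sup>2 / 2)))\<^sup>2 \<partial>M)
          = (\<integral>\<omega>. \<phi> n u \<omega> * cnj (\<phi> n u \<omega>) - complex_of_real c * \<phi> n u \<omega>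
              - complex_of_real c * cnj (\<phi> n u \<omega>) + complex_of_real (c\<^sup>2) \<partial>M)"
        unfolding c_def[symmetric] integral_complex_of_real[symmetric] expand ..
      also have "\<dots> = (\<integral>\<omega>. \<phi> n u \<omega> * cnj (\<phi> n u \<omega>) \<partial>M) - complex_of_real c * (\<integral>\<omega>. \<phi> n u \<omega> \<partial>M)
          - complex_of_real c * cnj (\<integral>\<omega>. \<phi> n u \<omega> \<partial>M) + complex_of_real (c\<^sup>2)"
        using \<phi>_int i2 by (simp add: M.prob_space)
      finally show ?thesis .
    qed
    moreover have "(\<lambda>n. (\<integral>\<omega>. \<phi> n u \<omega> * cnj (\<phi> n u \<omega>) \<partial>M) - complex_of_real c * (\<integral>\<omega>. \<phi> n u \<omega> \<partial>M)
          - complex_of_real c * cnj (\<integral>\<omega>. \<phi> n u \<omega> \<partial>M) + complex_of_real (c\<^sup>2))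
        \<longlonglongrightarrow> complex_of_real (exp (- u\<^sup>2)) - complex_of_real c * complex_of_real c
          - complex_of_real c * cnj (complex_of_real c) + complex_of_real (c\<^sup>2)"
      unfolding one' two' using one[of u] two[of u] unfolding c_def[symmetric] by (intro tendsto_intros)
    \<comment> \<open>The limits cancel because the limit for two replicas is the square of the
      limit for one.\<close>
    moreover have "complex_of_real (exp (- u\<^sup>2)) - complex_of_real c * complex_of_real c
          - complex_of_real c * cnj (complex_of_real c) + complex_of_real (c\<^sup>2) = 0"
    proof -
      have "exp (- u\<^sup>2) = c * c" by (simp add: c_def flip: exp_add)
      then show ?thesis by (simp add: power2_eq_square)
    qed
    ultimately have "(\<lambda>n. complex_of_real (\<integral>\<omega>. (cmod (\<phi> n u \<omega> - exp (- u\<^sup>2 / 2)))\<^sup>2 \<partial>M)) \<longlonglongrightarrow> complex_of_real 0"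
      by simp
    then show "(\<lambda>n. \<integral>\<omega>. (cmod (\<phi> n u \<omega> - exp (- u\<^sup>2 / 2)))\<^sup>2 \<partial>M) \<longlonglongrightarrow> 0"
      by (simp only: tendsto_of_real_iff)
  qed
  define L where "L n \<omega> = distr P borel (\<lambda>p. T n p \<omega>)" for n \<omega>
  define H where "H n \<omega> = (\<integral>\<^sup>+p. ennreal \<bar>T n p \<omega>\<bar> \<partial>P)" for n \<omega>
  have [measurable]: "H n \<in> borel_measurable M" for n unfolding H_def by measurable
  show ?thesis
  proof (rule M.converges_in_probI)
    fix \<epsilon> \<eta> :: real assume \<epsilon>: "\<epsilon> > 0" and \<eta>: "\<eta> > 0"
    \<comment> \<open>By Markov's inequality the conditional first moment exceeds \<open>C0\<close>
      with probability at most \<open>C / C0 < \<eta> / 2\<close>; elsewhere the conditional law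
      satisfies the moment hypothesis of the compactness lemma.\<close>
    define C0 where "C0 = 2 * (C + 1) / \<eta>"
    have C0: "C0 > 0" using C \<eta> by (simp add: C0_def)
    obtain U \<delta> where U: "finite U" and \<delta>: "\<delta> > 0"
      and close: "\<And>\<mu>. real_distribution \<mu> \<Longrightarrow> (\<integral>\<^sup>+y. ennreal \<bar>y\<bar> \<partial>\<mu>) \<le> ennreal C0 \<Longrightarrow>
        (\<And>u. u \<in> U \<Longrightarrow> cmod (char \<mu> u - char std_normal_distribution u) < \<delta>) \<Longrightarrow>
        \<bar>cdf \<mu> y - cdf std_normal_distribution y\<bar> < \<epsilon>"
      using cdf_close_std_normal[of C0 \<epsilon> y] C0 \<epsilon> by (auto simp: less_imp_le)
    let ?bad = "\<lambda>n. {\<omega>\<in>space M. \<bar>measure P {p \<in> space P. T n p \<omega> \<le> y} - cdf std_normal_distribution y\<bar> > \<epsilon>}"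
    \<comment> \<open>\<open>H n \<omega>\<close> may be infinite for some data, so the event is
      written in the form used by Markov's inequality for extended integrals.\<close>
    let ?A = "\<lambda>n. {\<omega>\<in>space M. 1 \<le> ennreal (1 / C0) * H n \<omega>}"
    let ?B = "\<lambda>n u. {\<omega>\<in>space M. \<bar>cmod (\<phi> n u \<omega> - exp (- u\<^sup>2 / 2)) - 0\<bar> > \<delta> / 2}"
    have sub: "?bad n \<subseteq> ?A n \<union> (\<Union>u\<in>U. ?B n u)" for n
    proof
      fix \<omega> assume \<omega>: "\<omega> \<in> ?bad n"
      then have \<omega>M[measurable]: "\<omega> \<in> space M" by simp
      show "\<omega> \<in> ?A n \<union> (\<Union>u\<in>U. ?B n u)"
      proof (rule ccontr)
        assume neg: "\<not> ?thesis"
        have "real_distribution (L n \<omega>)"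
          unfolding L_def real_distribution_def real_distribution_axioms_def by (auto intro!: P.prob_space_distr)
        moreover have "(\<integral>\<^sup>+y. ennreal \<bar>y\<bar> \<partial>L n \<omega>) \<le> ennreal C0"
        proof -
          have "ennreal (1 / C0) * H n \<omega> < 1" using neg \<omega>M by (auto simp: not_le)
          then have "ennreal C0 * (ennreal (1 / C0) * H n \<omega>) \<le> ennreal C0 * 1"
            by (intro mult_left_mono) auto
          moreover have "ennreal C0 * (ennreal (1 / C0) * H n \<omega>) = H n \<omega>"
            using C0 by (simp add: mult.assoc[symmetric] ennreal_mult[symmetric])
          ultimately have "H n \<omega> \<le> ennreal C0" by simp
          then show ?thesis unfolding L_def H_def by (simp add: nn_integral_distr)
        qed
        moreover have "cmod (char (L n \<omega>) u - char std_normal_distribution u) < \<delta>" if u: "u \<in> U" for u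
        proof -
          have "char (L n \<omega>) u = \<phi> n u \<omega>" unfolding char_def L_def \<phi>_def by (simp add: integral_distr)
          moreover have "cmod (\<phi> n u \<omega> - exp (- u\<^sup>2 / 2)) \<le> \<delta> / 2" using neg u \<omega>M by auto
          ultimately show ?thesis using \<delta> by (simp add: char_std_normal_distribution)
        qed
        ultimately have "\<bar>cdf (L n \<omega>) y - cdf std_normal_distribution y\<bar> < \<epsilon>" by (rule close)
        moreover have "cdf (L n \<omega>) y = measure P {p \<in> space P. T n p \<omega> \<le> y}"
          unfolding cdf_def L_def by (subst measure_distr) (auto simp: vimage_def Int_def conj_commute)
        ultimately show False using \<omega> by auto
      qed
    qed
    have A: "M.prob (?A n) < \<eta> / 2" for n
    proof -
      have "emeasure M (?A n) \<le> ennreal (1 / C0) * (\<integral>\<^sup>+\<omega>. H n \<omega> * indicator (space M) \<omega> \<partial>M)"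
        using nn_integral_Markov_inequality[of "H n" "space M" M "ennreal (1 / C0)"]
        by (simp add: sets.Int_space_eq2)
      also have "(\<integral>\<^sup>+\<omega>. H n \<omega> * indicator (space M) \<omega> \<partial>M) = (\<integral>\<^sup>+\<omega>. H n \<omega> \<partial>M)"
        by (intro nn_integral_cong) auto
      also have "ennreal (1 / C0) * \<dots> \<le> ennreal (1 / C0) * ennreal C"
        using C(2)[of n] by (intro mult_left_mono) (auto simp: H_def)
      also have "\<dots> = ennreal (C / C0)" using C C0 by (simp add: ennreal_mult[symmetric])
      finally have "M.prob (?A n) \<le> C / C0"
        using C C0 by (simp add: M.emeasure_eq_measure)
      also have "\<dots> < \<eta> / 2" using C \<eta> by (simp add: C0_def field_simps)
      finally show ?thesis .
    qed
    \<comment> \<open>The \<open>+ 1\<close> covers an empty \<open>U\<close> and keeps the sum over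
      \<open>U\<close> strictly below \<open>\<eta> / 2\<close>.\<close>
    define r where "r = \<eta> / (2 * (real (card U) + 1))"
    have r: "r > 0" using \<eta> by (simp add: r_def)
    have "\<forall>\<^sub>F n in sequentially. \<forall>u\<in>U. M.prob (?B n u) < r"
      using U M.converges_in_probD[OF \<phi>_conv _ r, of "\<delta> / 2"] \<delta> by (simp add: eventually_ball_finite)
    then show "\<forall>\<^sub>F n in sequentially. M.prob (?bad n) < \<eta>"
    proof eventually_elim
      case (elim n)
      have "M.prob (\<Union>u\<in>U. ?B n u) \<le> (\<Sum>u\<in>U. M.prob (?B n u))"
        using U by (intro M.finite_measure_subadditive_finite) auto
      also have "\<dots> \<le> (\<Sum>u\<in>U. r)" using elim by (intro sum_mono) auto
      also have "\<dots> < \<eta> / 2" using \<eta> by (simp add: r_def field_simps)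
      finally have "M.prob (\<Union>u\<in>U. ?B n u) < \<eta> / 2" .
      then have "M.prob (?bad n) < \<eta> / 2 + \<eta> / 2"
        using U by (intro M.prob_union_less[OF sub _ _ A]) auto
      then show ?case by simp
    qed
  qed
qed

text \<open>A small joint probability of \<open>\<bar>V - r * T\<bar> > h\<close> is by Fubini the
  mean of the conditional probabilities \<open>H\<close>, so by Markov these are small for most
  data. For such data the conditional distribution function of \<open>V\<close> at \<open>x\<close>
  lies, up to \<open>H\<close>, between those of \<open>T\<close> at \<open>(x - h) / r\<close> and
  \<open>(x + h) / r\<close>, and continuity of the normal one closes the gap.\<close>

lemma conditional_slutsky:
  fixes T V :: "nat \<Rightarrow> 'p \<Rightarrow> 'a \<Rightarrow> real"
  assumes P: "prob_space P" and M: "prob_space M"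
    and T: "\<And>n. (\<lambda>q. T n (fst q) (snd q)) \<in> borel_measurable (P \<Otimes>\<^sub>M M)"
    and V: "\<And>n. (\<lambda>q. V n (fst q) (snd q)) \<in> borel_measurable (P \<Otimes>\<^sub>M M)"
    and r: "r > 0"
    and VT: "converges_in_prob (P \<Otimes>\<^sub>M M) (\<lambda>n q. V n (fst q) (snd q) - r * T n (fst q) (snd q)) 0"
    and conv: "\<And>y. converges_in_prob M (\<lambda>n \<omega>. measure P {p \<in> space P. T n p \<omega> \<le> y}) (cdf std_normal_distribution y)"
  shows "converges_in_prob M (\<lambda>n \<omega>. measure P {p \<in> space P. V n p \<omega> \<le> x}) (cdf std_normal_distribution (x / r))"
proof -
  interpret P: prob_space P by fact
  interpret M: prob_space M by fact
  interpret PM: pair_prob_space P M ..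
  let ?\<Phi> = "cdf std_normal_distribution"
  have T'[measurable (raw)]: "(\<lambda>x. T n (f x) (g x)) \<in> borel_measurable N"
    if "f \<in> measurable N P" "g \<in> measurable N M" for n N f and g :: "'z \<Rightarrow> 'a"
    using measurable_compose[OF measurable_Pair[OF that] T] by simp
  have V'[measurable (raw)]: "(\<lambda>x. V n (f x) (g x)) \<in> borel_measurable N"
    if "f \<in> measurable N P" "g \<in> measurable N M" for n N f and g :: "'z \<Rightarrow> 'a"
    using measurable_compose[OF measurable_Pair[OF that] V] by simp
  define G where "G n y \<omega> = P.prob {p \<in> space P. T n p \<omega> \<le> y}" for n y \<omega>
  define K where "K n \<omega> = P.prob {p \<in> space P. V n p \<omega> \<le> x}" for n \<omega>
  show ?thesis
  proof (rule M.converges_in_probI)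
    fix \<epsilon> \<eta> :: real assume \<epsilon>: "\<epsilon> > 0" and \<eta>: "\<eta> > 0"
    have "\<forall>e>0. \<exists>d>0. \<forall>y. dist y (x / r) < d \<longrightarrow> dist (?\<Phi> y) (?\<Phi> (x / r)) < e"
      using isCont_cdf_std_normal[of "x / r"] by (simp add: continuous_at_eps_delta)
    then obtain d where d: "d > 0" "\<And>y. dist y (x / r) < d \<Longrightarrow> dist (?\<Phi> y) (?\<Phi> (x / r)) < \<epsilon> / 4"
      using \<epsilon> by (meson divide_pos_pos zero_less_numeral)
    \<comment> \<open>Places both \<open>a\<close> and \<open>b\<close> at distance
      \<open>d / 2\<close> from \<open>x / r\<close>.\<close>
    define h where "h = d * r / 2"
    have h: "h > 0" using d r by (simp add: h_def)
    define a b where "a = (x - h) / r" and "b = (x + h) / r"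
    have "dist a (x / r) < d" "dist b (x / r) < d"
      using d r by (simp_all add: a_def b_def h_def dist_real_def diff_divide_distrib add_divide_distrib)
    then have ab: "\<bar>?\<Phi> a - ?\<Phi> (x / r)\<bar> < \<epsilon> / 4" "\<bar>?\<Phi> b - ?\<Phi> (x / r)\<bar> < \<epsilon> / 4"
      using d(2) by (auto simp: dist_real_def)
    define H where "H n \<omega> = P.prob {p \<in> space P. \<bar>V n p \<omega> - r * T n p \<omega> - 0\<bar> > h}" for n \<omega>
    have [measurable]: "H n \<in> borel_measurable M" "K n \<in> borel_measurable M" "G n y \<in> borel_measurable M" for n y
      unfolding H_def K_def G_def by measurable
    have EH: "M.expectation (H n) = PM.prob {q \<in> space (P \<Otimes>\<^sub>M M). \<bar>V n (fst q) (snd q) - r * T n (fst q) (snd q) - 0\<bar> > h}" for n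
    proof -
      let ?S = "{q \<in> space (P \<Otimes>\<^sub>M M). \<bar>V n (fst q) (snd q) - r * T n (fst q) (snd q) - 0\<bar> > h}"
      have "emeasure (P \<Otimes>\<^sub>M M) ?S = (\<integral>\<^sup>+\<omega>. emeasure P ((\<lambda>p. (p, \<omega>)) -` ?S) \<partial>M)"
        by (rule PM.emeasure_pair_measure_alt2) measurable
      also have "\<dots> = (\<integral>\<^sup>+\<omega>. ennreal (H n \<omega>) \<partial>M)"
        unfolding H_def P.emeasure_eq_measure[symmetric]
        by (intro nn_integral_cong arg_cong[where f="emeasure P"]) (auto simp: space_pair_measure)
      also have "\<dots> = ennreal (M.expectation (H n))"
        by (intro nn_integral_eq_integral M.integrable_const_bound[of _ 1]) (auto simp: H_def)
      finally show ?thesis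
        by (simp add: PM.P.emeasure_eq_measure H_def integral_nonneg)
    qed
    have bounds: "G n a \<omega> - H n \<omega> \<le> K n \<omega>" "K n \<omega> \<le> G n b \<omega> + H n \<omega>" if \<omega>[measurable]: "\<omega> \<in> space M" for n \<omega>
    proof -
      have *: "P.prob A \<le> P.prob B + P.prob D" if "A \<subseteq> B \<union> D" "B \<in> P.events" "D \<in> P.events" for A B D
        using that by (meson P.finite_measure_mono measure_Un_le order_trans sets.Un)
      have "G n a \<omega> \<le> K n \<omega> + H n \<omega>" unfolding G_def K_def H_def
      proof (rule *)
        show "{p \<in> space P. T n p \<omega> \<le> a} \<subseteq> {p \<in> space P. V n p \<omega> \<le> x} \<union> {p \<in> space P. h < \<bar>V n p \<omega> - r * T n p \<omega> - 0\<bar>}"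
          using r by (auto simp: a_def field_simps)
      qed measurable
      then show "G n a \<omega> - H n \<omega> \<le> K n \<omega>" by simp
      show "K n \<omega> \<le> G n b \<omega> + H n \<omega>" unfolding G_def K_def H_def
      proof (rule *)
        show "{p \<in> space P. V n p \<omega> \<le> x} \<subseteq> {p \<in> space P. T n p \<omega> \<le> b} \<union> {p \<in> space P. h < \<bar>V n p \<omega> - r * T n p \<omega> - 0\<bar>}"
          using r by (auto simp: b_def field_simps)
      qed measurable
    qed
    have e4: "\<epsilon> / 4 > 0" and h3: "\<eta> / 3 > 0" and eh: "\<epsilon> / 4 * (\<eta> / 3) > 0" using \<epsilon> \<eta> by auto
    from M.converges_in_probD[OF conv e4 h3, of a] M.converges_in_probD[OF conv e4 h3, of b]
      prob_space.converges_in_probD[OF prob_space_pair[OF P M] VT h eh]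
    show "\<forall>\<^sub>F n in sequentially. M.prob {\<omega> \<in> space M. \<bar>P.prob {p \<in> space P. V n p \<omega> \<le> x} - ?\<Phi> (x / r)\<bar> > \<epsilon>} < \<eta>"
    proof eventually_elim
      case (elim n)
      let ?A = "{\<omega> \<in> space M. \<bar>G n a \<omega> - ?\<Phi> a\<bar> > \<epsilon> / 4}" and ?B = "{\<omega> \<in> space M. \<bar>G n b \<omega> - ?\<Phi> b\<bar> > \<epsilon> / 4}"
        and ?H = "{\<omega> \<in> space M. H n \<omega> > \<epsilon> / 4}"
      have pH: "M.prob ?H < \<eta> / 3"
      proof (rule M.markov_less)
        show "integrable M (H n)" by (rule M.integrable_const_bound[of _ 1]) (auto simp: H_def)
        show "M.expectation (H n) < \<epsilon> / 4 * (\<eta> / 3)" using elim(3) unfolding EH .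
        show "H n \<omega> \<ge> 0" for \<omega> by (simp add: H_def)
      qed fact
      have sub: "{\<omega> \<in> space M. \<bar>K n \<omega> - ?\<Phi> (x / r)\<bar> > \<epsilon>} \<subseteq> (?A \<union> ?B) \<union> ?H"
      proof (safe, rule ccontr)
        fix \<omega> assume *: "\<epsilon> < \<bar>K n \<omega> - ?\<Phi> (x / r)\<bar>" "\<omega> \<in> space M" "\<not> \<epsilon> / 4 < H n \<omega>"
          "\<not> \<epsilon> / 4 < \<bar>G n b \<omega> - ?\<Phi> b\<bar>" "\<not> \<epsilon> / 4 < \<bar>G n a \<omega> - ?\<Phi> a\<bar>"
        then show False using bounds[of \<omega> n] ab by linarith
      qed
      have "M.prob (?A \<union> ?B) < \<eta> / 3 + \<eta> / 3"
        using elim(1,2) unfolding G_def[symmetric] by (intro M.prob_union_less[OF order_refl]) auto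
      then have "M.prob {\<omega> \<in> space M. \<bar>K n \<omega> - ?\<Phi> (x / r)\<bar> > \<epsilon>} < \<eta> / 3 + \<eta> / 3 + \<eta> / 3"
        using pH by (intro M.prob_union_less[OF sub]) auto
      then show ?case unfolding K_def by simp
    qed
  qed
qed

section \<open>Independence and conditional probabilities\<close>

lemma distr_indep_elements:
  assumes M: "prob_space M" and ind: "indep_elements M S U T V"
  shows "distr M (S \<Otimes>\<^sub>M T) (\<lambda>\<omega>. (U \<omega>, V \<omega>)) = distr M S U \<Otimes>\<^sub>M distr M T V"
proof -
  interpret prob_space M by fact
  have [measurable]: "U \<in> measurable M S" "V \<in> measurable M T"
    and ind_sets: "indep_set (sets (vimage_algebra (space M) U S)) (sets (vimage_algebra (space M) V T))"
    using ind by (auto simp: indep_elements_def)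
  have "prob_space (distr M S U)" "prob_space (distr M T V)" by (auto intro: prob_space_distr)
  then interpret S: prob_space "distr M S U" + T: prob_space "distr M T V" .
  show ?thesis
  proof (rule pair_measure_eqI[symmetric])
    show "sigma_finite_measure (distr M S U)" "sigma_finite_measure (distr M T V)" by unfold_locales
    fix A B assume "A \<in> sets (distr M S U)" "B \<in> sets (distr M T V)"
    then have [measurable]: "A \<in> sets S" "B \<in> sets T" by auto
    have "prob ((U -` A \<inter> space M) \<inter> (V -` B \<inter> space M)) = prob (U -` A \<inter> space M) * prob (V -` B \<inter> space M)"
      by (rule indep_setD[OF ind_sets]) (auto intro!: in_vimage_algebra)
    moreover have "(\<lambda>\<omega>. (U \<omega>, V \<omega>)) -` (A \<times> B) \<inter> space M = (U -` A \<inter> space M) \<inter> (V -` B \<inter> space M)" by auto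
    ultimately show "emeasure (distr M S U) A * emeasure (distr M T V) B
        = emeasure (distr M (S \<Otimes>\<^sub>M T) (\<lambda>\<omega>. (U \<omega>, V \<omega>))) (A \<times> B)"
      by (simp add: emeasure_distr emeasure_eq_measure ennreal_mult)
  qed (auto intro!: sets_pair_measure_cong)
qed

lemma indep_elements_compose:
  assumes ind: "indep_elements M S U T V" and g: "g \<in> measurable T T'" and sp: "prob_space M"
  shows "indep_elements M S U T' (\<lambda>\<omega>. g (V \<omega>))"
proof -
  interpret prob_space M by fact
  have V: "V \<in> measurable M T" and U: "U \<in> measurable M S"
    and ind_sets: "indep_set (sets (vimage_algebra (space M) U S)) (sets (vimage_algebra (space M) V T))"
    using ind by (auto simp: indep_elements_def)
  have "sets (vimage_algebra (space M) (\<lambda>\<omega>. g (V \<omega>)) T') \<subseteq> sets (vimage_algebra (space M) V T)"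
  proof (rule sets_image_in_sets)
    show "(\<lambda>\<omega>. g (V \<omega>)) \<in> measurable (vimage_algebra (space M) V T) T'"
      using V by (intro measurable_compose[OF measurable_vimage_algebra1 g]) (auto simp: measurable_space)
  qed simp
  then show ?thesis
    using ind_sets U measurable_compose[OF V g] unfolding indep_elements_def indep_sets2_eq by blast
qed

text \<open>Conditioning on \<open>V\<close> freezes it while the independent \<open>U\<close> is
  integrated out; by Fubini for the product law the section probability has the defining integrals
  of the conditional expectation. The section is again measured by \<open>M\<close>, so a single
  space can later serve as both factors of the product.\<close>

lemma real_cond_exp_indep_elements:
  assumes M: "prob_space M" and ind: "indep_elements M S U T V" and A[measurable]: "A \<in> sets (S \<Otimes>\<^sub>M T)"
  shows "AE \<omega> in M. real_cond_exp M (vimage_algebra (space M) V T) (indicator {\<omega> \<in> space M. (U \<omega>, V \<omega>) \<in> A}) \<omega>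
    = measure M {\<omega>' \<in> space M. (U \<omega>', V \<omega>) \<in> A}"
proof -
  interpret prob_space M by fact
  let ?F = "vimage_algebra (space M) V T"
  have [measurable]: "U \<in> measurable M S" "V \<in> measurable M T"
    using ind by (auto simp: indep_elements_def)
  have sub: "subalgebra M ?F"
    unfolding subalgebra_def using sets_image_in_sets[of M "space M" V T] by simp
  interpret finite_measure_subalgebra M ?F by unfold_locales (rule sub)
  have VF: "V \<in> measurable ?F T"
    by (intro measurable_vimage_algebra1) (auto simp: measurable_space[of V M T])
  define G where "G v = measure M {\<omega>' \<in> space M. (U \<omega>', v) \<in> A}" for v
  have G[measurable]: "G \<in> borel_measurable T" unfolding G_def by measurable
  have GF: "(\<lambda>\<omega>. G (V \<omega>)) \<in> borel_measurable ?F" by (rule measurable_compose[OF VF G])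
  show ?thesis unfolding G_def[symmetric]
  proof (rule real_cond_exp_charact[OF _ _ _ GF])
    show "integrable M (indicat_real {\<omega> \<in> space M. (U \<omega>, V \<omega>) \<in> A})"
      by (rule integrable_const_bound[of _ 1]) auto
    show "integrable M (\<lambda>\<omega>. G (V \<omega>))"
      by (rule integrable_const_bound[of _ 1]) (auto simp: G_def)
    fix E assume "E \<in> sets ?F"
    then obtain B where B[measurable]: "B \<in> sets T" and E: "E = V -` B \<inter> space M"
      by (auto simp: sets_vimage_algebra2 measurable_space[of V M T])
    let ?f = "\<lambda>q. indicat_real A q * indicat_real B (snd q)"
    have "prob_space (distr M S U)" "prob_space (distr M T V)" by (auto intro: prob_space_distr)
    then interpret S: prob_space "distr M S U" + T: prob_space "distr M T V" .
    interpret ST: pair_prob_space "distr M S U" "distr M T V" ..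
    have fm: "?f \<in> borel_measurable (S \<Otimes>\<^sub>M T)" by measurable
    then have fm': "?f \<in> borel_measurable (distr M S U \<Otimes>\<^sub>M distr M T V)"
      by (simp cong: measurable_cong_sets add: sets_pair_measure_cong[OF sets_distr sets_distr])
    have "(\<integral>\<omega>\<in>E. indicat_real {\<omega> \<in> space M. (U \<omega>, V \<omega>) \<in> A} \<omega> \<partial>M) = (\<integral>\<omega>. ?f (U \<omega>, V \<omega>) \<partial>M)"
      unfolding set_lebesgue_integral_def E
      by (intro Bochner_Integration.integral_cong) (auto simp: indicator_def)
    also have "\<dots> = (\<integral>q. ?f q \<partial>(distr M S U \<Otimes>\<^sub>M distr M T V))"
      unfolding distr_indep_elements[OF M ind, symmetric] by (subst integral_distr) auto
    also have "\<dots> = (\<integral>v. (\<integral>u. ?f (u, v) \<partial>distr M S U) \<partial>distr M T V)"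
    proof -
      have eq: "case_prod (\<lambda>u v. ?f (u, v)) = ?f" by auto
      have "integrable (distr M S U \<Otimes>\<^sub>M distr M T V) (case_prod (\<lambda>u v. ?f (u, v)))"
        unfolding eq
        by (rule ST.P.integrable_const_bound[OF _ fm', of 1]) (auto simp: indicator_def)
      from ST.integral_snd[OF this] show ?thesis unfolding eq by simp
    qed
    also have "\<dots> = (\<integral>\<omega>. (\<integral>u. ?f (u, V \<omega>) \<partial>distr M S U) \<partial>M)"
      by (subst integral_distr) auto
    also have "\<dots> = (\<integral>\<omega>. (\<integral>\<omega>'. ?f (U \<omega>', V \<omega>) \<partial>M) \<partial>M)"
      by (intro Bochner_Integration.integral_cong refl, subst integral_distr) auto
    also have "\<dots> = (\<integral>\<omega>\<in>E. G (V \<omega>) \<partial>M)"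
      unfolding set_lebesgue_integral_def E
    proof (intro Bochner_Integration.integral_cong refl)
      fix \<omega> assume \<omega>: "\<omega> \<in> space M"
      have "(\<integral>\<omega>'. indicat_real A (U \<omega>', V \<omega>) \<partial>M) = (\<integral>\<omega>'. indicat_real {\<omega>' \<in> space M. (U \<omega>', V \<omega>) \<in> A} \<omega>' \<partial>M)"
        by (intro Bochner_Integration.integral_cong) (auto simp: indicator_def)
      also have "\<dots> = G (V \<omega>)" unfolding G_def by (simp add: Int_def conj_commute cong: conj_cong)
      finally show "(\<integral>\<omega>'. ?f (U \<omega>', V \<omega>) \<partial>M) = indicat_real (V -` B \<inter> space M) \<omega> *\<^sub>R G (V \<omega>)"
        using \<omega> by (auto simp: indicator_def)
    qed
    finally show "(\<integral>\<omega>\<in>E. indicat_real {\<omega> \<in> space M. (U \<omega>, V \<omega>) \<in> A} \<omega> \<partial>M) = (\<integral>\<omega>\<in>E. G (V \<omega>) \<partial>M)" .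
  qed
qed

subsection \<open>The bootstrap statistic with random weights\<close>

lemma (in prob_space) tight_seq_pair_snd:
  assumes P: "prob_space P" and [measurable]: "\<And>n. V n \<in> borel_measurable M" and V: "tight_seq V"
  shows "prob_space.tight_seq (P \<Otimes>\<^sub>M M) (\<lambda>n p. V n (snd p))"
proof -
  have M: "prob_space M" by unfold_locales
  have "{p \<in> space (P \<Otimes>\<^sub>M M). \<bar>V n (snd p)\<bar> > e} = space P \<times> {p \<in> space M. \<bar>V n p\<bar> > e}" for n e
    by (auto simp: space_pair_measure)
  then show ?thesis
    using V unfolding tight_seq_def prob_space.tight_seq_def[OF prob_space_pair[OF P M]]
    by (simp add: measure_pair_snd[OF P M])
qed

text \<open>For fixed weights \<open>clt_bound\<close> applies. Its error is small unless some
  coefficient exceeds \<open>\<delta>\<close> or the sum of squares misses \<open>\<tau>\<close> by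
  more than \<open>\<delta>\<close>; both events are rare. Characteristic functions are bounded by
  1, so convergence in probability passes to the mean over the weights.\<close>

lemma (in ar1_process) clt_random_weights:
  fixes P :: "'p measure" and b :: "nat \<Rightarrow> 'p \<Rightarrow> nat \<Rightarrow> real" and k :: "nat \<Rightarrow> nat"
  assumes P: "prob_space P" and [measurable]: "\<And>n t. (\<lambda>p. b n p t) \<in> borel_measurable P"
    and B: "converges_in_prob P (\<lambda>n p. \<Sum>t<k n. (b n p t)\<^sup>2) \<tau>" and \<tau>: "\<tau> \<ge> 0"
    and small: "\<And>\<delta>. \<delta> > 0 \<Longrightarrow> (\<lambda>n. measure P {p\<in>space P. \<exists>t<k n. \<bar>b n p t\<bar> > \<delta>}) \<longlonglongrightarrow> 0"
  shows "(\<lambda>n. \<integral>p. expectation (char_sum (b n p) (k n)) \<partial>P) \<longlonglongrightarrow> complex_of_real (exp (- (\<sigma>\<^sup>2 * m / 2 * \<tau>)))"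
proof -
  interpret P: prob_space P by fact
  define V where "V n p = expectation (char_sum (b n p) (k n))" for n p
  define c where "c = exp (- (\<sigma>\<^sup>2 * m / 2 * \<tau>))"
  have Vm[measurable]: "V n \<in> borel_measurable P" for n
    unfolding V_def char_sum_def by measurable
  have cm: "\<sigma>\<^sup>2 * m / 2 \<ge> 0" using m_nonneg by simp
  have K: "clt_const \<ge> 0" using m_nonneg \<kappa>_nonneg q_const_nonneg theta2 by (simp add: clt_const_def)
  have "(\<lambda>n. P.expectation (V n)) \<longlonglongrightarrow> complex_of_real c"
  proof (rule P.expectation_lim_of_prob)
    show "cmod (V n p) \<le> 1" for n p
      using norm_expectation_char_sum_mult_le[of "\<lambda>_. 1" "b n p" "k n"] by (simp add: V_def prob_space)
    show "cmod (complex_of_real c) \<le> 1" using cm \<tau> by (simp add: c_def)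
    show "converges_in_prob P (\<lambda>n \<omega>. cmod (V n \<omega> - complex_of_real c)) 0"
    proof (rule P.converges_in_probI)
      fix \<epsilon> \<eta> :: real assume \<epsilon>: "\<epsilon> > 0" and \<eta>: "\<eta> > 0"
      \<comment> \<open>The expression is the total error off the two rare events; it vanishes with
        \<open>\<delta>\<close>, so a suitable \<open>\<delta>\<close> exists. The later choice
        \<open>\<delta> < 1\<close> allows bounding the sum of squares by
        \<open>\<tau> + 1\<close>.\<close>
      have "((\<lambda>\<delta>. clt_const * (\<delta> + \<delta>\<^sup>2) * (\<tau> + 1) + \<sigma>\<^sup>2 * m / 2 * \<delta>) \<longlongrightarrow> clt_const * (0 + 0\<^sup>2) * (\<tau> + 1) + \<sigma>\<^sup>2 * m / 2 * 0) (at_right 0)"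
        by (intro tendsto_intros)
      then have "\<forall>\<^sub>F \<delta> in at_right 0. clt_const * (\<delta> + \<delta>\<^sup>2) * (\<tau> + 1) + \<sigma>\<^sup>2 * m / 2 * \<delta> < \<epsilon>"
        using \<epsilon> by (intro order_tendstoD) auto
      moreover have "\<forall>\<^sub>F \<delta> in at_right 0. (0::real) < \<delta> \<and> \<delta> < 1"
        using eventually_at_right_real[of 0 1] by (auto elim: eventually_mono)
      ultimately have "\<forall>\<^sub>F \<delta> in at_right (0::real). clt_const * (\<delta> + \<delta>\<^sup>2) * (\<tau> + 1) + \<sigma>\<^sup>2 * m / 2 * \<delta> < \<epsilon> \<and> 0 < \<delta> \<and> \<delta> < 1"
        by eventually_elim auto
      then obtain \<delta> where \<delta>: "0 < \<delta>" "\<delta> < 1" "clt_const * (\<delta> + \<delta>\<^sup>2) * (\<tau> + 1) + \<sigma>\<^sup>2 * m / 2 * \<delta> < \<epsilon>"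
        using eventually_happens'[OF trivial_limit_at_right_real] by blast
      have \<eta>2: "\<eta> / 2 > 0" using \<eta> by simp
      let ?A = "\<lambda>n. {p\<in>space P. \<exists>t<k n. \<bar>b n p t\<bar> > \<delta>}"
        and ?B = "\<lambda>n. {p\<in>space P. \<bar>(\<Sum>t<k n. (b n p t)\<^sup>2) - \<tau>\<bar> > \<delta>}"
      have sub: "{p\<in>space P. \<bar>cmod (V n p - complex_of_real c) - 0\<bar> > \<epsilon>} \<subseteq> ?A n \<union> ?B n" for n
      proof (safe, rule ccontr)
        fix p assume *: "p \<in> space P" "\<epsilon> < \<bar>cmod (V n p - complex_of_real c) - 0\<bar>"
          "\<not> \<delta> < \<bar>(\<Sum>t<k n. (b n p t)\<^sup>2) - \<tau>\<bar>" "\<not> (\<exists>t<k n. \<delta> < \<bar>b n p t\<bar>)"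
        let ?S = "\<Sum>t<k n. (b n p t)\<^sup>2"
        have S: "\<bar>?S - \<tau>\<bar> \<le> \<delta>" "?S \<ge> 0" using * by (auto intro: sum_nonneg)
        have "cmod (V n p - complex_of_real (exp (- (\<sigma>\<^sup>2 * m / 2 * ?S)))) \<le> clt_const * (\<delta> + \<delta>\<^sup>2) * ?S"
          unfolding V_def
        proof (rule clt_bound)
          show "\<bar>b n p t\<bar> \<le> \<delta>" if "t < k n" for t using *(4) that by (meson not_less)
        qed (use \<delta> in simp)
        also have "\<dots> \<le> clt_const * (\<delta> + \<delta>\<^sup>2) * (\<tau> + 1)"
          using S \<delta> K by (intro mult_left_mono) auto
        finally have 1: "cmod (V n p - complex_of_real (exp (- (\<sigma>\<^sup>2 * m / 2 * ?S)))) \<le> clt_const * (\<delta> + \<delta>\<^sup>2) * (\<tau> + 1)" .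
        have "cmod (complex_of_real (exp (- (\<sigma>\<^sup>2 * m / 2 * ?S))) - complex_of_real c)
            = \<bar>exp (- (\<sigma>\<^sup>2 * m / 2 * ?S)) - exp (- (\<sigma>\<^sup>2 * m / 2 * \<tau>))\<bar>"
          unfolding c_def of_real_diff[symmetric] norm_of_real ..
        also have "\<dots> \<le> \<bar>\<sigma>\<^sup>2 * m / 2 * ?S - \<sigma>\<^sup>2 * m / 2 * \<tau>\<bar>"
          using S cm \<tau> by (intro exp_minus_lipschitz mult_nonneg_nonneg) auto
        also have "\<dots> = \<sigma>\<^sup>2 * m / 2 * \<bar>?S - \<tau>\<bar>"
          unfolding right_diff_distrib[symmetric] abs_mult using cm by simp
        also have "\<dots> \<le> \<sigma>\<^sup>2 * m / 2 * \<delta>" using S cm by (intro mult_left_mono) auto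
        finally have 2: "cmod (complex_of_real (exp (- (\<sigma>\<^sup>2 * m / 2 * ?S))) - complex_of_real c) \<le> \<sigma>\<^sup>2 * m / 2 * \<delta>" .
        have "cmod (V n p - complex_of_real c) \<le> cmod (V n p - complex_of_real (exp (- (\<sigma>\<^sup>2 * m / 2 * ?S))))
            + cmod (complex_of_real (exp (- (\<sigma>\<^sup>2 * m / 2 * ?S))) - complex_of_real c)"
          using norm_triangle_ineq[of "V n p - complex_of_real (exp (- (\<sigma>\<^sup>2 * m / 2 * ?S)))"
            "complex_of_real (exp (- (\<sigma>\<^sup>2 * m / 2 * ?S))) - complex_of_real c"] by simp
        with 1 2 \<delta>(3) *(2) show False by simp
      qed
      have "\<forall>\<^sub>F n in sequentially. P.prob (?A n) < \<eta> / 2"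
        using small[OF \<delta>(1)] \<eta>2 by (rule order_tendstoD)
      with P.converges_in_probD[OF B \<delta>(1) \<eta>2]
      show "\<forall>\<^sub>F n in sequentially. P.prob {p\<in>space P. \<bar>cmod (V n p - complex_of_real c) - 0\<bar> > \<epsilon>} < \<eta>"
      proof eventually_elim
        case (elim n)
        have "P.prob {p\<in>space P. \<bar>cmod (V n p - complex_of_real c) - 0\<bar> > \<epsilon>} < \<eta> / 2 + \<eta> / 2"
          using elim by (intro P.prob_union_less[OF sub]) auto
        then show ?case by simp
      qed
    qed
  qed measurable
  then show ?thesis by (simp only: V_def[abs_def] c_def)
qed

lemma sum_diagonal_plus_const:
  fixes a b :: real
  shows "(\<Sum>s<N. \<Sum>t<N. (if s = t then a else 0) + b) = real N * a + (real N)\<^sup>2 * b"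
  by (simp add: sum.distrib power2_eq_square algebra_simps)

text \<open>Weights live on \<open>P\<close> and data on \<open>M\<close>, so their independence is
  the product structure. \<open>\<rho> n\<close> is the common covariance of two standardized
  weights in row \<open>n\<close>; multiplied by \<open>(sd n)^2\<close> it becomes that of the raw
  weights. \<open>W_max\<close> is the form in which uniform integrability of the squared weights
  enters.\<close>

locale ar1_bootstrap = ar1_process M F x z \<theta> \<sigma> m \<kappa> + P: prob_space P
  for M :: "'a measure" and F x z \<theta> \<sigma> m \<kappa> and P :: "'p measure" +
  fixes W :: "nat \<Rightarrow> nat \<Rightarrow> 'p \<Rightarrow> real" and sd \<rho> :: "nat \<Rightarrow> real"
  assumes sigma_pos: "\<sigma> > 0"
    and W_measurable [measurable]: "\<And>n t. W n t \<in> borel_measurable P"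
    and W_square: "\<And>n t. integrable P (\<lambda>p. (W n t p)\<^sup>2)"
    and W_variance: "\<And>n t. t \<in> {1..n} \<Longrightarrow> P.expectation (\<lambda>p. (W n t p)\<^sup>2) = 1"
    and W_cov: "\<And>n s t. s \<in> {1..n} \<Longrightarrow> t \<in> {1..n} \<Longrightarrow> s \<noteq> t \<Longrightarrow> P.expectation (\<lambda>p. W n s p * W n t p) = \<rho> n"
    and W_mean_square: "converges_in_prob P (\<lambda>n p. 1 / real n * (\<Sum>j=1..n. (W n j p)\<^sup>2)) 1"
    and W_max: "\<And>\<delta>. \<delta> > 0 \<Longrightarrow> (\<lambda>n. P.prob {p\<in>space P. \<exists>t\<in>{1..n}. \<bar>W n t p\<bar> > \<delta> * sqrt n}) \<longlonglongrightarrow> 0"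
    and sd_pos: "\<And>n. n \<ge> 1 \<Longrightarrow> sd n > 0"
    and sd_lim: "(\<lambda>n. (sd n)\<^sup>2 / n) \<longlonglongrightarrow> 0"
    and \<rho>_lim: "\<rho> \<longlonglongrightarrow> 0"
    and cov_lim: "(\<lambda>n. (sd n)\<^sup>2 * \<rho> n) \<longlonglongrightarrow> 0"
begin

sublocale PM: pair_prob_space P M ..
sublocale PP: pair_prob_space P P ..

lemma prob_spaces: "prob_space P" "prob_space M"
  by unfold_locales

lemma m_pos: "m > 0"
proof -
  have "(1 - \<theta>\<^sup>2) * m = \<sigma>\<^sup>2" using m by (simp add: algebra_simps)
  then have "(1 - \<theta>\<^sup>2) * m > 0" using sigma_pos by simp
  then show ?thesis using theta2 by (simp add: zero_less_mult_iff)
qed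

lemma W_prod_abs:
  assumes "s \<in> {1..n}" "t \<in> {1..n}"
  shows "\<bar>P.expectation (\<lambda>p. W n s p * W n t p)\<bar> \<le> (if s = t then 1 else 0) + \<bar>\<rho> n\<bar>"
  using assms W_variance[of s n] W_cov[of s n t] by (auto simp: power2_eq_square)

text \<open>The standard deviation of one summand \<open>x s * z s\<close>; it normalizes
  \<open>T\<close> to unit limiting variance.\<close>

definition c0 :: real where "c0 = \<sigma> * sqrt m"

lemma c0_pos: "c0 > 0" using sigma_pos m_pos by (simp add: c0_def)

lemma c0_square: "c0\<^sup>2 = \<sigma>\<^sup>2 * m" using m_pos by (simp add: c0_def power_mult_distrib)

text \<open>Below, \<open>x s\<close> plays the role of \<open>X\<^sub>s\<^sub>+\<^sub>1\<close>, so the summand \<open>X\<^sub>t\<^sub>-\<^sub>1 Z\<^sub>t\<close> is \<open>x s * z s\<close> with \<open>t = s + 2\<close>.\<close>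

definition T :: "nat \<Rightarrow> 'p \<Rightarrow> 'a \<Rightarrow> real" where
  "T n p \<omega> = (\<Sum>s<n-1. W n (s + 2) p * (x s \<omega> * z s \<omega>)) / (sqrt n * c0)"

definition B :: "nat \<Rightarrow> 'p \<Rightarrow> 'a \<Rightarrow> real" where
  "B n p \<omega> = (\<Sum>s<n-1. W n (s + 2) p * (x s \<omega>)\<^sup>2) / n"

definition L :: "nat \<Rightarrow> 'a \<Rightarrow> real" where
  "L n \<omega> = (\<Sum>s<n-1. x s \<omega> * z s \<omega>) / sqrt n"

definition Q :: "nat \<Rightarrow> 'a \<Rightarrow> real" where
  "Q n \<omega> = (\<Sum>s<n-1. (x s \<omega>)\<^sup>2) / n"

text \<open>Since a raw weight is \<open>1 + sd n * W\<close>, this is the denominator of the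
  weighted estimator divided by \<open>n\<close>.\<close>

definition D :: "nat \<Rightarrow> 'p \<Rightarrow> 'a \<Rightarrow> real" where
  "D n p \<omega> = Q n \<omega> + sd n * B n p \<omega>"

lemma T_measurable [measurable]: "(\<lambda>q. T n (fst q) (snd q)) \<in> borel_measurable (P \<Otimes>\<^sub>M M)"
  and B_measurable [measurable]: "(\<lambda>q. B n (fst q) (snd q)) \<in> borel_measurable (P \<Otimes>\<^sub>M M)"
  and L_measurable [measurable]: "L n \<in> borel_measurable M"
  and Q_measurable [measurable]: "Q n \<in> borel_measurable M"
  unfolding T_def B_def L_def Q_def by measurable

lemma D_measurable [measurable]: "(\<lambda>q. D n (fst q) (snd q)) \<in> borel_measurable (P \<Otimes>\<^sub>M M)"
  unfolding D_def by measurable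

lemma Q_conv: "converges_in_prob M Q m"
proof -
  obtain K where K: "K \<ge> 0" "\<And>n. integrable M (\<lambda>\<omega>. (\<Sum>t<n. (x t \<omega>)\<^sup>2 - m)\<^sup>2)"
    "\<And>n. expectation (\<lambda>\<omega>. (\<Sum>t<n. (x t \<omega>)\<^sup>2 - m)\<^sup>2) \<le> K * (real n + 1)"
    using expectation_sum_squares_bound by blast
  define V where "V n \<omega> = (\<Sum>s<n-1. (x s \<omega>)\<^sup>2 - m) / n" for n \<omega>
  have [measurable]: "V n \<in> borel_measurable M" for n unfolding V_def by measurable
  have V: "converges_in_prob M V 0"
  proof (rule converges_in_prob_L2)
    show "integrable M (\<lambda>\<omega>. (V n \<omega>)\<^sup>2)" for n using K(2)[of "n-1"] by (simp add: V_def power_divide)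
    show "expectation (\<lambda>\<omega>. (V n \<omega>)\<^sup>2) \<le> K / n" if "n \<ge> 1" for n
    proof -
      have "expectation (\<lambda>\<omega>. (V n \<omega>)\<^sup>2) = expectation (\<lambda>\<omega>. (\<Sum>t<n-1. (x t \<omega>)\<^sup>2 - m)\<^sup>2) / n\<^sup>2"
        by (simp add: V_def power_divide)
      also have "\<dots> \<le> (K * (real (n - 1) + 1)) / n\<^sup>2" by (intro divide_right_mono K(3)) simp
      also have "\<dots> = K / n" using that by (simp add: of_nat_diff power2_eq_square)
      finally show ?thesis .
    qed
    show "(\<lambda>n. K / real n) \<longlonglongrightarrow> 0" by (rule lim_const_over_n)
  qed
  \<comment> \<open>\<open>Q n\<close> sums \<open>n - 1\<close> squares but divides by
    \<open>n\<close>, which gives it the mean \<open>m * (1 - 1 / n)\<close>.\<close>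
  have "(\<lambda>n. m * (1 - 1 / real n)) \<longlonglongrightarrow> m * (1 - 0)"
    by (intro tendsto_intros lim_1_over_n)
  then have "converges_in_prob M (\<lambda>n \<omega>. m * (1 - 1 / real n)) m"
    using converges_in_prob_const_seq by simp
  from converges_in_prob_add[OF _ _ V this]
  have "converges_in_prob M (\<lambda>n \<omega>. V n \<omega> + m * (1 - 1 / real n)) m" by simp
  then show ?thesis
  proof (rule converges_in_prob_cong[rotated])
    have eq: "Q n \<omega> = V n \<omega> + m * (1 - 1 / real n)" if "n \<ge> 1" for n \<omega>
      using that by (simp add: Q_def V_def sum_subtractf field_simps of_nat_diff)
    show "\<forall>\<^sub>F n in sequentially. AE \<omega> in M. Q n \<omega> = V n \<omega> + m * (1 - 1 / real n)"
      using eventually_ge_at_top[of 1] by eventually_elim (intro AE_I2 eq)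
  qed measurable
qed

text \<open>Orthogonality of the summands keeps the second moment bounded. Tightness is enough
  because \<open>L\<close> enters the statistic only multiplied by the vanishing
  \<open>B\<close>.\<close>

lemma L_tight: "tight_seq L"
proof (rule tight_seq_L2)
  show "integrable M (\<lambda>\<omega>. (L n \<omega>)\<^sup>2)" for n
    unfolding L_def power_divide by (intro integrable_divide integrable_sum_square) auto
  show "expectation (\<lambda>\<omega>. (L n \<omega>)\<^sup>2) \<le> m * \<sigma>\<^sup>2" for n
  proof -
    have orth: "expectation (\<lambda>\<omega>. (x s \<omega> * z s \<omega>) * (x t \<omega> * z t \<omega>)) = (if s = t then m * \<sigma>\<^sup>2 else 0)" for s t
      using xz_orthogonal[of s t] expectation_xz2[of t] by (auto simp: power2_eq_square)
    have "expectation (\<lambda>\<omega>. (L n \<omega>)\<^sup>2) = expectation (\<lambda>\<omega>. (\<Sum>s<n-1. x s \<omega> * z s \<omega>)\<^sup>2) / n"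
      by (simp add: L_def power_divide)
    also have "expectation (\<lambda>\<omega>. (\<Sum>s<n-1. x s \<omega> * z s \<omega>)\<^sup>2) = (n - 1) * (m * \<sigma>\<^sup>2)"
      by (subst integral_sum_square) (auto simp: orth)
    also have "(n - 1) * (m * \<sigma>\<^sup>2) / n \<le> m * \<sigma>\<^sup>2"
    proof (cases "n = 0")
      case False
      have "real (n - 1) * (m * \<sigma>\<^sup>2) \<le> n * (m * \<sigma>\<^sup>2)"
        using m_pos by (intro mult_right_mono) auto
      then show ?thesis using False by (simp add: field_simps)
    qed (use m_pos in simp)
    finally show ?thesis .
  qed
qed

text \<open>Orthogonality of the data summands kills all off-diagonal terms, so correlations among
  the weights cancel here. The bound 1 also feeds the moment condition on the conditional
  laws.\<close>

lemma
  shows integrable_T2: "integrable (P \<Otimes>\<^sub>M M) (\<lambda>q. (T n (fst q) (snd q))\<^sup>2)"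
    and expectation_T2: "PM.expectation (\<lambda>q. (T n (fst q) (snd q))\<^sup>2) \<le> 1"
proof -
  note sm = pair_second_moment[OF prob_spaces, of "{..<n-1}" "\<lambda>s. W n (s + 2)" "\<lambda>s \<omega>. x s \<omega> * z s \<omega>"]
  have i: "integrable (P \<Otimes>\<^sub>M M) (\<lambda>q. (\<Sum>s<n-1. W n (s + 2) (fst q) * (x s (snd q) * z s (snd q)))\<^sup>2)"
    by (rule sm(1)) (auto simp: W_square)
  then show "integrable (P \<Otimes>\<^sub>M M) (\<lambda>q. (T n (fst q) (snd q))\<^sup>2)"
    unfolding T_def power_divide by (rule integrable_divide)
  have "PM.expectation (\<lambda>q. (\<Sum>s<n-1. W n (s + 2) (fst q) * (x s (snd q) * z s (snd q)))\<^sup>2)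
      = (\<Sum>s<n-1. \<Sum>t<n-1. P.expectation (\<lambda>p. W n (s + 2) p * W n (t + 2) p)
          * expectation (\<lambda>\<omega>. (x s \<omega> * z s \<omega>) * (x t \<omega> * z t \<omega>)))"
    by (rule sm(2)) (auto simp: W_square)
  also have "\<dots> = (\<Sum>s<n-1. \<Sum>t<n-1. if s = t then c0\<^sup>2 else 0)"
  proof (intro sum.cong refl)
    fix s t assume st: "s \<in> {..<n-1}" "t \<in> {..<n-1}"
    show "P.expectation (\<lambda>p. W n (s + 2) p * W n (t + 2) p) * expectation (\<lambda>\<omega>. (x s \<omega> * z s \<omega>) * (x t \<omega> * z t \<omega>))
        = (if s = t then c0\<^sup>2 else 0)"
    proof (cases "s = t")
      case True
      have "P.expectation (\<lambda>p. W n (t + 2) p * W n (t + 2) p) = 1"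
        using W_variance[of "t + 2" n] st by (simp add: power2_eq_square)
      moreover have "expectation (\<lambda>\<omega>. (x t \<omega> * z t \<omega>) * (x t \<omega> * z t \<omega>)) = c0\<^sup>2"
        using expectation_xz2[of t] unfolding c0_square by (simp add: power2_eq_square mult_ac)
      ultimately show ?thesis using True by simp
    qed (use xz_orthogonal in simp)
  qed
  also have "\<dots> = real (n - 1) * c0\<^sup>2" by simp
  finally have "PM.expectation (\<lambda>q. (T n (fst q) (snd q))\<^sup>2) = real (n - 1) * c0\<^sup>2 / (n * c0\<^sup>2)"
    unfolding T_def by (simp add: power_divide power_mult_distrib)
  also have "\<dots> \<le> 1" using c0_pos by (simp add: divide_le_eq)
  finally show "PM.expectation (\<lambda>q. (T n (fst q) (snd q))\<^sup>2) \<le> 1" .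
qed

lemma T_tight: "PM.P.tight_seq (\<lambda>n q. T n (fst q) (snd q))"
  by (rule PM.P.tight_seq_L2[OF integrable_T2 expectation_T2])

text \<open>The squares \<open>(x s)^2\<close> are not centred, so the off-diagonal covariances of
  the weights remain: the diagonal gives \<open>1 / n\<close>, the other pairs give
  \<open>\<bar>\<rho> n\<bar>\<close>, and \<open>\<kappa>\<close> bounds all mixed moments of the
  data.\<close>

lemma
  shows integrable_B2: "integrable (P \<Otimes>\<^sub>M M) (\<lambda>q. (B n (fst q) (snd q))\<^sup>2)"
    and expectation_B2: "n \<ge> 1 \<Longrightarrow> PM.expectation (\<lambda>q. (B n (fst q) (snd q))\<^sup>2) \<le> \<kappa> * (1 / n + \<bar>\<rho> n\<bar>)"
proof -
  note sm = pair_second_moment[OF prob_spaces, of "{..<n-1}" "\<lambda>s. W n (s + 2)" "\<lambda>s \<omega>. (x s \<omega>)\<^sup>2"]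
  have x4': "integrable M (\<lambda>\<omega>. ((x s \<omega>)\<^sup>2)\<^sup>2)" for s using x4(1)[of s] by (simp flip: power_mult)
  have i: "integrable (P \<Otimes>\<^sub>M M) (\<lambda>q. (\<Sum>s<n-1. W n (s + 2) (fst q) * (x s (snd q))\<^sup>2)\<^sup>2)"
    by (rule sm(1)) (auto simp: W_square x4')
  then show "integrable (P \<Otimes>\<^sub>M M) (\<lambda>q. (B n (fst q) (snd q))\<^sup>2)"
    unfolding B_def power_divide by (rule integrable_divide)
  assume n: "n \<ge> 1"
  have xx: "\<bar>expectation (\<lambda>\<omega>. (x s \<omega>)\<^sup>2 * (x t \<omega>)\<^sup>2)\<bar> \<le> \<kappa>" for s t
  proof -
    have ixx: "integrable M (\<lambda>\<omega>. (x s \<omega>)\<^sup>2 * (x t \<omega>)\<^sup>2)"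
      by (rule integrable_mult_of_squares) (auto simp: x4')
    have "expectation (\<lambda>\<omega>. (x s \<omega>)\<^sup>2 * (x t \<omega>)\<^sup>2) \<le> expectation (\<lambda>\<omega>. (x s \<omega> ^ 4 + x t \<omega> ^ 4) / 2)"
    proof (rule integral_mono[OF ixx])
      show "(x s \<omega>)\<^sup>2 * (x t \<omega>)\<^sup>2 \<le> (x s \<omega> ^ 4 + x t \<omega> ^ 4) / 2" for \<omega>
        using sum_squares_bound[of "(x s \<omega>)\<^sup>2" "(x t \<omega>)\<^sup>2"] by (simp flip: power_mult)
    qed simp
    also have "\<dots> \<le> \<kappa>" using x4(2)[of s] x4(2)[of t] by simp
    finally show ?thesis by (simp add: abs_of_nonneg integral_nonneg)
  qed
  have "PM.expectation (\<lambda>q. (\<Sum>s<n-1. W n (s + 2) (fst q) * (x s (snd q))\<^sup>2)\<^sup>2)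
      = (\<Sum>s<n-1. \<Sum>t<n-1. P.expectation (\<lambda>p. W n (s + 2) p * W n (t + 2) p)
          * expectation (\<lambda>\<omega>. (x s \<omega>)\<^sup>2 * (x t \<omega>)\<^sup>2))"
    by (rule sm(2)) (auto simp: W_square x4')
  also have "\<dots> \<le> (\<Sum>s<n-1. \<Sum>t<n-1. (if s = t then \<kappa> else 0) + \<bar>\<rho> n\<bar> * \<kappa>)"
  proof (intro sum_mono)
    fix s t assume st: "s \<in> {..<n-1}" "t \<in> {..<n-1}"
    have "P.expectation (\<lambda>p. W n (s + 2) p * W n (t + 2) p) * expectation (\<lambda>\<omega>. (x s \<omega>)\<^sup>2 * (x t \<omega>)\<^sup>2)
        \<le> \<bar>P.expectation (\<lambda>p. W n (s + 2) p * W n (t + 2) p)\<bar> * \<bar>expectation (\<lambda>\<omega>. (x s \<omega>)\<^sup>2 * (x t \<omega>)\<^sup>2)\<bar>"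
      unfolding abs_mult[symmetric] by (rule abs_ge_self)
    also have "\<dots> \<le> ((if s = t then 1 else 0) + \<bar>\<rho> n\<bar>) * \<kappa>"
      using W_prod_abs[of "s + 2" n "t + 2"] st xx by (intro mult_mono) auto
    also have "\<dots> = (if s = t then \<kappa> else 0) + \<bar>\<rho> n\<bar> * \<kappa>" by (simp add: distrib_right)
    finally show "P.expectation (\<lambda>p. W n (s + 2) p * W n (t + 2) p) * expectation (\<lambda>\<omega>. (x s \<omega>)\<^sup>2 * (x t \<omega>)\<^sup>2)
        \<le> (if s = t then \<kappa> else 0) + \<bar>\<rho> n\<bar> * \<kappa>" .
  qed
  also have "\<dots> = (real (n - 1) + (real (n - 1))\<^sup>2 * \<bar>\<rho> n\<bar>) * \<kappa>"
    unfolding sum_diagonal_plus_const by (simp only: distrib_right mult.assoc)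
  also have "\<dots> \<le> (n + (real n)\<^sup>2 * \<bar>\<rho> n\<bar>) * \<kappa>"
    using \<kappa>_nonneg by (intro mult_right_mono add_mono power_mono) auto
  finally have "PM.expectation (\<lambda>q. (\<Sum>s<n-1. W n (s + 2) (fst q) * (x s (snd q))\<^sup>2)\<^sup>2) / n\<^sup>2
      \<le> (n + (real n)\<^sup>2 * \<bar>\<rho> n\<bar>) * \<kappa> / n\<^sup>2" by (intro divide_right_mono) auto
  also have "\<dots> = \<kappa> * (1 / n + \<bar>\<rho> n\<bar>)" using n by (simp add: field_simps power2_eq_square)
  finally show "PM.expectation (\<lambda>q. (B n (fst q) (snd q))\<^sup>2) \<le> \<kappa> * (1 / n + \<bar>\<rho> n\<bar>)"
    unfolding B_def by (simp add: power_divide)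
qed

lemma B_conv: "converges_in_prob (P \<Otimes>\<^sub>M M) (\<lambda>n q. B n (fst q) (snd q)) 0"
proof (rule PM.P.converges_in_prob_L2[OF integrable_B2 expectation_B2])
  have "(\<lambda>n. \<kappa> * (1 / real n + \<bar>\<rho> n\<bar>)) \<longlonglongrightarrow> \<kappa> * (0 + \<bar>0\<bar>)"
    by (intro tendsto_intros \<rho>_lim lim_1_over_n)
  then show "(\<lambda>n. \<kappa> * (1 / real n + \<bar>\<rho> n\<bar>)) \<longlonglongrightarrow> 0" by simp
qed

text \<open>\<open>sd n\<close> may grow, so convergence of \<open>B\<close> alone does not suffice:
  the factor \<open>(sd n)^2\<close> turns its bound into \<open>(sd n)^2 / n\<close> plus the
  absolute covariance of the raw weights.\<close>

lemma sd_B_conv: "converges_in_prob (P \<Otimes>\<^sub>M M) (\<lambda>n q. sd n * B n (fst q) (snd q)) 0"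
proof (rule PM.P.converges_in_prob_L2)
  show "integrable (P \<Otimes>\<^sub>M M) (\<lambda>q. (sd n * B n (fst q) (snd q))\<^sup>2)" for n
    using integrable_B2[of n] by (simp add: power_mult_distrib)
  have "(\<lambda>n. \<kappa> * ((sd n)\<^sup>2 / n + \<bar>(sd n)\<^sup>2 * \<rho> n\<bar>)) \<longlonglongrightarrow> \<kappa> * (0 + \<bar>0\<bar>)"
    by (intro tendsto_intros sd_lim cov_lim)
  then show "(\<lambda>n. \<kappa> * ((sd n)\<^sup>2 / n + \<bar>(sd n)\<^sup>2 * \<rho> n\<bar>)) \<longlonglongrightarrow> 0" by simp
  fix n :: nat assume "n \<ge> 1"
  have "PM.expectation (\<lambda>q. (sd n * B n (fst q) (snd q))\<^sup>2) = (sd n)\<^sup>2 * PM.expectation (\<lambda>q. (B n (fst q) (snd q))\<^sup>2)"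
    by (simp add: power_mult_distrib)
  also have "\<dots> \<le> (sd n)\<^sup>2 * (\<kappa> * (1 / n + \<bar>\<rho> n\<bar>))"
    using expectation_B2[OF \<open>n \<ge> 1\<close>] by (rule mult_left_mono) simp
  also have "\<dots> = \<kappa> * ((sd n)\<^sup>2 / n + \<bar>(sd n)\<^sup>2 * \<rho> n\<bar>)"
    by (simp add: abs_mult algebra_simps)
  finally show "PM.expectation (\<lambda>q. (sd n * B n (fst q) (snd q))\<^sup>2) \<le> \<kappa> * ((sd n)\<^sup>2 / n + \<bar>(sd n)\<^sup>2 * \<rho> n\<bar>)" .
qed

lemma D_conv: "converges_in_prob (P \<Otimes>\<^sub>M M) (\<lambda>n q. D n (fst q) (snd q)) m"
  using PM.P.converges_in_prob_add[OF _ _ converges_in_prob_pair_snd[OF prob_spaces _ Q_conv] sd_B_conv]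
  unfolding D_def by simp

section \<open>Empirical moments of the weights and their replicas\<close>

definition W_bar :: "nat \<Rightarrow> 'p \<Rightarrow> real" where
  "W_bar n p = (\<Sum>s<n-1. (W n (s + 2) p)\<^sup>2) / n"

lemma W_bar_measurable [measurable]: "W_bar n \<in> borel_measurable P"
  unfolding W_bar_def by measurable

lemma W_bar_conv: "converges_in_prob P W_bar 1"
proof -
  \<comment> \<open>The regression sums start at index 2, whereas the assumed mean square includes
    index 1; \<open>V\<close> removes that first term, whose mean is \<open>1 / n\<close>.\<close>
  define V where "V n p = (if n = 0 then 0 else - ((W n 1 p)\<^sup>2 / n))" for n p
  have [measurable]: "V n \<in> borel_measurable P" for n unfolding V_def by measurable
  have V: "converges_in_prob P V 0"
  proof (rule P.converges_in_prob_L1)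
    show "integrable P (V n)" for n using W_square[of n 1] by (cases "n = 0") (simp_all add: V_def[abs_def])
    have "P.expectation (\<lambda>p. \<bar>V n p\<bar>) = (if n = 0 then 0 else 1 / n)" for n
      using W_variance[of 1 n] by (auto simp: V_def)
    moreover have "(\<lambda>n. if n = 0 then 0 else 1 / real n) \<longlonglongrightarrow> 0"
      using lim_1_over_n by (rule Lim_transform_eventually) (auto simp: eventually_sequentially intro: exI[of _ 1])
    ultimately show "(\<lambda>n. P.expectation (\<lambda>p. \<bar>V n p\<bar>)) \<longlonglongrightarrow> 0" by simp
  qed
  from P.converges_in_prob_add[OF _ _ W_mean_square V]
  have "converges_in_prob P (\<lambda>n p. 1 / real n * (\<Sum>j=1..n. (W n j p)\<^sup>2) + V n p) 1" by simp
  then show ?thesis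
  proof (rule P.converges_in_prob_cong[rotated])
    have eq: "W_bar n p = 1 / real n * (\<Sum>j=1..n. (W n j p)\<^sup>2) + V n p" if n: "n \<ge> 1" for n p
    proof -
      have "(\<Sum>j=1..n. (W n j p)\<^sup>2) = (W n 1 p)\<^sup>2 + (\<Sum>j=2..n. (W n j p)\<^sup>2)"
        using n by (simp add: sum.atLeast_Suc_atMost numeral_2_eq_2)
      also have "(\<Sum>j=2..n. (W n j p)\<^sup>2) = (\<Sum>s<n-1. (W n (s + 2) p)\<^sup>2)"
        by (rule sum.reindex_bij_witness[of _ "\<lambda>s. s + 2" "\<lambda>j. j - 2"]) (auto simp: le_add_diff_inverse2 simp del: add_2_eq_Suc')
      finally show ?thesis using n by (simp add: W_bar_def V_def field_simps)
    qed
    show "\<forall>\<^sub>F n in sequentially. AE p in P. W_bar n p = 1 / real n * (\<Sum>j=1..n. (W n j p)\<^sup>2) + V n p"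
      using eventually_ge_at_top[of 1] by eventually_elim (intro AE_I2 eq)
  qed measurable
qed

definition W_cross :: "nat \<Rightarrow> 'p \<times> 'p \<Rightarrow> real" where
  "W_cross n pp = (\<Sum>s<n-1. W n (s + 2) (fst pp) * W n (s + 2) (snd pp)) / n"

lemma W_cross_measurable [measurable]: "W_cross n \<in> borel_measurable (P \<Otimes>\<^sub>M P)"
  unfolding W_cross_def by measurable

text \<open>The replicas are independent with the same covariances, so the second moment is a sum of
  squared covariances: about \<open>n\<close> from the diagonal and
  \<open>n^2 * (\<rho> n)^2\<close> from the rest, divided by \<open>n^2\<close>.\<close>

lemma W_cross_conv: "converges_in_prob (P \<Otimes>\<^sub>M P) W_cross 0"
proof (rule PP.P.converges_in_prob_L2)
  note sm = pair_second_moment[OF prob_spaces(1) prob_spaces(1), of "{..<n-1}" "\<lambda>s. W n (s + 2)" "\<lambda>s. W n (s + 2)" for n]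
  have "integrable (P \<Otimes>\<^sub>M P) (\<lambda>q. (\<Sum>s<n-1. W n (s + 2) (fst q) * W n (s + 2) (snd q))\<^sup>2)" for n
    by (rule sm(1)) (auto simp: W_square)
  then show "integrable (P \<Otimes>\<^sub>M P) (\<lambda>q. (W_cross n q)\<^sup>2)" for n
    unfolding W_cross_def power_divide by (rule integrable_divide)
  show "PP.expectation (\<lambda>q. (W_cross n q)\<^sup>2) \<le> 1 / n + (1 / n + \<bar>\<rho> n\<bar>) * \<bar>\<rho> n\<bar> + \<bar>\<rho> n\<bar> / n" if n: "n \<ge> 1" for n
  proof -
    let ?r = "\<bar>\<rho> n\<bar>"
    have "PP.expectation (\<lambda>q. (\<Sum>s<n-1. W n (s + 2) (fst q) * W n (s + 2) (snd q))\<^sup>2)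
        = (\<Sum>s<n-1. \<Sum>t<n-1. P.expectation (\<lambda>p. W n (s + 2) p * W n (t + 2) p)
            * P.expectation (\<lambda>p. W n (s + 2) p * W n (t + 2) p))"
      by (rule sm(2)) (auto simp: W_square)
    also have "\<dots> \<le> (\<Sum>s<n-1. \<Sum>t<n-1. (if s = t then 1 + 2 * ?r else 0) + ?r\<^sup>2)"
    proof (intro sum_mono)
      fix s t assume st: "s \<in> {..<n-1}" "t \<in> {..<n-1}"
      let ?e = "P.expectation (\<lambda>p. W n (s + 2) p * W n (t + 2) p)"
      have "?e * ?e = \<bar>?e\<bar> * \<bar>?e\<bar>" by simp
      also have "\<dots> \<le> ((if s = t then 1 else 0) + ?r) * ((if s = t then 1 else 0) + ?r)"
        using W_prod_abs[of "s + 2" n "t + 2"] st by (intro mult_mono) auto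
      also have "\<dots> = (if s = t then 1 + 2 * ?r else 0) + ?r\<^sup>2" by (simp add: power2_eq_square algebra_simps)
      finally show "?e * ?e \<le> (if s = t then 1 + 2 * ?r else 0) + ?r\<^sup>2" .
    qed
    also have "\<dots> = real (n - 1) * (1 + 2 * ?r) + (real (n - 1))\<^sup>2 * ?r\<^sup>2"
      by (rule sum_diagonal_plus_const)
    also have "\<dots> \<le> n * (1 + 2 * ?r) + (real n)\<^sup>2 * ?r\<^sup>2"
      by (intro add_mono mult_right_mono power_mono) auto
    finally have "PP.expectation (\<lambda>q. (\<Sum>s<n-1. W n (s + 2) (fst q) * W n (s + 2) (snd q))\<^sup>2) / n\<^sup>2
        \<le> (n * (1 + 2 * ?r) + (real n)\<^sup>2 * ?r\<^sup>2) / n\<^sup>2" by (intro divide_right_mono) auto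
    also have "\<dots> = 1 / n + (1 / n + ?r) * ?r + ?r / n"
      using n by (simp add: field_simps power2_eq_square)
    finally show ?thesis unfolding W_cross_def by (simp add: power_divide)
  qed
  have "(\<lambda>n. 1 / real n + (1 / real n + \<bar>\<rho> n\<bar>) * \<bar>\<rho> n\<bar> + \<bar>\<rho> n\<bar> * (1 / real n)) \<longlonglongrightarrow> 0 + (0 + \<bar>0\<bar>) * \<bar>0\<bar> + \<bar>0\<bar> * 0"
    by (intro tendsto_intros \<rho>_lim lim_1_over_n)
  then show "(\<lambda>n. 1 / real n + (1 / real n + \<bar>\<rho> n\<bar>) * \<bar>\<rho> n\<bar> + \<bar>\<rho> n\<bar> / real n) \<longlonglongrightarrow> 0" by simp
qed

section \<open>The limit theorem for one and for two replicas\<close>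

lemma iexp_T: "iexp (u * T n p \<omega>) = char_sum (\<lambda>s. u / (sqrt n * c0) * W n (s + 2) p) (n - 1) \<omega>"
  unfolding T_def char_sum_def by (simp add: sum_distrib_left sum_divide_distrib mult_ac)

lemma iexp_T_diff: "iexp (u * T n p \<omega> - u * T n p' \<omega>)
  = char_sum (\<lambda>s. u / (sqrt n * c0) * (W n (s + 2) p - W n (s + 2) p')) (n - 1) \<omega>"
proof -
  have "u * T n p \<omega> - u * T n p' \<omega>
      = (\<Sum>s<n-1. u / (sqrt n * c0) * (W n (s + 2) p - W n (s + 2) p') * (x s \<omega> * z s \<omega>))"
    unfolding T_def by (simp add: sum_distrib_left sum_divide_distrib sum_subtractf[symmetric] algebra_simps diff_divide_distrib)
  then show ?thesis unfolding char_sum_def by simp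
qed

text \<open>The denominator \<open>\<bar>u\<bar> + 1\<close> makes the threshold meaningful at
  \<open>u = 0\<close>. For \<open>n = 0\<close> the coefficient is 0 by division by zero, against
  the premise.\<close>

lemma coeff_large:
  fixes n :: nat
  assumes "\<delta> > 0" "\<bar>u / (sqrt n * c0) * v\<bar> > \<delta>"
  shows "\<bar>v\<bar> > \<delta> * c0 / (\<bar>u\<bar> + 1) * sqrt n"
proof -
  have n: "n > 0" using assms by (cases n) auto
  have "\<delta> < \<bar>u\<bar> * \<bar>v\<bar> / (sqrt n * c0)"
    using assms(2) c0_pos n by (simp add: abs_mult)
  then have "\<delta> * (sqrt n * c0) < \<bar>u\<bar> * \<bar>v\<bar>" using n c0_pos by (simp add: pos_less_divide_eq)
  also have "\<dots> \<le> (\<bar>u\<bar> + 1) * \<bar>v\<bar>" by (intro mult_right_mono) auto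
  finally show ?thesis by (simp add: field_simps)
qed

text \<open>Serves both replica statements: \<open>S\<close> is the weight space with
  \<open>\<tau> = 1\<close>, or its square with \<open>\<tau> = 2\<close>. The factor
  \<open>\<sigma>^2 * m\<close> of the limit theorem cancels against \<open>c0^2\<close>.\<close>

lemma clt_standardized_weights:
  fixes V :: "nat \<Rightarrow> 'q \<Rightarrow> nat \<Rightarrow> real"
  assumes S: "prob_space S" and [measurable]: "\<And>n s. (\<lambda>q. V n q s) \<in> borel_measurable S"
    and sq: "converges_in_prob S (\<lambda>n q. (\<Sum>s<n-1. (V n q s)\<^sup>2) / n) \<tau>" and \<tau>: "\<tau> \<ge> 0"
    and small: "\<And>\<delta>. \<delta> > 0 \<Longrightarrow> (\<lambda>n. measure S {q\<in>space S. \<exists>s<n-1. \<bar>V n q s\<bar> > \<delta> * sqrt n}) \<longlonglongrightarrow> 0"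
  shows "(\<lambda>n. \<integral>q. expectation (char_sum (\<lambda>s. u / (sqrt n * c0) * V n q s) (n - 1)) \<partial>S)
    \<longlonglongrightarrow> complex_of_real (exp (- (\<tau> * u\<^sup>2 / 2)))"
proof -
  interpret S: prob_space S by fact
  have "(\<lambda>n. \<integral>q. expectation (char_sum (\<lambda>s. u / (sqrt n * c0) * V n q s) (n - 1)) \<partial>S)
    \<longlonglongrightarrow> complex_of_real (exp (- (\<sigma>\<^sup>2 * m / 2 * (u\<^sup>2 / c0\<^sup>2 * \<tau>))))"
  proof (rule clt_random_weights[OF S])
    have eq: "(\<Sum>s<n-1. (u / (sqrt n * c0) * V n q s)\<^sup>2) = u\<^sup>2 / c0\<^sup>2 * ((\<Sum>s<n-1. (V n q s)\<^sup>2) / n)" for n q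
      by (simp add: power_mult_distrib power_divide sum_distrib_left[symmetric] sum_divide_distrib[symmetric])
    show "converges_in_prob S (\<lambda>n q. \<Sum>s<n-1. (u / (sqrt n * c0) * V n q s)\<^sup>2) (u\<^sup>2 / c0\<^sup>2 * \<tau>)"
      unfolding eq by (rule S.converges_in_prob_cmult[OF sq])
    show "u\<^sup>2 / c0\<^sup>2 * \<tau> \<ge> 0" using \<tau> by simp
    fix \<delta> :: real assume \<delta>: "\<delta> > 0"
    define d where "d = \<delta> * c0 / (\<bar>u\<bar> + 1)"
    have d: "d > 0" using \<delta> c0_pos by (simp add: d_def)
    show "(\<lambda>n. S.prob {q\<in>space S. \<exists>s<n-1. \<bar>u / (sqrt n * c0) * V n q s\<bar> > \<delta>}) \<longlonglongrightarrow> 0"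
    proof (rule tendsto_sandwich[OF _ _ tendsto_const small[OF d]])
      show "\<forall>\<^sub>F n in sequentially. S.prob {q\<in>space S. \<exists>s<n-1. \<bar>u / (sqrt n * c0) * V n q s\<bar> > \<delta>}
          \<le> S.prob {q\<in>space S. \<exists>s<n-1. \<bar>V n q s\<bar> > d * sqrt n}"
        unfolding d_def using coeff_large[OF \<delta>]
        by (intro always_eventually allI S.finite_measure_mono) (blast, measurable)
    qed simp
  qed measurable
  moreover have "\<sigma>\<^sup>2 * m / 2 * (u\<^sup>2 / c0\<^sup>2 * \<tau>) = \<tau> * u\<^sup>2 / 2"
    unfolding c0_square using sigma_pos m_pos by simp
  ultimately show ?thesis by (simp only:)
qed

lemma one_replica:
  "(\<lambda>n. \<integral>p. (\<integral>\<omega>. iexp (u * T n p \<omega>) \<partial>M) \<partial>P) \<longlonglongrightarrow> complex_of_real (exp (- u\<^sup>2 / 2))"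
proof -
  have "(\<lambda>n. \<integral>p. expectation (char_sum (\<lambda>s. u / (sqrt n * c0) * W n (s + 2) p) (n - 1)) \<partial>P)
    \<longlonglongrightarrow> complex_of_real (exp (- (1 * u\<^sup>2 / 2)))"
  proof (rule clt_standardized_weights[OF prob_spaces(1)])
    show "converges_in_prob P (\<lambda>n p. (\<Sum>s<n-1. (W n (s + 2) p)\<^sup>2) / n) 1"
      using W_bar_conv unfolding W_bar_def[abs_def] .
    fix \<delta> :: real assume \<delta>: "\<delta> > 0"
    show "(\<lambda>n. P.prob {p\<in>space P. \<exists>s<n-1. \<bar>W n (s + 2) p\<bar> > \<delta> * sqrt n}) \<longlonglongrightarrow> 0"
    proof (rule tendsto_sandwich[OF _ _ tendsto_const W_max[OF \<delta>]])
      show "\<forall>\<^sub>F n in sequentially. P.prob {p\<in>space P. \<exists>s<n-1. \<bar>W n (s + 2) p\<bar> > \<delta> * sqrt n}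
          \<le> P.prob {p\<in>space P. \<exists>t\<in>{1..n}. \<bar>W n t p\<bar> > \<delta> * sqrt n}"
        by (intro always_eventually allI P.finite_measure_mono) (force intro!: bexI[of _ "_ + 2"], measurable)
    qed simp
  qed auto
  then show ?thesis unfolding iexp_T by simp
qed

lemma two_replicas:
  "(\<lambda>n. \<integral>q. (\<integral>\<omega>. iexp (u * T n (fst q) \<omega> - u * T n (snd q) \<omega>) \<partial>M) \<partial>(P \<Otimes>\<^sub>M P)) \<longlonglongrightarrow> complex_of_real (exp (- u\<^sup>2))"
proof -
  define V where "V n q s = W n (s + 2) (fst q) - W n (s + 2) (snd q)" for n q and s :: nat
  have "(\<lambda>n. \<integral>q. expectation (char_sum (\<lambda>s. u / (sqrt n * c0) * V n q s) (n - 1)) \<partial>(P \<Otimes>\<^sub>M P))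
    \<longlonglongrightarrow> complex_of_real (exp (- (2 * u\<^sup>2 / 2)))"
  proof (rule clt_standardized_weights[OF PP.P.prob_space_axioms])
    show "(\<lambda>q. V n q s) \<in> borel_measurable (P \<Otimes>\<^sub>M P)" for n s unfolding V_def by measurable
    \<comment> \<open>Expanding \<open>(W - W')^2\<close> leaves two mean squares, each tending to
      1, and a cross term tending to 0; the limit 2 produces the exponent
      \<open>- u^2\<close>.\<close>
    note fst_conv = converges_in_prob_pair_fst[OF prob_spaces(1) prob_spaces(1) W_bar_measurable W_bar_conv]
    note snd_conv = converges_in_prob_pair_snd[OF prob_spaces(1) prob_spaces(1) W_bar_measurable W_bar_conv]
    have "converges_in_prob (P \<Otimes>\<^sub>M P) (\<lambda>n q. W_bar n (fst q) + W_bar n (snd q)) (1 + 1)"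
      by (rule PP.P.converges_in_prob_add[OF _ _ fst_conv snd_conv]) measurable
    from PP.P.converges_in_prob_add[OF _ _ this PP.P.converges_in_prob_cmult[OF W_cross_conv, of "-2"]]
    have "converges_in_prob (P \<Otimes>\<^sub>M P) (\<lambda>n q. W_bar n (fst q) + W_bar n (snd q) + - 2 * W_cross n q) 2" by simp
    moreover have "(\<Sum>s<n-1. (V n q s)\<^sup>2) / n = W_bar n (fst q) + W_bar n (snd q) + - 2 * W_cross n q" for n q
      unfolding V_def W_bar_def W_cross_def power2_diff sum_subtractf sum.distrib mult.assoc sum_distrib_left[symmetric]
      by (simp add: add_divide_distrib diff_divide_distrib)
    ultimately show "converges_in_prob (P \<Otimes>\<^sub>M P) (\<lambda>n q. (\<Sum>s<n-1. (V n q s)\<^sup>2) / n) 2" by simp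
    fix \<delta> :: real assume \<delta>: "\<delta> > 0"
    \<comment> \<open>A difference above \<open>\<delta> * sqrt n\<close> forces one of the two
      weights above half of it.\<close>
    then have d: "\<delta> / 2 > 0" by simp
    let ?A = "\<lambda>n. {q\<in>space (P \<Otimes>\<^sub>M P). \<exists>s<n-1. \<bar>V n q s\<bar> > \<delta> * sqrt n}"
    let ?E = "\<lambda>n. {p\<in>space P. \<exists>t\<in>{1..n}. \<bar>W n t p\<bar> > \<delta> / 2 * sqrt n}"
    show "(\<lambda>n. PP.prob (?A n)) \<longlonglongrightarrow> 0"
    proof (rule tendsto_sandwich[OF _ _ tendsto_const])
      show "(\<lambda>n. P.prob (?E n) + P.prob (?E n)) \<longlonglongrightarrow> 0"
        using tendsto_add[OF W_max[OF d] W_max[OF d]] by simp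
      have "PP.prob (?A n) \<le> P.prob (?E n) + P.prob (?E n)" for n
      proof -
        have "?A n \<subseteq> ?E n \<times> space P \<union> space P \<times> ?E n"
        proof
          fix q assume "q \<in> ?A n"
          then obtain s where q: "q \<in> space P \<times> space P" "s < n - 1" "\<bar>V n q s\<bar> > \<delta> * sqrt n"
            by (auto simp: space_pair_measure)
          then have "\<delta> / 2 * sqrt n < \<bar>W n (s + 2) (fst q)\<bar> \<or> \<delta> / 2 * sqrt n < \<bar>W n (s + 2) (snd q)\<bar>"
            unfolding V_def by (simp add: abs_if split: if_splits) linarith+
          moreover have "s + 2 \<in> {1..n}" using q by auto
          ultimately show "q \<in> ?E n \<times> space P \<union> space P \<times> ?E n" using q(1) by (cases q) auto
        qed
        then have "PP.prob (?A n) \<le> PP.prob (?E n \<times> space P \<union> space P \<times> ?E n)"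
          by (rule PP.P.finite_measure_mono) measurable
        also have "\<dots> \<le> PP.prob (?E n \<times> space P) + PP.prob (space P \<times> ?E n)"
          by (rule measure_Un_le) measurable
        also have "\<dots> = P.prob (?E n) + P.prob (?E n)"
          by (simp add: measure_pair_fst[OF prob_spaces(1) prob_spaces(1)] measure_pair_snd[OF prob_spaces(1) prob_spaces(1)])
        finally show ?thesis .
      qed
      then show "\<forall>\<^sub>F n in sequentially. PP.prob (?A n) \<le> P.prob (?E n) + P.prob (?E n)" by simp
    qed simp
  qed simp
  then show ?thesis unfolding iexp_T_diff V_def by simp
qed

lemma T_conditional_clt:
  "converges_in_prob M (\<lambda>n \<omega>. P.prob {p \<in> space P. T n p \<omega> \<le> y}) (cdf std_normal_distribution y)"
proof (rule conditional_clt_of_replicas[OF prob_spaces T_measurable one_replica two_replicas, of 2])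
  fix n
  have "(\<integral>\<^sup>+\<omega>. (\<integral>\<^sup>+p. ennreal \<bar>T n p \<omega>\<bar> \<partial>P) \<partial>M) = (\<integral>\<^sup>+q. ennreal \<bar>T n (fst q) (snd q)\<bar> \<partial>(P \<Otimes>\<^sub>M M))"
    using PM.nn_integral_snd[of "\<lambda>q. ennreal \<bar>T n (fst q) (snd q)\<bar>"] by simp
  \<comment> \<open>This domination together with the second moment bound 1 yields the constant
    2.\<close>
  also have "\<dots> \<le> (\<integral>\<^sup>+q. ennreal (1 + (T n (fst q) (snd q))\<^sup>2) \<partial>(P \<Otimes>\<^sub>M M))"
  proof (intro nn_integral_mono ennreal_leI)
    show "\<bar>T n (fst q) (snd q)\<bar> \<le> 1 + (T n (fst q) (snd q))\<^sup>2" for q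
      using abs_mult_le_sum_squares[of 1 "T n (fst q) (snd q)"] by simp
  qed
  also have "\<dots> = ennreal (PM.expectation (\<lambda>q. 1 + (T n (fst q) (snd q))\<^sup>2))"
    using integrable_T2 by (intro nn_integral_eq_integral) auto
  also have "\<dots> \<le> ennreal 2"
    using integrable_T2[of n] expectation_T2[of n] by (intro ennreal_leI) (simp add: PM.P.prob_space)
  finally show "(\<integral>\<^sup>+\<omega>. (\<integral>\<^sup>+p. ennreal \<bar>T n p \<omega>\<bar> \<partial>P) \<partial>M) \<le> ennreal 2" .
qed simp

section \<open>Linearization of the rescaled contrast\<close>

definition R :: "nat \<Rightarrow> 'p \<Rightarrow> 'a \<Rightarrow> real" where
  "R n p \<omega> = sqrt n * inverse (sd n) *
    ((\<Sum>s<n-1. (1 + sd n * W n (s + 2) p) * x (Suc s) \<omega> * x s \<omega>) / (\<Sum>s<n-1. (1 + sd n * W n (s + 2) p) * (x s \<omega>)\<^sup>2)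
     - (\<Sum>s<n-1. x (Suc s) \<omega> * x s \<omega>) / (\<Sum>s<n-1. (x s \<omega>)\<^sup>2))"

lemma R_measurable [measurable]: "(\<lambda>q. R n (fst q) (snd q)) \<in> borel_measurable (P \<Otimes>\<^sub>M M)"
  unfolding R_def by measurable

text \<open>After inserting the recursion both quotients contain the summand
  \<open>\<theta>\<close>, which cancels. In the difference of what remains a factor
  \<open>sd n\<close> splits off and cancels against the normalization.\<close>

lemma R_eq:
  assumes n: "n \<ge> 1" and Q0: "Q n \<omega> \<noteq> 0" and D0: "D n p \<omega> \<noteq> 0"
  shows "R n p \<omega> = (c0 * T n p \<omega> - L n \<omega> / Q n \<omega> * B n p \<omega>) / D n p \<omega>"
proof -
  define a t b l q where "a = sqrt (real n)" and "t = (\<Sum>s<n-1. W n (s + 2) p * (x s \<omega> * z s \<omega>))"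
    and "b = (\<Sum>s<n-1. W n (s + 2) p * (x s \<omega>)\<^sup>2)" and "l = (\<Sum>s<n-1. x s \<omega> * z s \<omega>)"
    and "q = (\<Sum>s<n-1. (x s \<omega>)\<^sup>2)"
  define e where "e = q + sd n * b"
  have a: "a > 0" "real n = a * a" using n by (simp_all add: a_def)
  have sd: "sd n \<noteq> 0" using sd_pos[OF n] by simp
  have s1: "(\<Sum>s<n-1. (1 + sd n * W n (s + 2) p) * x (Suc s) \<omega> * x s \<omega>) = \<theta> * e + l + sd n * t"
    unfolding x_Suc e_def q_def b_def l_def t_def
    by (simp add: sum.distrib sum_distrib_left algebra_simps power2_eq_square)
  have s2: "(\<Sum>s<n-1. (1 + sd n * W n (s + 2) p) * (x s \<omega>)\<^sup>2) = e"
    unfolding e_def q_def b_def by (simp add: sum.distrib sum_distrib_left algebra_simps)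
  have s3: "(\<Sum>s<n-1. x (Suc s) \<omega> * x s \<omega>) = \<theta> * q + l"
    unfolding x_Suc q_def l_def by (simp add: sum.distrib sum_distrib_left algebra_simps power2_eq_square)
  have q: "q \<noteq> 0" and Qn: "Q n \<omega> = q / (a * a)" using Q0 n by (auto simp: Q_def q_def a)
  have Dn: "D n p \<omega> = e / (a * a)" unfolding D_def Qn B_def e_def b_def a(2) by (simp add: add_divide_distrib)
  have e: "e \<noteq> 0" using D0 unfolding Dn by auto
  have Tn: "c0 * T n p \<omega> = t / a" using c0_pos by (simp add: T_def t_def a_def)
  have Ln: "L n \<omega> = l / a" by (simp add: L_def l_def a_def)
  have Bn: "B n p \<omega> = b / (a * a)" unfolding B_def b_def a(2) ..
  have "R n p \<omega> = a * inverse (sd n) * ((\<theta> * e + l + sd n * t) / e - (\<theta> * q + l) / q)"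
    unfolding R_def s1 s2 s3 q_def[symmetric] a_def[symmetric] ..
  also have "\<dots> = a * inverse (sd n) * ((l * q + sd n * t * q - l * e) / (e * q))"
    using e q by (simp add: field_simps)
  also have "l * q + sd n * t * q - l * e = sd n * (t * q - l * b)" by (simp add: e_def algebra_simps)
  also have "a * inverse (sd n) * (sd n * (t * q - l * b) / (e * q)) = a * (t * q - l * b) / (e * q)"
    using sd by simp
  also have "\<dots> = (c0 * T n p \<omega> - L n \<omega> / Q n \<omega> * B n p \<omega>) / D n p \<omega>"
    unfolding Tn Ln Bn Dn Qn using a e q by (simp add: field_simps)
  finally show ?thesis .
qed

text \<open>By \<open>R_eq\<close> the difference is
  \<open>c0 * T * (1 / D - 1 / m) - L / (Q * D) * B\<close>, in each term a tight factor times a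
  vanishing one. The identity needs \<open>Q\<close> and \<open>D\<close> nonzero, which holds with
  probability tending to 1 since both converge to \<open>m > 0\<close>.\<close>

lemma R_T_conv: "converges_in_prob (P \<Otimes>\<^sub>M M) (\<lambda>n q. R n (fst q) (snd q) - c0 / m * T n (fst q) (snd q)) 0"
proof -
  note Q_snd = converges_in_prob_pair_snd[OF prob_spaces Q_measurable Q_conv]
  have [measurable]: "(\<lambda>q. Q n (snd q)) \<in> borel_measurable (P \<Otimes>\<^sub>M M)" "(\<lambda>q. L n (snd q)) \<in> borel_measurable (P \<Otimes>\<^sub>M M)" for n
    by measurable
  note invQ = PM.P.converges_in_prob_inverse[OF _ Q_snd m_pos]
  note invD = PM.P.converges_in_prob_inverse[OF _ D_conv m_pos]
  have "PM.P.tight_seq (\<lambda>n q. L n (snd q) * (inverse (Q n (snd q)) * inverse (D n (fst q) (snd q))))"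
    using PM.P.converges_in_prob_tight[OF invQ] PM.P.converges_in_prob_tight[OF invD]
      tight_seq_pair_snd[OF prob_spaces(1) L_measurable L_tight]
    by (intro PM.P.tight_seq_mult) auto
  from PM.P.converges_in_prob_cmult[OF PM.P.converges_in_prob_tight_mult[OF _ _ this B_conv], of "- 1"]
  have 1: "converges_in_prob (P \<Otimes>\<^sub>M M) (\<lambda>n q. - 1 * (L n (snd q) * (inverse (Q n (snd q)) * inverse (D n (fst q) (snd q))) * B n (fst q) (snd q))) 0"
    by simp
  have "converges_in_prob (P \<Otimes>\<^sub>M M) (\<lambda>n q. inverse (D n (fst q) (snd q)) + - inverse m) 0"
    using PM.P.converges_in_prob_add[OF _ _ invD PM.P.converges_in_prob_const_seq[OF tendsto_const, of "- inverse m"]] by simp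
  from PM.P.converges_in_prob_cmult[OF PM.P.converges_in_prob_tight_mult[OF _ _ T_tight this], of c0]
  have 2: "converges_in_prob (P \<Otimes>\<^sub>M M) (\<lambda>n q. c0 * (T n (fst q) (snd q) * (inverse (D n (fst q) (snd q)) + - inverse m))) 0"
    by simp
  define V where "V n q = c0 * (T n (fst q) (snd q) * (inverse (D n (fst q) (snd q)) + - inverse m))
    + - 1 * (L n (snd q) * (inverse (Q n (snd q)) * inverse (D n (fst q) (snd q))) * B n (fst q) (snd q))" for n q
  have [measurable]: "V n \<in> borel_measurable (P \<Otimes>\<^sub>M M)" for n unfolding V_def by measurable
  have V: "converges_in_prob (P \<Otimes>\<^sub>M M) V 0"
    unfolding V_def[abs_def] using PM.P.converges_in_prob_add[OF _ _ 2 1] by simp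
  have eq: "R n (fst q) (snd q) - c0 / m * T n (fst q) (snd q) = V n q"
    if "n \<ge> 1" "Q n (snd q) \<noteq> 0" "D n (fst q) (snd q) \<noteq> 0" for n q
    unfolding R_eq[OF that] V_def using that m_pos by (simp add: field_simps)
  show ?thesis
  proof (rule PM.P.converges_in_probI)
    fix \<epsilon> \<eta> :: real assume \<epsilon>: "\<epsilon> > 0" and \<eta>: "\<eta> > 0"
    then have m2: "m / 2 > 0" and e3: "\<eta> / 3 > 0" using m_pos by auto
    from PM.P.converges_in_probD[OF V \<epsilon> e3] PM.P.converges_in_probD[OF Q_snd m2 e3]
      PM.P.converges_in_probD[OF D_conv m2 e3] eventually_ge_at_top[of "1::nat"]
    show "\<forall>\<^sub>F n in sequentially. PM.prob {q \<in> space (P \<Otimes>\<^sub>M M). \<bar>R n (fst q) (snd q) - c0 / m * T n (fst q) (snd q) - 0\<bar> > \<epsilon>} < \<eta>"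
    proof eventually_elim
      case (elim n)
      let ?V = "{q \<in> space (P \<Otimes>\<^sub>M M). \<bar>V n q - 0\<bar> > \<epsilon>}" and ?Q = "{q \<in> space (P \<Otimes>\<^sub>M M). \<bar>Q n (snd q) - m\<bar> > m / 2}"
        and ?D = "{q \<in> space (P \<Otimes>\<^sub>M M). \<bar>D n (fst q) (snd q) - m\<bar> > m / 2}"
      have sub: "{q \<in> space (P \<Otimes>\<^sub>M M). \<bar>R n (fst q) (snd q) - c0 / m * T n (fst q) (snd q) - 0\<bar> > \<epsilon>} \<subseteq> (?V \<union> ?Q) \<union> ?D"
      proof
        fix q assume q: "q \<in> {q \<in> space (P \<Otimes>\<^sub>M M). \<bar>R n (fst q) (snd q) - c0 / m * T n (fst q) (snd q) - 0\<bar> > \<epsilon>}"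
        show "q \<in> (?V \<union> ?Q) \<union> ?D"
        \<comment> \<open>A vanishing \<open>Q\<close> or \<open>D\<close> is at distance
          \<open>m > m / 2\<close> from its limit, so this case is absorbed by the events
          \<open>?Q\<close> and \<open>?D\<close>.\<close>
        proof (cases "Q n (snd q) = 0 \<or> D n (fst q) (snd q) = 0")
          case True
          then show ?thesis using q m_pos by auto
        next
          case False
          then show ?thesis using q eq[OF elim(4), of q] by auto
        qed
      qed
      have "PM.prob (?V \<union> ?Q) < \<eta> / 3 + \<eta> / 3"
        using elim by (intro PM.P.prob_union_less[OF order_refl]) auto
      then have "PM.prob {q \<in> space (P \<Otimes>\<^sub>M M). \<bar>R n (fst q) (snd q) - c0 / m * T n (fst q) (snd q) - 0\<bar> > \<epsilon>} < \<eta> / 3 + \<eta> / 3 + \<eta> / 3"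
        using elim by (intro PM.P.prob_union_less[OF sub]) auto
      then show ?case by simp
    qed
  qed
qed

lemma R_conditional_clt:
  "converges_in_prob M (\<lambda>n \<omega>. P.prob {p \<in> space P. R n p \<omega> \<le> y}) (cdf std_normal_distribution (y / (c0 / m)))"
  by (rule conditional_slutsky[OF prob_spaces T_measurable R_measurable _ R_T_conv T_conditional_clt])
    (use c0_pos m_pos in simp)

end

subsection \<open>Stationary processes and exchangeable rows\<close>

text \<open>Convexity of the fourth power at the average
  \<open>r * u + (1 - r) * (y / (1 - r))\<close>. The coefficient of \<open>u^4\<close> stays
  \<open>r < 1\<close>, which makes the iteration below contract; a crude bound on
  \<open>(a + b)^4\<close> would lose this.\<close>

lemma fourth_power_convexity:
  fixes r u y :: real
  assumes "0 \<le> r" "r < 1"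
  shows "(r * u + y) ^ 4 \<le> r * u ^ 4 + y ^ 4 / (1 - r) ^ 3"
proof -
  define d where "d = 1 - r"
  have d: "d > 0" "d \<le> 1" "1 - d = r" using assms by (auto simp: d_def)
  have "((1 - d) *\<^sub>R u + d *\<^sub>R (y / d)) ^ 4 \<le> (1 - d) * u ^ 4 + d * (y / d) ^ 4"
    by (rule convex_onD[OF convex_power_even]) (use d in auto)
  moreover have "d * (y / d) ^ 4 = y ^ 4 / d ^ 3"
  proof -
    have "d ^ 4 = d * d ^ 3" by (simp add: eval_nat_numeral)
    then show ?thesis using d by (simp add: power_divide)
  qed
  moreover have "d *\<^sub>R (y / d) = y" using d by simp
  ultimately show ?thesis by (simp only: d real_scaleR_def d_def[symmetric])
qed

lemma norm_min_fourth_power_le: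
  fixes c K y :: real
  assumes "0 \<le> c" "0 \<le> K"
  shows "norm (min (c * y ^ 4) K) \<le> K"
proof -
  have "0 \<le> c * y ^ 4" using assms by simp
  then show ?thesis using assms by (simp add: min_def)
qed

text \<open>Stationarity of an AR(1) process is an equation in law, from which moments have to be
  extracted: iterating \<open>V\<^sup>4 \<le> r U\<^sup>4 + C Y\<^sup>4\<close> under the truncation \<open>min _ K\<close> leaves
  \<open>E (min (r\<^sup>h U\<^sup>4) K)\<close>, which vanishes as \<open>h \<rightarrow> \<infinity>\<close>.\<close>

lemma (in prob_space) fourth_moment_of_fixed_point_law:
  fixes U V Y :: "'a \<Rightarrow> real"
  assumes [measurable]: "U \<in> borel_measurable M" "V \<in> borel_measurable M" "Y \<in> borel_measurable M"
    and law: "distr M borel V = distr M borel U"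
    and eq: "AE \<omega> in M. V \<omega> = \<theta> * U \<omega> + Y \<omega>"
    and \<theta>: "\<bar>\<theta>\<bar> < 1" and Y4: "integrable M (\<lambda>\<omega>. Y \<omega> ^ 4)"
  shows "integrable M (\<lambda>\<omega>. U \<omega> ^ 4)"
proof -
  define r where "r = \<bar>\<theta>\<bar>"
  have r: "0 \<le> r" "r < 1" using \<theta> by (auto simp: r_def)
  define C where "C = expectation (\<lambda>\<omega>. Y \<omega> ^ 4) / (1 - r) ^ 3"
  have C: "C \<ge> 0" using r by (simp add: C_def)
  define e where "e K c = expectation (\<lambda>\<omega>. min (c * U \<omega> ^ 4) K)" for K c
  have int: "integrable M (\<lambda>\<omega>. min (c * U \<omega> ^ 4) K)" if "K \<ge> 0" "c \<ge> 0" for K c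
    using that by (intro integrable_const_bound[of _ K] AE_I2 norm_min_fourth_power_le) auto
  have V4: "AE \<omega> in M. V \<omega> ^ 4 \<le> r * U \<omega> ^ 4 + Y \<omega> ^ 4 / (1 - r) ^ 3"
    using eq
  proof eventually_elim
    case (elim \<omega>)
    have "V \<omega> ^ 4 = \<bar>\<theta> * U \<omega> + Y \<omega>\<bar> ^ 4" unfolding elim by (simp only: power_even_abs_numeral even_numeral)
    also have "\<dots> \<le> (r * \<bar>U \<omega>\<bar> + \<bar>Y \<omega>\<bar>) ^ 4"
      unfolding r_def abs_mult[symmetric] by (rule power_mono[OF abs_triangle_ineq]) simp
    also have "\<dots> \<le> r * \<bar>U \<omega>\<bar> ^ 4 + \<bar>Y \<omega>\<bar> ^ 4 / (1 - r) ^ 3" by (rule fourth_power_convexity[OF r])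
    finally show ?case by (simp only: power_even_abs_numeral even_numeral)
  qed
  \<comment> \<open>Truncated expectations depend on the law alone, so \<open>U\<close> may be
    exchanged for \<open>V\<close>. Then \<open>min (a + b) K \<le> min a K + b\<close> for
    \<open>b \<ge> 0\<close> moves the innovation out of the truncation.\<close>
  have step: "e K c \<le> e K (r * c) + c * C" if K: "K \<ge> 0" and c: "c \<ge> 0" for K c
  proof -
    have "e K c = (\<integral>u. min (c * u ^ 4) K \<partial>distr M borel U)" unfolding e_def by (simp add: integral_distr)
    also have "\<dots> = expectation (\<lambda>\<omega>. min (c * V \<omega> ^ 4) K)" unfolding law[symmetric] by (simp add: integral_distr)
    also have "\<dots> \<le> expectation (\<lambda>\<omega>. min (r * c * U \<omega> ^ 4) K + c * (Y \<omega> ^ 4 / (1 - r) ^ 3))"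
    proof (rule integral_mono_AE)
      show "integrable M (\<lambda>\<omega>. min (c * V \<omega> ^ 4) K)"
        using K c by (intro integrable_const_bound[of _ K] AE_I2 norm_min_fourth_power_le) auto
      show "integrable M (\<lambda>\<omega>. min (r * c * U \<omega> ^ 4) K + c * (Y \<omega> ^ 4 / (1 - r) ^ 3))"
        using int[OF K, of "r * c"] c r Y4 by simp
      show "AE \<omega> in M. min (c * V \<omega> ^ 4) K \<le> min (r * c * U \<omega> ^ 4) K + c * (Y \<omega> ^ 4 / (1 - r) ^ 3)"
        using V4
      proof eventually_elim
        case (elim \<omega>)
        have "c * V \<omega> ^ 4 \<le> c * (r * U \<omega> ^ 4 + Y \<omega> ^ 4 / (1 - r) ^ 3)"
          using elim c by (rule mult_left_mono)
        also have "\<dots> = r * c * U \<omega> ^ 4 + c * (Y \<omega> ^ 4 / (1 - r) ^ 3)" by (simp add: algebra_simps)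
        finally have 1: "c * V \<omega> ^ 4 \<le> r * c * U \<omega> ^ 4 + c * (Y \<omega> ^ 4 / (1 - r) ^ 3)" .
        have "0 \<le> c * (Y \<omega> ^ 4 / (1 - r) ^ 3)" using c r by simp
        with 1 show ?case by linarith
      qed
    qed
    also have "\<dots> = e K (r * c) + c * C"
      using int[OF K, of "r * c"] c r Y4 by (simp add: e_def C_def)
    finally show ?thesis .
  qed
  have iter: "e K 1 \<le> e K (r ^ h) + C / (1 - r) * (1 - r ^ h)" if K: "K \<ge> 0" for K and h :: nat
  proof (induction h)
    case (Suc h)
    have "e K (r ^ h) \<le> e K (r ^ Suc h) + r ^ h * C" using step[OF K, of "r ^ h"] r by simp
    moreover have "C / (1 - r) * (1 - r ^ h) + r ^ h * C = C / (1 - r) * (1 - r ^ Suc h)"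
      using r by (simp add: field_simps)
    ultimately show ?case using Suc by linarith
  qed simp
  have bound: "e K 1 \<le> C / (1 - r)" if K: "K \<ge> 0" for K
  proof (rule tendsto_lowerbound[of "\<lambda>h. e K (r ^ h) + C / (1 - r)" _ sequentially])
    have "(\<lambda>h. e K (r ^ h)) \<longlonglongrightarrow> expectation (\<lambda>\<omega>. 0)"
      unfolding e_def
    proof (rule integral_dominated_convergence[where w="\<lambda>_. K"])
      show "AE \<omega> in M. (\<lambda>h. min (r ^ h * U \<omega> ^ 4) K) \<longlonglongrightarrow> 0"
      proof (intro AE_I2)
        fix \<omega>
        have "(\<lambda>h. min (r ^ h * U \<omega> ^ 4) K) \<longlonglongrightarrow> min (0 * U \<omega> ^ 4) K"
          using r by (intro tendsto_intros LIMSEQ_power_zero) auto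
        then show "(\<lambda>h. min (r ^ h * U \<omega> ^ 4) K) \<longlonglongrightarrow> 0" using K by simp
      qed
      show "AE \<omega> in M. norm (min (r ^ h * U \<omega> ^ 4) K) \<le> K" for h
        using K r by (intro AE_I2 norm_min_fourth_power_le) auto
    qed auto
    then show "(\<lambda>h. e K (r ^ h) + C / (1 - r)) \<longlonglongrightarrow> C / (1 - r)"
      using tendsto_add[OF _ tendsto_const, of "\<lambda>h. e K (r ^ h)" 0 sequentially "C / (1 - r)"] by simp
    have "C / (1 - r) * (1 - r ^ h) \<le> C / (1 - r) * 1" for h
      using C r by (intro mult_left_mono) auto
    then show "\<forall>\<^sub>F h in sequentially. e K 1 \<le> e K (r ^ h) + C / (1 - r)"
      using iter[OF K] by (intro always_eventually allI) (smt (verit) mult.right_neutral)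
  qed simp
  show ?thesis
  proof (rule integrableI_bounded)
    \<comment> \<open>The bound \<open>C / (1 - r)\<close> is uniform in the truncation level, so
      monotone convergence removes the truncation.\<close>
    have "(\<integral>\<^sup>+\<omega>. ennreal (U \<omega> ^ 4) \<partial>M) = (\<integral>\<^sup>+\<omega>. (SUP k. ennreal (min (U \<omega> ^ 4) (real k))) \<partial>M)"
    proof (intro nn_integral_cong)
      fix \<omega>
      obtain k0 :: nat where k0: "U \<omega> ^ 4 \<le> real k0" using real_arch_simple by blast
      show "ennreal (U \<omega> ^ 4) = (SUP k. ennreal (min (U \<omega> ^ 4) (real k)))"
      proof (rule antisym)
        show "ennreal (U \<omega> ^ 4) \<le> (SUP k. ennreal (min (U \<omega> ^ 4) (real k)))"
          by (rule SUP_upper2[of k0]) (use k0 in auto)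
        show "(SUP k. ennreal (min (U \<omega> ^ 4) (real k))) \<le> ennreal (U \<omega> ^ 4)"
          by (intro SUP_least ennreal_leI) simp
      qed
    qed
    also have "\<dots> = (SUP k. \<integral>\<^sup>+\<omega>. ennreal (min (U \<omega> ^ 4) (real k)) \<partial>M)"
      by (rule nn_integral_monotone_convergence_SUP) (auto simp: incseq_def le_fun_def intro!: ennreal_leI)
    also have "\<dots> \<le> ennreal (C / (1 - r))"
    proof (rule SUP_least)
      fix k :: nat
      have "(\<integral>\<^sup>+\<omega>. ennreal (min (U \<omega> ^ 4) (real k)) \<partial>M) = ennreal (e (real k) 1)"
        unfolding e_def using int[of "real k" 1] by (subst nn_integral_eq_integral) auto
      also have "\<dots> \<le> ennreal (C / (1 - r))" by (intro ennreal_leI bound) simp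
      finally show "(\<integral>\<^sup>+\<omega>. ennreal (min (U \<omega> ^ 4) (real k)) \<partial>M) \<le> ennreal (C / (1 - r))" .
    qed
    finally show "(\<integral>\<^sup>+\<omega>. ennreal (norm (U \<omega> ^ 4)) \<partial>M) < \<infinity>"
      by (simp add: le_less_trans[OF _ ennreal_less_top])
  qed simp
qed

text \<open>The recursion is given almost surely but wanted at every point, so the innovation is
  replaced by the residual \<open>\<zeta> t = X t - \<theta> * X (t - 1)\<close>, almost surely
  equal to \<open>Z t\<close>. Time is shifted: \<open>x t\<close> is \<open>X (t + 1)\<close>,
  \<open>z t\<close> is the residual at \<open>t + 2\<close>, and the past \<open>F t\<close> is
  generated by all \<open>X s\<close> with \<open>s < t + 2\<close>, including the infinite
  past.\<close>

lemma (in prob_space) stationary_ar1_process: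
  fixes X Z :: "int \<Rightarrow> 'a \<Rightarrow> real" and \<theta> \<sigma> :: real
  assumes \<theta>: "\<bar>\<theta>\<bar> < 1"
    and X[measurable]: "\<And>t. X t \<in> borel_measurable M"
    and stat: "strictly_stationary M X"
    and ar: "\<And>t. AE \<omega> in M. X t \<omega> = \<theta> * X (t - 1) \<omega> + Z t \<omega>"
    and ind: "\<And>t. indep_elements M borel (Z t) (\<Pi>\<^sub>M s\<in>{..<t}. borel) (\<lambda>\<omega>. \<lambda>s\<in>{..<t}. X s \<omega>)"
    and Z[measurable]: "\<And>t. Z t \<in> borel_measurable M"
    and iid: "\<And>s t. distr M borel (Z s) = distr M borel (Z t)"
    and Z4: "\<And>t. integrable M (\<lambda>\<omega>. Z t \<omega> ^ 4)"
    and Z1: "\<And>t. expectation (Z t) = 0"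
    and Z2: "\<And>t. variance (Z t) = \<sigma>\<^sup>2"
  shows "\<exists>m \<kappa>. ar1_process M
    (\<lambda>t. vimage_algebra (space M) (\<lambda>\<omega>. \<lambda>s\<in>{..<int t + 2}. X s \<omega>) (\<Pi>\<^sub>M s\<in>{..<int t + 2}. borel))
    (\<lambda>t. X (int t + 1)) (\<lambda>t \<omega>. X (int t + 2) \<omega> - \<theta> * X (int t + 1) \<omega>) \<theta> \<sigma> m \<kappa>"
proof -
  define past where "past t \<omega> = (\<lambda>s\<in>{..<t}. X s \<omega>)" for t :: int and \<omega>
  define G where "G t = vimage_algebra (space M) (past t) (\<Pi>\<^sub>M s\<in>{..<t}. borel)" for t
  have past_meas[measurable]: "past t \<in> measurable M (\<Pi>\<^sub>M s\<in>{..<t}. borel)" for t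
    unfolding past_def by measurable
  have G_space[simp]: "space (G t) = space M" for t by (simp add: G_def)
  have past_G: "past t \<in> measurable (G t) (\<Pi>\<^sub>M s\<in>{..<t}. borel)" for t
    unfolding G_def using measurable_space[OF past_meas] by (intro measurable_vimage_algebra1) auto
  have XG: "X s \<in> borel_measurable (G t)" if "s < t" for s t
  proof -
    have "(\<lambda>\<omega>. past t \<omega> s) \<in> borel_measurable (G t)"
      using that by (intro measurable_compose[OF past_G measurable_component_singleton]) auto
    then show ?thesis using that by (simp add: past_def)
  qed
  have G_mono: "subalgebra (G t) (G s)" if "s \<le> t" for s t
    unfolding subalgebra_def
  proof
    have "past s \<in> measurable (G t) (\<Pi>\<^sub>M s\<in>{..<s}. borel)"
      unfolding past_def using that by (intro measurable_restrict XG) auto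
    then show "sets (G s) \<subseteq> sets (G t)"
      unfolding G_def[of s] by (intro sets_image_in_sets) auto
  qed simp
  have G_M: "subalgebra M (G t)" for t
    unfolding subalgebra_def G_def using sets_image_in_sets[OF refl past_meas] by simp
  have lawX: "distr M borel (X t) = distr M borel (X 0)" for t
  proof -
    have "distr (distr M (\<Pi>\<^sub>M s\<in>{0}. borel) (\<lambda>\<omega>. \<lambda>s\<in>{0}. X (s + t) \<omega>)) borel (\<lambda>f. f 0)
        = distr (distr M (\<Pi>\<^sub>M s\<in>{0}. borel) (\<lambda>\<omega>. \<lambda>s\<in>{0}. X s \<omega>)) borel (\<lambda>f. f 0)"
      using stat[unfolded strictly_stationary_def, rule_format, of "{0}" t] by simp
    then show ?thesis by (subst (asm) (1 2) distr_distr) (auto simp: comp_def)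
  qed
  have transfer: "expectation (\<lambda>\<omega>. f (X t \<omega>)) = expectation (\<lambda>\<omega>. f (X 0 \<omega>))"
    "integrable M (\<lambda>\<omega>. f (X t \<omega>)) \<longleftrightarrow> integrable M (\<lambda>\<omega>. f (X 0 \<omega>))"
    if [measurable]: "f \<in> borel_measurable borel" for f :: "real \<Rightarrow> real" and t
    using integral_distr[of "X t" M borel f] integral_distr[of "X 0" M borel f]
      integrable_distr_eq[of "X t" M borel f] integrable_distr_eq[of "X 0" M borel f] by (simp_all add: lawX[of t])
  have transferZ: "expectation (\<lambda>\<omega>. Z t \<omega> ^ 4) = expectation (\<lambda>\<omega>. Z 0 \<omega> ^ 4)" for t
    using integral_distr[of "Z t" M borel "\<lambda>y. y ^ 4"] integral_distr[of "Z 0" M borel "\<lambda>y. y ^ 4"] by (simp add: iid[of t 0])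
  define \<zeta> where "\<zeta> t \<omega> = X t \<omega> - \<theta> * X (t - 1) \<omega>" for t \<omega>
  have \<zeta>m[measurable]: "\<zeta> t \<in> borel_measurable M" for t unfolding \<zeta>_def by measurable
  have \<zeta>Z: "AE \<omega> in M. \<zeta> t \<omega> = Z t \<omega>" for t
    using ar[of t] by eventually_elim (simp add: \<zeta>_def)
  \<comment> \<open>The sigma-algebras of \<open>\<zeta> t\<close> and \<open>Z t\<close> may differ
    as families of sets, but the events belonging to one Borel set differ by a null set, also inside
    any event of the past.\<close>
  have \<zeta>_ind: "indep_set (sets (G t)) (sets (vimage_algebra (space M) (\<zeta> t) borel))" for t
    unfolding indep_sets2_eq
  proof (intro conjI ballI)
    show "sets (G t) \<subseteq> events" using G_M by (simp add: subalgebra_def)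
    show "sets (vimage_algebra (space M) (\<zeta> t) borel) \<subseteq> events" by (rule sets_image_in_sets) auto
    fix a b assume a: "a \<in> sets (G t)" and "b \<in> sets (vimage_algebra (space M) (\<zeta> t) borel)"
    then obtain E where E[measurable]: "E \<in> sets borel" and b: "b = \<zeta> t -` E \<inter> space M"
      by (auto simp: sets_vimage_algebra2)
    have [measurable]: "a \<in> events" using a G_M by (auto simp: subalgebra_def)
    have "indep_set (sets (vimage_algebra (space M) (Z t) borel)) (sets (G t))"
      using ind[of t] by (simp add: indep_elements_def G_def past_def[abs_def])
    from indep_setD[OF this in_vimage_algebra[OF E] a]
    have "prob ((Z t -` E \<inter> space M) \<inter> a) = prob (Z t -` E \<inter> space M) * prob a" .
    moreover have "prob ((Z t -` E \<inter> space M) \<inter> a) = prob (a \<inter> b)"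
      unfolding b using \<zeta>Z[of t] by (intro measure_eq_AE) auto
    moreover have "prob (Z t -` E \<inter> space M) = prob b"
      unfolding b using \<zeta>Z[of t] by (intro measure_eq_AE) auto
    ultimately show "prob (a \<inter> b) = prob a * prob b" by simp
  qed
  have Z2': "integrable M (\<lambda>\<omega>. (Z t \<omega>)\<^sup>2)" for t
  proof -
    have "integrable M (\<lambda>\<omega>. ((Z t \<omega>)\<^sup>2)\<^sup>2)" using Z4[of t] by (simp flip: power_mult)
    then show ?thesis by (rule square_integrable_imp_integrable[rotated]) auto
  qed
  have \<zeta>4: "integrable M (\<lambda>\<omega>. \<zeta> t \<omega> ^ 4)" "expectation (\<lambda>\<omega>. \<zeta> t \<omega> ^ 4) = expectation (\<lambda>\<omega>. Z 0 \<omega> ^ 4)" for t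
  proof -
    have "integrable M (\<lambda>\<omega>. \<zeta> t \<omega> ^ 4) \<longleftrightarrow> integrable M (\<lambda>\<omega>. Z t \<omega> ^ 4)"
      using \<zeta>Z[of t] by (intro integrable_cong_AE) auto
    then show "integrable M (\<lambda>\<omega>. \<zeta> t \<omega> ^ 4)" using Z4 by simp
    have "expectation (\<lambda>\<omega>. \<zeta> t \<omega> ^ 4) = expectation (\<lambda>\<omega>. Z t \<omega> ^ 4)"
      using \<zeta>Z[of t] by (intro integral_cong_AE) auto
    then show "expectation (\<lambda>\<omega>. \<zeta> t \<omega> ^ 4) = expectation (\<lambda>\<omega>. Z 0 \<omega> ^ 4)" by (simp only: transferZ[of t])
  qed
  have \<zeta>1: "expectation (\<zeta> t) = 0" for t
  proof -
    have "expectation (\<zeta> t) = expectation (Z t)" using \<zeta>Z[of t] by (intro integral_cong_AE) auto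
    then show ?thesis by (simp add: Z1)
  qed
  have \<zeta>2: "expectation (\<lambda>\<omega>. (\<zeta> t \<omega>)\<^sup>2) = \<sigma>\<^sup>2" for t
  proof -
    have "expectation (\<lambda>\<omega>. (\<zeta> t \<omega>)\<^sup>2) = expectation (\<lambda>\<omega>. (Z t \<omega>)\<^sup>2)"
      using \<zeta>Z[of t] by (intro integral_cong_AE) auto
    then show ?thesis using Z2[of t] by (simp add: Z1)
  qed
  have X4: "integrable M (\<lambda>\<omega>. X t \<omega> ^ 4)" for t
  proof -
    have "integrable M (\<lambda>\<omega>. X 0 \<omega> ^ 4)"
    proof (rule fourth_moment_of_fixed_point_law[of "X 0" "X 1" "Z 1"])
      show "AE \<omega> in M. X 1 \<omega> = \<theta> * X 0 \<omega> + Z 1 \<omega>" using ar[of 1] by simp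
    qed (auto simp: lawX[of 1] \<theta> Z4)
    then show ?thesis using transfer(2)[of "\<lambda>y. y ^ 4" t] by simp
  qed
  have X2: "integrable M (\<lambda>\<omega>. (X t \<omega>)\<^sup>2)" for t
  proof -
    have "integrable M (\<lambda>\<omega>. ((X t \<omega>)\<^sup>2)\<^sup>2)" using X4[of t] by (simp flip: power_mult)
    then show ?thesis by (rule square_integrable_imp_integrable[rotated]) auto
  qed
  have \<zeta>2': "integrable M (\<lambda>\<omega>. (\<zeta> t \<omega>)\<^sup>2)" for t
  proof -
    have "integrable M (\<lambda>\<omega>. ((\<zeta> t \<omega>)\<^sup>2)\<^sup>2)" using \<zeta>4[of t] by (simp flip: power_mult)
    then show ?thesis by (rule square_integrable_imp_integrable[rotated]) auto
  qed
  define m where "m = expectation (\<lambda>\<omega>. (X 0 \<omega>)\<^sup>2)"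
  define \<kappa> where "\<kappa> = max (expectation (\<lambda>\<omega>. X 0 \<omega> ^ 4)) (expectation (\<lambda>\<omega>. Z 0 \<omega> ^ 4))"
  have mX: "expectation (\<lambda>\<omega>. (X t \<omega>)\<^sup>2) = m" for t unfolding m_def by (rule transfer(1)) measurable
  \<comment> \<open>Square the recursion: the cross term has mean zero, since \<open>X 0\<close> is
    independent of the centred residual at time 1.\<close>
  have m: "m = \<theta>\<^sup>2 * m + \<sigma>\<^sup>2"
  proof -
    have "indep_var borel (X 0) borel (\<zeta> 1)"
      by (rule indep_set_imp_indep_var[OF \<zeta>_ind[of 1]]) (auto intro!: XG measurable_vimage_algebra1)
    then have "expectation (\<lambda>\<omega>. X 0 \<omega> * \<zeta> 1 \<omega>) = expectation (X 0) * expectation (\<zeta> 1)"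
      by (rule indep_var_lebesgue_integral[OF _ square_integrable_imp_integrable[OF _ X2]
        square_integrable_imp_integrable[OF _ \<zeta>2']]) auto
    then have c: "expectation (\<lambda>\<omega>. X 0 \<omega> * \<zeta> 1 \<omega>) = 0" by (simp add: \<zeta>1)
    have i: "integrable M (\<lambda>\<omega>. X 0 \<omega> * \<zeta> 1 \<omega>)"
      by (rule integrable_mult_of_squares) (auto simp: X2 \<zeta>2')
    have "m = expectation (\<lambda>\<omega>. (X 1 \<omega>)\<^sup>2)" by (simp add: mX)
    also have "\<dots> = expectation (\<lambda>\<omega>. \<theta>\<^sup>2 * (X 0 \<omega>)\<^sup>2 + (2 * \<theta> * (X 0 \<omega> * \<zeta> 1 \<omega>) + (\<zeta> 1 \<omega>)\<^sup>2))"
      by (intro Bochner_Integration.integral_cong) (auto simp: \<zeta>_def power2_eq_square algebra_simps)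
    also have "\<dots> = \<theta>\<^sup>2 * m + \<sigma>\<^sup>2"
      using X2[of 0] i \<zeta>2'[of 1] by (simp add: c mX \<zeta>2)
    finally show ?thesis .
  qed
  have "ar1_process M (\<lambda>t. G (int t + 2)) (\<lambda>t. X (int t + 1)) (\<lambda>t. \<zeta> (int t + 2)) \<theta> \<sigma> m \<kappa>"
  proof (unfold_locales)
    fix t :: nat
    show "subalgebra M (G (int t + 2))" by (rule G_M)
    show "subalgebra (G (int (Suc t) + 2)) (G (int t + 2))" by (rule G_mono) simp
    show "X (int t + 1) \<in> borel_measurable (G (int t + 2))" by (rule XG) simp
    show "X (int (Suc t) + 1) \<omega> = \<theta> * X (int t + 1) \<omega> + \<zeta> (int t + 2) \<omega>" for \<omega>
    proof -
      have e: "int (Suc t) + 1 = int t + 2" "int t + 2 - 1 = int t + 1" by auto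
      show ?thesis unfolding \<zeta>_def e by simp
    qed
    show "indep_set (sets (G (int t + 2))) (sets (vimage_algebra (space M) (\<zeta> (int t + 2)) borel))" by (rule \<zeta>_ind)
    show "expectation (\<lambda>\<omega>. X (int t + 1) \<omega> ^ 4) \<le> \<kappa>"
      using transfer(1)[of "\<lambda>y. y ^ 4" "int t + 1"] by (simp add: \<kappa>_def)
    show "expectation (\<lambda>\<omega>. \<zeta> (int t + 2) \<omega> ^ 4) \<le> \<kappa>" by (simp add: \<zeta>4 \<kappa>_def)
  qed (auto simp: \<theta> X4 \<zeta>4 mX \<zeta>1 \<zeta>2 m[symmetric])
  moreover have "\<zeta> (int t + 2) = (\<lambda>\<omega>. X (int t + 2) \<omega> - \<theta> * X (int t + 1) \<omega>)" for t
  proof -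
    have e: "int t + 2 - 1 = int t + 1" by simp
    show ?thesis unfolding \<zeta>_def[abs_def] e ..
  qed
  ultimately show ?thesis unfolding G_def past_def by auto
qed

section \<open>Exchangeable weights\<close>

lemma exists_permutation_of_pair:
  assumes "a \<noteq> b" "s \<noteq> t" "a \<in> I" "b \<in> I" "s \<in> I" "t \<in> I"
  shows "\<exists>\<pi>. \<pi> permutes I \<and> \<pi> a = s \<and> \<pi> b = t"
proof -
  \<comment> \<open>The preimage of \<open>t\<close> under the transposition of \<open>a\<close> and
    \<open>s\<close>. Sending \<open>b\<close> to \<open>r\<close> first leaves \<open>a\<close>
    fixed, as \<open>r \<noteq> a\<close>; the second transposition then gives \<open>a\<close> to
    \<open>s\<close> and \<open>r\<close> to \<open>t\<close>.\<close>
  define r where "r = Transposition.transpose a s t"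
  have r: "r \<in> I" "r \<noteq> a" "Transposition.transpose a s r = t"
    using assms by (auto simp: r_def Transposition.transpose_def)
  have "(Transposition.transpose a s \<circ> Transposition.transpose b r) permutes I"
    using assms r by (intro permutes_compose permutes_swap_id) auto
  moreover have "(Transposition.transpose a s \<circ> Transposition.transpose b r) a = s" using assms r by (simp add: Transposition.transpose_def)
  moreover have "(Transposition.transpose a s \<circ> Transposition.transpose b r) b = t" using r by simp
  ultimately show ?thesis by blast
qed

lemma (in prob_space) row_exchangeable_pair:
  fixes f :: "real \<Rightarrow> real \<Rightarrow> real"
  assumes ex: "row_exchangeable M w" and w: "\<And>t. t \<in> {1..n} \<Longrightarrow> w n t \<in> borel_measurable M"
    and f: "(\<lambda>p. f (fst p) (snd p)) \<in> borel_measurable (borel \<Otimes>\<^sub>M borel)"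
    and st: "a \<noteq> b" "s \<noteq> t" "a \<in> {1..n}" "b \<in> {1..n}" "s \<in> {1..n}" "t \<in> {1..n}"
  shows "expectation (\<lambda>\<omega>. f (w n s \<omega>) (w n t \<omega>)) = expectation (\<lambda>\<omega>. f (w n a \<omega>) (w n b \<omega>))"
proof -
  obtain \<pi> where \<pi>: "\<pi> permutes {1..n}" "\<pi> a = s" "\<pi> b = t"
    using exists_permutation_of_pair[OF st] by blast
  let ?P = "\<Pi>\<^sub>M t\<in>{1..n}. borel :: real measure"
  have pm: "(\<lambda>\<omega>. \<lambda>t\<in>{1..n}. w n (\<pi> t) \<omega>) \<in> measurable M ?P"
    using w permutes_in_image[OF \<pi>(1)] by (intro measurable_restrict) blast
  have wm: "(\<lambda>\<omega>. \<lambda>t\<in>{1..n}. w n t \<omega>) \<in> measurable M ?P"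
    using w by (intro measurable_restrict) auto
  have "(\<lambda>v. (v a, v b)) \<in> measurable ?P (borel \<Otimes>\<^sub>M borel)"
    using st by (intro measurable_Pair measurable_component_singleton) auto
  from measurable_compose[OF this f] have fm: "(\<lambda>v. f (v a) (v b)) \<in> borel_measurable ?P" by simp
  have "expectation (\<lambda>\<omega>. f (w n s \<omega>) (w n t \<omega>))
      = (\<integral>v. f (v a) (v b) \<partial>distr M ?P (\<lambda>\<omega>. \<lambda>t\<in>{1..n}. w n (\<pi> t) \<omega>))"
    using st \<pi> by (subst integral_distr[OF pm fm]) simp
  also have "\<dots> = (\<integral>v. f (v a) (v b) \<partial>distr M ?P (\<lambda>\<omega>. \<lambda>t\<in>{1..n}. w n t \<omega>))"
    using ex \<pi>(1) unfolding row_exchangeable_def by auto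
  also have "\<dots> = expectation (\<lambda>\<omega>. f (w n a \<omega>) (w n b \<omega>))"
    using st by (subst integral_distr[OF wm fm]) simp
  finally show ?thesis .
qed

lemma (in prob_space) row_exchangeable_single:
  fixes f :: "real \<Rightarrow> real"
  assumes ex: "row_exchangeable M w" and w: "\<And>t. t \<in> {1..n} \<Longrightarrow> w n t \<in> borel_measurable M"
    and f: "f \<in> borel_measurable borel" and st: "s \<in> {1..n}" "t \<in> {1..n}"
  shows "expectation (\<lambda>\<omega>. f (w n s \<omega>)) = expectation (\<lambda>\<omega>. f (w n t \<omega>))"
proof (cases "s = t")
  case False
  have "(\<lambda>p. f (fst p)) \<in> borel_measurable (borel \<Otimes>\<^sub>M (borel :: real measure))"
    using f by measurable
  from row_exchangeable_pair[where f="\<lambda>u v. f u", OF ex w this, of t s s t] False st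
  show ?thesis by auto
qed simp

text \<open>A union bound over \<open>n\<close> entries, each estimated by Chebyshev with the second
  moment restricted to the tail beyond \<open>K\<close>: once
  \<open>\<delta> * sqrt n \<ge> K\<close>, the total is at most the tail moment divided by
  \<open>\<delta>^2\<close>. The full second moment would give a bounded total, not a vanishing
  one.\<close>

lemma (in prob_space) exchangeable_max_negligible:
  fixes W :: "nat \<Rightarrow> nat \<Rightarrow> 'a \<Rightarrow> real"
  assumes W[measurable]: "\<And>n t. W n t \<in> borel_measurable M"
    and W2: "\<And>n t. integrable M (\<lambda>\<omega>. (W n t \<omega>)\<^sup>2)"
    and same: "\<And>n t K. t \<in> {1..n} \<Longrightarrow> expectation (\<lambda>\<omega>. (W n t \<omega>)\<^sup>2 * indicator {\<omega>. \<bar>W n t \<omega>\<bar> > K} \<omega>)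
      = expectation (\<lambda>\<omega>. (W n 1 \<omega>)\<^sup>2 * indicator {\<omega>. \<bar>W n 1 \<omega>\<bar> > K} \<omega>)"
    and ui: "\<And>\<eta>. \<eta> > 0 \<Longrightarrow> \<exists>K. \<forall>\<^sub>F n in sequentially.
      expectation (\<lambda>\<omega>. (W n 1 \<omega>)\<^sup>2 * indicator {\<omega>. \<bar>W n 1 \<omega>\<bar> > K} \<omega>) < \<eta>"
    and \<delta>: "\<delta> > 0"
  shows "(\<lambda>n. prob {\<omega>\<in>space M. \<exists>t\<in>{1..n}. \<bar>W n t \<omega>\<bar> > \<delta> * sqrt n}) \<longlonglongrightarrow> 0"
proof (rule LIMSEQ_I)
  define h where "h n t K = expectation (\<lambda>\<omega>. (W n t \<omega>)\<^sup>2 * indicator {\<omega>. \<bar>W n t \<omega>\<bar> > K} \<omega>)" for n t K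
  have ind[measurable]: "(\<lambda>\<omega>. (W n t \<omega>)\<^sup>2 * indicator {\<omega>. \<bar>W n t \<omega>\<bar> > K} \<omega>) \<in> borel_measurable M" for n t K
  proof -
    have "(\<lambda>\<omega>. (W n t \<omega>)\<^sup>2 * indicator {\<omega>. \<bar>W n t \<omega>\<bar> > K} \<omega>) = (\<lambda>\<omega>. (W n t \<omega>)\<^sup>2 * indicat_real {y. \<bar>y\<bar> > K} (W n t \<omega>))"
      by (auto simp: indicator_def)
    also have "\<dots> \<in> borel_measurable M" by measurable
    finally show ?thesis .
  qed
  have int: "integrable M (\<lambda>\<omega>. (W n t \<omega>)\<^sup>2 * indicator {\<omega>. \<bar>W n t \<omega>\<bar> > K} \<omega>)" for n t K
    by (rule Bochner_Integration.integrable_bound[OF W2[of n t]]) (auto simp: indicator_def)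
  fix r :: real assume r: "r > 0"
  then have "\<delta>\<^sup>2 * r > 0" using \<delta> by simp
  from ui[OF this] obtain K where K: "\<forall>\<^sub>F n in sequentially. h n 1 K < \<delta>\<^sup>2 * r"
    unfolding h_def by blast
  have "filterlim (\<lambda>n. \<delta> * sqrt (real n)) at_top sequentially"
    using \<delta> by (intro filterlim_tendsto_pos_mult_at_top[OF tendsto_const] filterlim_compose[OF sqrt_at_top] filterlim_real_sequentially)
  then have "\<forall>\<^sub>F n in sequentially. \<delta> * sqrt (real n) \<ge> K" by (simp add: filterlim_at_top)
  with K eventually_ge_at_top[of 1]
  have "\<forall>\<^sub>F n in sequentially. prob {\<omega>\<in>space M. \<exists>t\<in>{1..n}. \<bar>W n t \<omega>\<bar> > \<delta> * sqrt n} < r"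
  proof eventually_elim
    case (elim n)
    have n: "real n > 0" using elim by simp
    let ?A = "\<lambda>t. {\<omega>\<in>space M. \<bar>W n t \<omega>\<bar> > \<delta> * sqrt n}"
    have one: "prob (?A t) \<le> h n 1 K / (\<delta>\<^sup>2 * n)" if t: "t \<in> {1..n}" for t
    proof -
      have "\<delta>\<^sup>2 * n * prob (?A t) = expectation (\<lambda>\<omega>. \<delta>\<^sup>2 * n * indicator (?A t) \<omega>)" by simp
      also have "\<dots> \<le> h n t K" unfolding h_def
      proof (rule integral_mono[OF _ int])
        show "integrable M (\<lambda>\<omega>. \<delta>\<^sup>2 * n * indicator (?A t) \<omega>)"
          by (intro integrable_mult_right integrable_const_bound[of _ 1]) auto
        fix \<omega>
        show "\<delta>\<^sup>2 * n * indicator (?A t) \<omega> \<le> (W n t \<omega>)\<^sup>2 * indicator {\<omega>. \<bar>W n t \<omega>\<bar> > K} \<omega>"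
        proof (cases "\<omega> \<in> ?A t")
          case True
          have "(\<delta> * sqrt n)\<^sup>2 \<le> \<bar>W n t \<omega>\<bar>\<^sup>2" using True \<delta> by (intro power_mono) auto
          then show ?thesis using True elim by (simp add: power_mult_distrib)
        qed simp
      qed
      also have "\<dots> = h n 1 K" using same[OF t] by (simp add: h_def)
      finally show ?thesis using \<delta> n by (simp add: field_simps)
    qed
    have "prob {\<omega>\<in>space M. \<exists>t\<in>{1..n}. \<bar>W n t \<omega>\<bar> > \<delta> * sqrt n} = prob (\<Union>t\<in>{1..n}. ?A t)"
      by (rule arg_cong[where f=prob]) auto
    also have "\<dots> \<le> (\<Sum>t\<in>{1..n}. prob (?A t))" by (intro finite_measure_subadditive_finite) auto
    also have "\<dots> \<le> (\<Sum>t\<in>{1..n}. h n 1 K / (\<delta>\<^sup>2 * n))" by (intro sum_mono one)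
    also have "\<dots> = h n 1 K / \<delta>\<^sup>2" using n by simp
    also have "\<dots> < r" using elim \<delta> by (simp add: field_simps)
    finally show ?case .
  qed
  then show "\<exists>no. \<forall>n\<ge>no. norm (prob {\<omega>\<in>space M. \<exists>t\<in>{1..n}. \<bar>W n t \<omega>\<bar> > \<delta> * sqrt n} - 0) < r"
    by (simp add: eventually_sequentially)
qed

text \<open>Outside its row the array is arbitrary, so standardized weights are extended by 0 to
  make measurability and integrability hold for all indices. With \<open>\<rho>\<close> the raw
  covariance over \<open>sd^2\<close>, the product \<open>sd^2 * \<rho>\<close> is the raw
  covariance again and vanishes by (A3).\<close>

lemma (in prob_space) ar1_bootstrap_of_exchangeable_weights:
  fixes w :: "nat \<Rightarrow> nat \<Rightarrow> 'a \<Rightarrow> real"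
  assumes ar1: "ar1_process M F x z \<theta> \<sigma> m \<kappa>" and \<sigma>: "\<sigma> > 0"
    and wm: "\<And>n t. (n, t) \<in> array_index \<Longrightarrow> w n t \<in> borel_measurable M"
    and w2: "\<And>n t. (n, t) \<in> array_index \<Longrightarrow> integrable M (\<lambda>\<omega>. (w n t \<omega>)\<^sup>2)"
    and ex: "row_exchangeable M w"
    and A1: "\<And>n. n \<ge> 1 \<Longrightarrow> expectation (w n 1) = 1"
    and A2: "k > 0" "\<And>n. n \<ge> 1 \<Longrightarrow> variance (w n 1) > k" "(\<lambda>n. variance (w n 1)) \<in> o(\<lambda>n. real n)"
    and A3: "(\<lambda>n. covariance M (w n 1) (w n 2)) \<in> O(\<lambda>n. 1 / real n)"
    and A4: "\<And>n j. (n, j) \<in> array_index \<Longrightarrow> expectation (std_weight M w n j) = 0"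
      "\<And>n j. (n, j) \<in> array_index \<Longrightarrow> expectation (\<lambda>\<omega>. (std_weight M w n j \<omega>)\<^sup>2) = 1"
      "converges_in_prob M (\<lambda>n \<omega>. 1 / real n * (\<Sum>j=1..n. (std_weight M w n j \<omega>)\<^sup>2)) 1"
      "((\<lambda>K::real. limsup (\<lambda>n. ereal (sqrt (expectation (\<lambda>\<omega>. (std_weight M w n 1 \<omega>)\<^sup>2 *
          indicator {\<omega>. \<bar>std_weight M w n 1 \<omega>\<bar> > K} \<omega>))))) \<longlongrightarrow> 0) at_top"
  shows "ar1_bootstrap M F x z \<theta> \<sigma> m \<kappa> M (\<lambda>n t \<omega>. if t \<in> {1..n} then std_weight M w n t \<omega> else 0)
    (weight_sd M w) (\<lambda>n. covariance M (w n 1) (w n 2) / (weight_sd M w n)\<^sup>2)"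
proof -
  interpret ar1_process M F x z \<theta> \<sigma> m \<kappa> by (rule ar1)
  define W where "W n t \<omega> = (if t \<in> {1..n} then std_weight M w n t \<omega> else 0)" for n t \<omega>
  define sd where "sd = weight_sd M w"
  define cv where "cv n = covariance M (w n 1) (w n 2)" for n
  have idx: "(n, t) \<in> array_index \<longleftrightarrow> t \<in> {1..n}" for n t by (auto simp: array_index_def)
  have [measurable]: "w n t \<in> borel_measurable M" if "t \<in> {1..n}" for n t using wm that idx by blast
  have w1: "integrable M (w n t)" if "t \<in> {1..n}" for n t
    using that w2[unfolded idx, OF that] by (intro square_integrable_imp_integrable[of "w n t"]) auto
  have W_eq: "W n t = (\<lambda>\<omega>. (w n t \<omega> - 1) / sd n)" if "t \<in> {1..n}" for n t
    using that by (auto simp: W_def sd_def std_weight_def fun_eq_iff)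
  have W_0: "W n t = (\<lambda>\<omega>. 0)" if "t \<notin> {1..n}" for n t
    using that by (auto simp: W_def fun_eq_iff)
  have Wm[measurable]: "W n t \<in> borel_measurable M" for n t
    by (cases "t \<in> {1..n}") (simp_all add: W_eq W_0)
  have W2: "integrable M (\<lambda>\<omega>. (W n t \<omega>)\<^sup>2)" for n t
  proof (cases "t \<in> {1..n}")
    case True
    have "integrable M (\<lambda>\<omega>. ((w n t \<omega>)\<^sup>2 - 2 * w n t \<omega> + 1) / (sd n)\<^sup>2)"
      using w2[unfolded idx, OF True] w1[OF True] by simp
    moreover have "(W n t \<omega>)\<^sup>2 = ((w n t \<omega>)\<^sup>2 - 2 * w n t \<omega> + 1) / (sd n)\<^sup>2" for \<omega>
      unfolding W_eq[OF True] by (simp add: power_divide power2_diff)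
    ultimately show ?thesis by simp
  qed (simp add: W_0)
  have var: "(sd n)\<^sup>2 = variance (w n 1)" for n
    by (simp add: sd_def weight_sd_def integral_nonneg)
  have sd: "sd n > 0" "(sd n)\<^sup>2 > k" if "n \<ge> 1" for n
  proof -
    show "(sd n)\<^sup>2 > k" using A2(2)[OF that] var by simp
    have "variance (w n 1) > 0" using A2(1) A2(2)[OF that] by linarith
    then show "sd n > 0" by (simp add: sd_def weight_sd_def)
  qed
  have w_mean: "expectation (w n t) = 1" if t: "t \<in> {1..n}" for n t
  proof -
    have n: "n \<ge> 1" using t by simp
    have "expectation (W n t) = 0" using A4(1)[of n t] t unfolding idx W_def by simp
    also have "expectation (W n t) = (expectation (w n t) - 1) / sd n"
      unfolding W_eq[OF t] using w1[OF t] by (simp add: prob_space)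
    finally show ?thesis using sd(1)[OF n] by simp
  qed
  have W_cov: "expectation (\<lambda>\<omega>. W n s \<omega> * W n t \<omega>) = cv n / (sd n)\<^sup>2"
    if st: "s \<in> {1..n}" "t \<in> {1..n}" "s \<noteq> t" for n s t
  proof -
    have n: "1 \<in> {1..n}" "2 \<in> {1..n}" using st by auto
    let ?f = "\<lambda>u v. (u - 1) / sd n * ((v - 1) / sd n)"
    have "expectation (\<lambda>\<omega>. W n s \<omega> * W n t \<omega>) = expectation (\<lambda>\<omega>. ?f (w n s \<omega>) (w n t \<omega>))"
      using st by (simp add: W_eq)
    also have "\<dots> = expectation (\<lambda>\<omega>. ?f (w n 1 \<omega>) (w n 2 \<omega>))"
      using st n by (intro row_exchangeable_pair[OF ex]) auto
    also have "\<dots> = expectation (\<lambda>\<omega>. (w n 1 \<omega> - 1) * (w n 2 \<omega> - 1)) / (sd n)\<^sup>2"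
      by (simp add: power2_eq_square)
    also have "expectation (\<lambda>\<omega>. (w n 1 \<omega> - 1) * (w n 2 \<omega> - 1)) = cv n"
      unfolding cv_def covariance_def w_mean[OF n(1)] w_mean[OF n(2)] ..
    finally show ?thesis .
  qed
  have cv: "cv \<longlonglongrightarrow> 0"
  proof -
    obtain c where c: "\<forall>\<^sub>F n in sequentially. norm (cv n) \<le> c * norm (1 / real n)"
      using A3 unfolding cv_def[symmetric] by (elim landau_o.bigE) auto
    have "(\<lambda>n. c * (1 / real n)) \<longlonglongrightarrow> c * 0" by (intro tendsto_intros lim_1_over_n)
    then have l: "(\<lambda>n. c * norm (1 / real n)) \<longlonglongrightarrow> 0" by simp
    show ?thesis by (rule Lim_null_comparison[OF c l])
  qed
  have "ar1_bootstrap M F x z \<theta> \<sigma> m \<kappa> M W sd (\<lambda>n. cv n / (sd n)\<^sup>2)"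
  proof (unfold_locales)
    show "expectation (\<lambda>p. (W n t p)\<^sup>2) = 1" if "t \<in> {1..n}" for n t
      using A4(2)[of n t] that unfolding idx W_def by simp
    show "expectation (\<lambda>p. W n s p * W n t p) = cv n / (sd n)\<^sup>2"
      if "s \<in> {1..n}" "t \<in> {1..n}" "s \<noteq> t" for n s t by (rule W_cov[OF that])
    have "(\<Sum>j=1..n. (W n j \<omega>)\<^sup>2) = (\<Sum>j=1..n. (std_weight M w n j \<omega>)\<^sup>2)" for n \<omega>
      by (intro sum.cong) (auto simp: W_def)
    then show "converges_in_prob M (\<lambda>n p. 1 / real n * (\<Sum>j=1..n. (W n j p)\<^sup>2)) 1" using A4(3) by simp
    show "sd n > 0" if "n \<ge> 1" for n by (rule sd(1)[OF that])
    show "(\<lambda>n. (sd n)\<^sup>2 / real n) \<longlonglongrightarrow> 0" unfolding var by (rule smalloD_tendsto[OF A2(3)])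
    \<comment> \<open>Here the lower bound \<open>k\<close> on the variance enters: dividing by
      \<open>(sd n)^2\<close> costs at most a factor \<open>1 / k\<close>.\<close>
    have "\<forall>\<^sub>F n in sequentially. norm (cv n / (sd n)\<^sup>2) \<le> norm (cv n) * (1 / k)"
      using eventually_ge_at_top[of 1]
    proof eventually_elim
      case (elim n)
      have "norm (cv n) / (sd n)\<^sup>2 \<le> norm (cv n) / k"
        using sd[OF elim] A2(1) by (intro divide_left_mono) auto
      then show ?case by (simp add: norm_divide)
    qed
    moreover have "(\<lambda>n. norm (cv n) * (1 / k)) \<longlonglongrightarrow> 0"
      using tendsto_mult[OF tendsto_norm[OF cv] tendsto_const, of "1 / k"] by simp
    ultimately show "(\<lambda>n. cv n / (sd n)\<^sup>2) \<longlonglongrightarrow> 0" by (rule Lim_null_comparison)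
    show "(\<lambda>n. (sd n)\<^sup>2 * (cv n / (sd n)\<^sup>2)) \<longlonglongrightarrow> 0"
    proof (rule Lim_transform_eventually[OF cv])
      show "\<forall>\<^sub>F n in sequentially. cv n = (sd n)\<^sup>2 * (cv n / (sd n)\<^sup>2)"
        using eventually_ge_at_top[of 1] by eventually_elim (use sd in force)
    qed
    fix \<delta> :: real assume \<delta>: "\<delta> > 0"
    show "(\<lambda>n. prob {p\<in>space M. \<exists>t\<in>{1..n}. \<bar>W n t p\<bar> > \<delta> * sqrt n}) \<longlonglongrightarrow> 0"
    proof (rule exchangeable_max_negligible[OF Wm W2 _ _ \<delta>])
      fix n t :: nat and K :: real assume t: "t \<in> {1..n}"
      then have one: "1 \<in> {1..n}" by auto
      let ?f = "\<lambda>u. ((u - 1) / sd n)\<^sup>2 * indicat_real {u. \<bar>(u - 1) / sd n\<bar> > K} u"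
      have e: "expectation (\<lambda>\<omega>. (W n s \<omega>)\<^sup>2 * indicator {\<omega>. \<bar>W n s \<omega>\<bar> > K} \<omega>) = expectation (\<lambda>\<omega>. ?f (w n s \<omega>))"
        if "s \<in> {1..n}" for s
        unfolding W_eq[OF that] by (intro Bochner_Integration.integral_cong) (auto simp: indicator_def)
      show "expectation (\<lambda>\<omega>. (W n t \<omega>)\<^sup>2 * indicator {\<omega>. \<bar>W n t \<omega>\<bar> > K} \<omega>)
          = expectation (\<lambda>\<omega>. (W n 1 \<omega>)\<^sup>2 * indicator {\<omega>. \<bar>W n 1 \<omega>\<bar> > K} \<omega>)"
        unfolding e[OF t] e[OF one] by (rule row_exchangeable_single[OF ex _ _ t one]) auto
    next
      fix \<eta> :: real assume \<eta>: "\<eta> > 0"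
      let ?g = "\<lambda>n K. expectation (\<lambda>\<omega>. (std_weight M w n 1 \<omega>)\<^sup>2 * indicator {\<omega>. \<bar>std_weight M w n 1 \<omega>\<bar> > K} \<omega>)"
      \<comment> \<open>The iterated limit supplies one level \<open>K\<close> at which the tail
        moment is below \<open>\<eta>\<close> for all large \<open>n\<close>.\<close>
      have "\<forall>\<^sub>F K in at_top. limsup (\<lambda>n. ereal (sqrt (?g n K))) < ereal (sqrt \<eta>)"
        using \<eta> by (intro order_tendstoD(2)[OF A4(4)]) simp
      then obtain K where "limsup (\<lambda>n. ereal (sqrt (?g n K))) < ereal (sqrt \<eta>)"
        using eventually_happens'[OF trivial_limit_at_top_linorder] by blast
      then have "\<forall>\<^sub>F n in sequentially. ereal (sqrt (?g n K)) < ereal (sqrt \<eta>)" by (rule Limsup_lessD)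
      with eventually_ge_at_top[of 1]
      have "\<forall>\<^sub>F n in sequentially. expectation (\<lambda>\<omega>. (W n 1 \<omega>)\<^sup>2 * indicator {\<omega>. \<bar>W n 1 \<omega>\<bar> > K} \<omega>) < \<eta>"
        by eventually_elim (simp add: W_def)
      then show "\<exists>K. \<forall>\<^sub>F n in sequentially. expectation (\<lambda>\<omega>. (W n 1 \<omega>)\<^sup>2 * indicator {\<omega>. \<bar>W n 1 \<omega>\<bar> > K} \<omega>) < \<eta>" by blast
    qed
  qed (auto simp: \<sigma> W2)
  then show ?thesis unfolding W_def sd_def cv_def by simp
qed

section \<open>Return to the original probability space\<close>

lemma sum_from_2_to_n:
  fixes f :: "nat \<Rightarrow> 'b::comm_monoid_add"
  shows "(\<Sum>t=2..n. f t) = (\<Sum>s<n-1. f (s + 2))"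
  by (rule sum.reindex_bij_witness[of _ "\<lambda>s. s + 2" "\<lambda>j. j - 2"]) (auto simp: le_add_diff_inverse2 simp del: add_2_eq_Suc')

lemma normal_cdf_standardize:
  assumes N: "prob_space N" and Y: "distributed N lborel Y (normal_density 0 s)" and s: "s > 0"
  shows "measure N {y \<in> space N. Y y \<le> x} = cdf std_normal_distribution (x / s)"
proof -
  interpret N: prob_space N by fact
  have D: "distributed N lborel (\<lambda>y. (Y y - 0) / s) std_normal_density"
    using Y N.normal_standard_normal_convert[OF s, of Y 0] by simp
  have m: "(\<lambda>y. (Y y - 0) / s) \<in> borel_measurable N" using distributed_measurable[OF D] by simp
  have "cdf std_normal_distribution (x / s) = measure (distr N lborel (\<lambda>y. (Y y - 0) / s)) {..x / s}"
    unfolding cdf_def distributed_distr_eq_density[OF D] ..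
  also have "\<dots> = measure N {y \<in> space N. Y y \<le> x}"
    using s m by (subst measure_distr) (auto simp: vimage_def Int_def conj_commute divide_le_cancel)
  finally show ?thesis by simp
qed

text \<open>\<open>fst q\<close> is the weight array, \<open>snd q\<close> are the observations.\<close>

definition ls_contrast :: "nat \<Rightarrow> real \<Rightarrow> (nat \<times> nat \<Rightarrow> real) \<times> (int \<Rightarrow> real) \<Rightarrow> real" where
  "ls_contrast n s q = sqrt (real n) * inverse s *
    ((\<Sum>t=2..n. fst q (n, t) * snd q (int t) * snd q (int t - 1)) / (\<Sum>t=2..n. fst q (n, t) * (snd q (int t - 1))\<^sup>2)
     - (\<Sum>t=2..n. snd q (int t) * snd q (int t - 1)) / (\<Sum>t=2..n. (snd q (int t - 1))\<^sup>2))"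

lemma ls_contrast_measurable:
  "ls_contrast n s \<in> borel_measurable ((\<Pi>\<^sub>M p\<in>array_index. borel) \<Otimes>\<^sub>M (\<Pi>\<^sub>M t\<in>{1..int n}. borel))"
proof -
  let ?S = "(\<Pi>\<^sub>M p\<in>array_index. borel :: real measure) \<Otimes>\<^sub>M (\<Pi>\<^sub>M t\<in>{1..int n}. borel :: real measure)"
  \<comment> \<open>For \<open>t\<close> from 2 to \<open>n\<close> both \<open>t\<close> and
    \<open>t - 1\<close> lie among the observed times, so the coordinates are measurable.\<close>
  have [measurable]: "(\<lambda>q. fst q (n, t)) \<in> borel_measurable ?S" "(\<lambda>q. snd q (int t)) \<in> borel_measurable ?S"
    "(\<lambda>q. snd q (int t - 1)) \<in> borel_measurable ?S" if "t \<in> {2..n}" for t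
    using that by (auto intro!: measurable_compose[OF measurable_fst measurable_component_singleton]
      measurable_compose[OF measurable_snd measurable_component_singleton] simp: array_index_def)
  show ?thesis unfolding ls_contrast_def by measurable
qed

theorem theorem1:
  fixes M :: "'a measure" and N :: "'b measure"
    and X Z :: "int \<Rightarrow> 'a \<Rightarrow> real"
    and w :: "nat \<Rightarrow> nat \<Rightarrow> 'a \<Rightarrow> real"
    and Y :: "'b \<Rightarrow> real"
    and \<theta> \<sigma> k x :: real
  assumes "prob_space M"
    and "\<bar>\<theta>\<bar> < 1"
    and "\<And>t. X t \<in> borel_measurable M"
    and "strictly_stationary M X"
    and "\<And>t. AE \<omega> in M. X t \<omega> = \<theta> * X (t - 1) \<omega> + Z t \<omega>"
    and "\<And>t. indep_elements M borel (Z t)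
                (\<Pi>\<^sub>M s\<in>{..<t}. borel) (\<lambda>\<omega>. \<lambda>s\<in>{..<t}. X s \<omega>)"
    and "\<And>t. Z t \<in> borel_measurable M"
    and "prob_space.indep_vars M (\<lambda>_. borel) Z UNIV"
    and "\<And>s t. distr M borel (Z s) = distr M borel (Z t)"
    and "\<And>t. integrable M (\<lambda>\<omega>. Z t \<omega> ^ 4)"
    and "\<And>t. prob_space.expectation M (Z t) = 0"
    and "\<And>t. prob_space.variance M (Z t) = \<sigma>\<^sup>2"
    and "\<sigma> > 0"
    and "\<And>n t. (n, t) \<in> array_index \<Longrightarrow> w n t \<in> borel_measurable M"
    and "\<And>n t. (n, t) \<in> array_index \<Longrightarrow> integrable M (\<lambda>\<omega>. (w n t \<omega>)\<^sup>2)"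
    and "row_exchangeable M w"
    and "indep_elements M
           (\<Pi>\<^sub>M p\<in>array_index. borel) (\<lambda>\<omega>. \<lambda>p\<in>array_index. w (fst p) (snd p) \<omega>)
           (\<Pi>\<^sub>M t\<in>UNIV. borel) (\<lambda>\<omega> t. X t \<omega>)"
    and A1: "\<And>n. n \<ge> 1 \<Longrightarrow> prob_space.expectation M (w n 1) = 1"
    and A2: "k > 0"
            "\<And>n. n \<ge> 1 \<Longrightarrow> prob_space.variance M (w n 1) > k"
            "(\<lambda>n. prob_space.variance M (w n 1)) \<in> o(\<lambda>n. real n)"
    and A3: "(\<lambda>n. covariance M (w n 1) (w n 2)) \<in> O(\<lambda>n. 1 / real n)"
    and A4: "\<And>n j. (n, j) \<in> array_index \<Longrightarrow>
               prob_space.expectation M (std_weight M w n j) = 0"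
            "\<And>n j. (n, j) \<in> array_index \<Longrightarrow>
               prob_space.expectation M (\<lambda>\<omega>. (std_weight M w n j \<omega>)\<^sup>2) = 1"
            "converges_in_prob M
               (\<lambda>n \<omega>. 1 / real n * (\<Sum>j=1..n. (std_weight M w n j \<omega>)\<^sup>2)) 1"
            "\<And>j. j \<ge> 1 \<Longrightarrow>
               ((\<lambda>K::real. limsup (\<lambda>n. ereal (sqrt (prob_space.expectation M
                   (\<lambda>\<omega>. (std_weight M w n j \<omega>)\<^sup>2 *
                        indicator {\<omega>. \<bar>std_weight M w n j \<omega>\<bar> > K} \<omega>)))))
                 \<longlongrightarrow> 0) at_top"
    \<comment> \<open>the limiting normal variable; note that \<open>normal_density\<close> takes the standard deviation\<close>
    and "prob_space N"
    and "distributed N lborel Y (normal_density 0 (sqrt (1 - \<theta>\<^sup>2)))"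
  shows "converges_in_prob M
           (\<lambda>n \<omega>. cond_prob_data M X n
                     (\<lambda>\<omega>'. sqrt (real n) * inverse (weight_sd M w n) *
                            (weighted_ls_estimator w X n \<omega>' - ls_estimator X n \<omega>') \<le> x) \<omega>
                  - measure N {y \<in> space N. Y y \<le> x})
           0"
proof -
  interpret prob_space M by fact
  have [measurable]: "X t \<in> borel_measurable M" for t by fact
  obtain m \<kappa> where ar1: "ar1_process M
    (\<lambda>t. vimage_algebra (space M) (\<lambda>\<omega>. \<lambda>s\<in>{..<int t + 2}. X s \<omega>) (\<Pi>\<^sub>M s\<in>{..<int t + 2}. borel))
    (\<lambda>t. X (int t + 1)) (\<lambda>t \<omega>. X (int t + 2) \<omega> - \<theta> * X (int t + 1) \<omega>) \<theta> \<sigma> m \<kappa>"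
    using stationary_ar1_process[of \<theta> X Z \<sigma>] assms by blast
  define W where "W n t \<omega> = (if t \<in> {1..n} then std_weight M w n t \<omega> else 0)" for n t \<omega>
  have boot: "ar1_bootstrap M
    (\<lambda>t. vimage_algebra (space M) (\<lambda>\<omega>. \<lambda>s\<in>{..<int t + 2}. X s \<omega>) (\<Pi>\<^sub>M s\<in>{..<int t + 2}. borel))
    (\<lambda>t. X (int t + 1)) (\<lambda>t \<omega>. X (int t + 2) \<omega> - \<theta> * X (int t + 1) \<omega>) \<theta> \<sigma> m \<kappa> M W
    (weight_sd M w) (\<lambda>n. covariance M (w n 1) (w n 2) / (weight_sd M w n)\<^sup>2)"
    unfolding W_def[abs_def]
    by (rule ar1_bootstrap_of_exchangeable_weights[OF ar1 \<open>\<sigma> > 0\<close> _ _ \<open>row_exchangeable M w\<close> A1 A2 A3 A4(1-3) A4(4)])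
      (simp_all add: assms)
  \<comment> \<open>Both factors of the product are \<open>M\<close> itself:
    \<open>R n \<omega>' \<omega>\<close> combines the weights at \<open>\<omega>'\<close> with the
    data at \<open>\<omega>\<close>.\<close>
  interpret ar1_bootstrap M
    "\<lambda>t. vimage_algebra (space M) (\<lambda>\<omega>. \<lambda>s\<in>{..<int t + 2}. X s \<omega>) (\<Pi>\<^sub>M s\<in>{..<int t + 2}. borel)"
    "\<lambda>t. X (int t + 1)" "\<lambda>t \<omega>. X (int t + 2) \<omega> - \<theta> * X (int t + 1) \<omega>" \<theta> \<sigma> m \<kappa> M W
    "weight_sd M w" "\<lambda>n. covariance M (w n 1) (w n 2) / (weight_sd M w n)\<^sup>2"
    by (rule boot)
  let ?SW = "\<Pi>\<^sub>M p\<in>array_index. borel :: real measure"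
  let ?SX = "\<lambda>n. \<Pi>\<^sub>M t\<in>{1..int n}. borel :: real measure"
  define U where "U \<omega> = (\<lambda>p\<in>array_index. w (fst p) (snd p) \<omega>)" for \<omega>
  define V where "V n \<omega> = (\<lambda>t\<in>{1..int n}. X t \<omega>)" for n \<omega>
  have ind: "indep_elements M ?SW U (?SX n) (V n)" for n
  proof -
    have "indep_elements M ?SW U (\<Pi>\<^sub>M t\<in>UNIV. borel) (\<lambda>\<omega> t. X t \<omega>)"
      using assms(17) by (simp add: U_def[abs_def])
    from indep_elements_compose[OF this measurable_restrict_subset[of "{1..int n}"] \<open>prob_space M\<close>]
    show ?thesis by (simp add: V_def[abs_def])
  qed
  have UV: "U \<in> measurable M ?SW" "V n \<in> measurable M (?SX n)" for n
    using ind[of n] by (auto simp: indep_elements_def)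
  define A where "A n = {q \<in> space (?SW \<Otimes>\<^sub>M ?SX n). ls_contrast n (weight_sd M w n) q \<le> x}" for n
  have A: "A n \<in> sets (?SW \<Otimes>\<^sub>M ?SX n)" for n
    unfolding A_def using ls_contrast_measurable by measurable
  have inA: "(U \<omega>', V n \<omega>) \<in> A n \<longleftrightarrow> ls_contrast n (weight_sd M w n) (U \<omega>', V n \<omega>) \<le> x"
    if "\<omega>' \<in> space M" "\<omega> \<in> space M" for n \<omega>' \<omega>
    using that measurable_space[OF UV(1)] measurable_space[OF UV(2)] by (auto simp: A_def space_pair_measure)
  have Ut: "U \<omega> (n, t) = w n t \<omega>" and Vt: "V n \<omega> (int t) = X (int t) \<omega>" "V n \<omega> (int t - 1) = X (int t - 1) \<omega>"
    if "t \<in> {2..n}" for n t \<omega>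
    using that by (auto simp: U_def V_def array_index_def)
  have stat: "ls_contrast n (weight_sd M w n) (U \<omega>, V n \<omega>)
      = sqrt (real n) * inverse (weight_sd M w n) * (weighted_ls_estimator w X n \<omega> - ls_estimator X n \<omega>)" for n \<omega>
    unfolding ls_contrast_def weighted_ls_estimator_def ls_estimator_def by (simp only: Ut Vt fst_conv snd_conv cong: sum.cong)
  \<comment> \<open>Recovering \<open>w\<close> from \<open>1 + sd * W\<close> needs a nonzero
    standard deviation, hence \<open>n \<ge> 1\<close>.\<close>
  have R_contrast: "R n \<omega>' \<omega> = ls_contrast n (weight_sd M w n) (U \<omega>', V n \<omega>)" if n: "n \<ge> 1" for n \<omega>' \<omega>
  proof -
    have wW: "1 + weight_sd M w n * W n (s + 2) \<omega>' = U \<omega>' (n, s + 2)" if "s \<in> {..<n - 1}" for s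
      using that sd_pos[OF n] Ut[of "s + 2" n \<omega>'] by (simp add: W_def std_weight_def)
    have v: "V n \<omega> (int (s + 2)) = X (int (Suc s) + 1) \<omega>" "V n \<omega> (int (s + 2) - 1) = X (int s + 1) \<omega>" if "s \<in> {..<n - 1}" for s
      using Vt[of "s + 2" n \<omega>] that by (simp_all add: algebra_simps)
    show ?thesis
      unfolding R_def ls_contrast_def sum_from_2_to_n fst_conv snd_conv
      by (simp only: wW v cong: sum.cong)
  qed
  have data: "data_algebra M X n = vimage_algebra (space M) (V n) (?SX n)" for n
    by (simp add: data_algebra_def V_def[abs_def])
  define G where "G n = cond_prob_data M X n (\<lambda>\<omega>'. sqrt (real n) * inverse (weight_sd M w n) *
    (weighted_ls_estimator w X n \<omega>' - ls_estimator X n \<omega>') \<le> x)" for n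
  have G_eq: "AE \<omega> in M. G n \<omega> = prob {\<omega>' \<in> space M. R n \<omega>' \<omega> \<le> x}" if n: "n \<ge> 1" for n
  proof -
    have "{\<omega> \<in> space M. sqrt (real n) * inverse (weight_sd M w n) *
        (weighted_ls_estimator w X n \<omega> - ls_estimator X n \<omega>) \<le> x} = {\<omega> \<in> space M. (U \<omega>, V n \<omega>) \<in> A n}"
      using inA by (auto simp: stat)
    then have "G n = real_cond_exp M (vimage_algebra (space M) (V n) (?SX n)) (indicator {\<omega> \<in> space M. (U \<omega>, V n \<omega>) \<in> A n})"
      by (simp add: G_def cond_prob_data_def data)
    then have "AE \<omega> in M. G n \<omega> = prob {\<omega>' \<in> space M. (U \<omega>', V n \<omega>) \<in> A n}"
      using real_cond_exp_indep_elements[OF \<open>prob_space M\<close> ind A] by simp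
    then show ?thesis
    proof (rule AE_mp, intro AE_I2 impI)
      fix \<omega> assume \<omega>: "\<omega> \<in> space M" and eq: "G n \<omega> = prob {\<omega>' \<in> space M. (U \<omega>', V n \<omega>) \<in> A n}"
      have "{\<omega>' \<in> space M. (U \<omega>', V n \<omega>) \<in> A n} = {\<omega>' \<in> space M. R n \<omega>' \<omega> \<le> x}"
        using inA \<omega> by (auto simp: R_contrast[OF n])
      then show "G n \<omega> = prob {\<omega>' \<in> space M. R n \<omega>' \<omega> \<le> x}" using eq by simp
    qed
  qed
  define s where "s = sqrt (1 - \<theta>\<^sup>2)"
  have s: "s > 0" using theta2 by (simp add: s_def)
  \<comment> \<open>From \<open>(1 - \<theta>^2) * m = \<sigma>^2\<close> one gets
    \<open>c0 / m = \<sigma> / sqrt m = sqrt (1 - \<theta>^2)\<close>, the standard deviation of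
    \<open>Y\<close>.\<close>
  have limit: "cdf std_normal_distribution (x / (c0 / m)) = measure N {y \<in> space N. Y y \<le> x}"
  proof -
    have "(1 - \<theta>\<^sup>2) * m = \<sigma>\<^sup>2" using m by (simp add: algebra_simps)
    then have "s * sqrt m = \<sigma>"
      unfolding s_def real_sqrt_mult[symmetric] using sigma_pos by simp
    then have "c0 = s * m" using m_pos by (auto simp: c0_def)
    then have "c0 / m = s" using m_pos by simp
    then show ?thesis using normal_cdf_standardize[OF \<open>prob_space N\<close> _ s, of Y x] assms(28) by (simp add: s_def)
  qed
  let ?p = "measure N {y \<in> space N. Y y \<le> x}"
  have [measurable]: "G n \<in> borel_measurable M" for n
    unfolding G_def cond_prob_data_def by (rule borel_measurable_cond_exp2)
  have Rm[measurable]: "(\<lambda>\<omega>. prob {\<omega>' \<in> space M. R n \<omega>' \<omega> \<le> x}) \<in> borel_measurable M" for n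
  proof -
    have [measurable (raw)]: "(\<lambda>q. R n (f q) (g q)) \<in> borel_measurable L"
      if "f \<in> measurable L M" "g \<in> measurable L M" for L :: "'z measure" and f g
      using measurable_compose[OF measurable_Pair[OF that] R_measurable] by simp
    show ?thesis by measurable
  qed
  have "converges_in_prob M (\<lambda>n \<omega>. prob {\<omega>' \<in> space M. R n \<omega>' \<omega> \<le> x} - ?p) 0"
    using R_conditional_clt[of x] unfolding limit converges_in_prob_def by simp
  then have "converges_in_prob M (\<lambda>n \<omega>. G n \<omega> - ?p) 0"
  proof (rule converges_in_prob_cong[rotated])
    show "\<forall>\<^sub>F n in sequentially. AE \<omega> in M. G n \<omega> - ?p = prob {\<omega>' \<in> space M. R n \<omega>' \<omega> \<le> x} - ?p"
      using eventually_ge_at_top[of 1] by eventually_elim (use G_eq in auto)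
  qed measurable
  then show ?thesis by (simp add: G_def)
qed

end
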